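(* Let $\mathbb F\in\{\mathbb R,\mathbb C\}$, let $c\ge 4$, and consider a $(c-1)$-division problem with row blocks $\{D_1,\dots,D_{k+1}\}$ over $\mathbb F$. For an ordered collection $(j_1,\dots,j_c)$ of distinct indices in $\{1,\dots,k+1\}$ put $$\mathrm{Cov}^{(j_1,\dots,j_c)}=D_{j_1}^T\bar D_{j_1}D_{j_2}^T\bar D_{j_2}\cdots D_{j_c}^T\bar D_{j_c}D_{j_1}^T\bar D_{j_1}.$$ Then: 1. The problem is also a $c$-division problem if and only if for every ordered collection $(j_1,\dots,j_c)$ of distinct indices, $\mathrm{Cov}^{(j_1,\dots,j_c)}$ has at most one nonzero eigenvalue. 2. The problem is not a $c$-division problem if and only if there is an ordered collection $(j_1,\dots,j_c)$ of distinct indices such that $\mathrm{Cov}^{(j_1,\dots,j_c)}$ has at least two nonzero eigenvalues. (Eigenvalues are counted without multiplicity.)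
   Context: $\mathcal R(\cdot)$ is the column space over $\mathbb F$, $\bar{\ }$ is entrywise conjugation, and orthogonality is with respect to the standard inner product. Eigenvalues of matrices are taken in $\mathbb{C}$. Row separation problem. It is given by row blocks $D_j\in\mathbb F^{r_j\times\hat d}$ ($j=1,\dots,k+1$), each of full row rank, stacked into $D=[D_1^T\cdots D_{k+1}^T]^T$. A solution consists of a permutation matrix $E$, unitary (orthogonal if $\mathbb F=\mathbb R$) matrices $H_j$ of size $r_j$, a unitary (orthogonal if $\mathbb F=\mathbb R$) $L$ of size $\hat d$ and a block diagonal matrix (any number $g$ of blocks) with $E\,\mathrm{diag}\{H_1,\dots,H_{k+1}\}DL=\mathrm{diag}\{B_1,\dots,B_g\}$. A row separation subspace is a nonzero subspace $\mathcal S\subseteq\mathbb F^{\hat d}$ such that for some solution and some $t$, $\mathcal S=\mathcal R(\bar L (B_t')^T)$, where $B_t'=[0\ \cdots\ B_t\ \cdots\ 0]$ is the block row (with $\hat d$ columns) of $\mathrm{diag}\{B_1,\dots,B_g\}$ containing $B_t$. For $\{C\}\subset\{1,\dots,k+1\}$, the $\{C\}$-subset subproblem is the row separation problem with blocks $D_j$, $j\in\{C\}$. Division problems (eigenvalues and singular values are counted without multiplicity). 1-division: each $\bar D_jD_j^T$ has exactly one eigenvalue and each $\mathrm{rank}(D_j)\ge 2$. 2-division: it is 1-division; each $\bar D_jD_{j'}^T$ has exactly one singular value, meaning that it is a scalar multiple (possibly zero) of a unitary matrix (for nonzero ones this forces $r_j=r_{j'}$); and the graph on $\{1,\dots,k+1\}$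 with an edge between $j\neq j'$ iff $\bar D_jD_{j'}^T\ne0$ is connected. 3-division: it is 2-division and for all $j,j',j''$ the matrix $D_j^T\bar D_jD_{j''}^T\bar D_{j''}D_{j'}^T\bar D_{j'}D_j^T\bar D_j$ has at most one nonzero eigenvalue. $c$-division ($c\ge4$): it is $(c-1)$-division and for every ordered collection $(j_1,\dots,j_c)$ of distinct indices, with $\{C\}=\{j_1,\dots,j_c\}$, and every $v\in\mathcal R(D_{j_1}^T)$ there is a row separation subspace $\mathcal S$ of the $\{C\}$-subset subproblem with $v\in\mathcal S$ and $\dim(\mathcal S\cap\mathcal R(D_{j_i}^T))=1$ for $i=1,\dots,c$. *)

theory Defs
  imports
    "Jordan_Normal_Form.Spectral_Radius"
    "Jordan_Normal_Form.Schur_Decomposition"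
    "Jordan_Normal_Form.DL_Rank"
begin

text \<open>
  The scalar field is either the reals or the complex numbers. The two cases are treated
  uniformly by a class of fields with conjugation together with an embedding into the complex
  numbers whose range is one of the two; up to isomorphism it has no other members than the
  instances \<open>real\<close> and \<open>complex\<close> below. The embedding is needed because eigenvalues of
  real matrices are taken in the complex numbers.
\<close>

class real_or_complex = conjugatable_field +
  fixes to_complex :: "'a \<Rightarrow> complex"
  assumes to_complex_one: "to_complex 1 = 1"
    and to_complex_add: "to_complex (x + y) = to_complex x + to_complex y"
    and to_complex_mult: "to_complex (x * y) = to_complex x * to_complex y"
    and to_complex_conjugate: "to_complex (conjugate x) = cnj (to_complex x)"
    and range_to_complex: "range to_complex = \<real> \<or> range to_complex = UNIV"

instantiation real :: real_or_complex
begin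
definition to_complex_real :: "real \<Rightarrow> complex" where
  "to_complex_real = complex_of_real"
instance
  by standard (auto simp: to_complex_real_def Reals_def)
end

instantiation complex :: real_or_complex
begin
definition to_complex_complex :: "complex \<Rightarrow> complex" where
  "to_complex_complex z = z"
instance
  by standard (auto simp: to_complex_complex_def image_def)
end

definition eigenvalues :: "'a::real_or_complex mat \<Rightarrow> complex set" where
  "eigenvalues M = spectrum (map_mat to_complex M)"

abbreviation mat_conj :: "'a::real_or_complex mat \<Rightarrow> 'a mat" where
  "mat_conj \<equiv> map_mat conjugate"

text \<open>Over the reals this says that the matrix is orthogonal.\<close>

definition unitary_mat :: "nat \<Rightarrow> 'a::real_or_complex mat \<Rightarrow> bool" where
  "unitary_mat n U \<longleftrightarrow>
     U \<in> carrier_mat n n \<and> U * mat_adjoint U = 1\<^sub>m n \<and> mat_adjoint U * U = 1\<^sub>m n"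

definition permutation_mat :: "nat \<Rightarrow> 'a::real_or_complex mat \<Rightarrow> bool" where
  "permutation_mat n E \<longleftrightarrow>
     (\<exists>p. p permutes {..<n} \<and> E = mat n n (\<lambda>(i, j). if p i = j then 1 else 0))"

definition column_space :: "'a::real_or_complex mat \<Rightarrow> 'a vec set" where
  "column_space A = vec_space.col_space (dim_row A) A"

definition mat_rank :: "'a::real_or_complex mat \<Rightarrow> nat" where
  "mat_rank A = vec_space.rank (dim_row A) A"

definition subspace_dim :: "nat \<Rightarrow> 'a::real_or_complex vec set \<Rightarrow> nat" where
  "subspace_dim n S = vectorspace.dim class_ring (module_vec TYPE('a) n \<lparr>carrier := S\<rparr>)"

section \<open>Row separation problems\<close>

text \<open>A problem is the list of its row blocks; \<open>d\<close> is the common number of columns.\<close>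

definition row_separation_problem :: "nat \<Rightarrow> 'a::real_or_complex mat list \<Rightarrow> bool" where
  "row_separation_problem d Ds \<longleftrightarrow> (\<forall>A \<in> set Ds. dim_col A = d \<and> mat_rank A = dim_row A)"

definition stack_rows :: "nat \<Rightarrow> 'a mat list \<Rightarrow> 'a mat" where
  "stack_rows d Ds = mat_of_rows d (concat (map rows Ds))"

definition row_separation_solution ::
  "nat \<Rightarrow> 'a::real_or_complex mat list \<Rightarrow> 'a mat \<Rightarrow> 'a mat list \<Rightarrow> 'a mat \<Rightarrow> 'a mat list \<Rightarrow> bool"
where
  "row_separation_solution d Ds E Hs L Bs \<longleftrightarrow>
     permutation_mat (sum_list (map dim_row Ds)) E \<and>
     length Hs = length Ds \<and>
     (\<forall>i < length Ds. unitary_mat (dim_row (Ds ! i)) (Hs ! i)) \<and>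
     unitary_mat d L \<and>
     E * diag_block_mat Hs * stack_rows d Ds * L = diag_block_mat Bs"

text \<open>The block row of the block diagonal matrix that contains the \<open>t\<close>-th block.\<close>

definition block_row :: "'a::zero mat list \<Rightarrow> nat \<Rightarrow> 'a mat" where
  "block_row Bs t =
     mat (dim_row (Bs ! t)) (dim_col (diag_block_mat Bs))
       (\<lambda>(i, j). diag_block_mat Bs $$ (sum_list (map dim_row (take t Bs)) + i, j))"

definition row_separation_subspace ::
  "nat \<Rightarrow> 'a::real_or_complex mat list \<Rightarrow> 'a vec set \<Rightarrow> bool"
where
  "row_separation_subspace d Ds S \<longleftrightarrow>
     S \<noteq> {0\<^sub>v d} \<and>
     (\<exists>E Hs L Bs t. row_separation_solution d Ds E Hs L Bs \<and> t < length Bs \<and>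
        S = column_space (mat_conj L * (block_row Bs t)\<^sup>T))"

section \<open>Division problems\<close>

text \<open>From here on the row blocks are \<open>D 1, \<dots>, D (k + 1)\<close>, each with \<open>d\<close> columns.\<close>

text \<open>The order in which the blocks of a subproblem are listed is irrelevant.\<close>

definition subset_subproblem :: "(nat \<Rightarrow> 'a mat) \<Rightarrow> nat set \<Rightarrow> 'a mat list" where
  "subset_subproblem D C = map D (sorted_list_of_set C)"

definition ordered_collection :: "nat \<Rightarrow> nat \<Rightarrow> nat list \<Rightarrow> bool" where
  "ordered_collection k c js \<longleftrightarrow> length js = c \<and> distinct js \<and> set js \<subseteq> {1..k + 1}"

abbreviation cov_factor :: "(nat \<Rightarrow> 'a::real_or_complex mat) \<Rightarrow> nat \<Rightarrow> 'a mat" where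
  "cov_factor D j \<equiv> (D j)\<^sup>T * mat_conj (D j)"

text \<open>For \<open>js = [j\<^sub>1, \<dots>, j\<^sub>c]\<close> this is the product of the factors of \<open>j\<^sub>1, \<dots>, j\<^sub>c, j\<^sub>1\<close>,
  in this order.\<close>

definition Cov :: "(nat \<Rightarrow> 'a::real_or_complex mat) \<Rightarrow> nat list \<Rightarrow> 'a mat" where
  "Cov D js = foldr (\<lambda>j M. cov_factor D j * M) js (cov_factor D (hd js))"

definition one_division :: "nat \<Rightarrow> (nat \<Rightarrow> 'a::real_or_complex mat) \<Rightarrow> bool" where
  "one_division k D \<longleftrightarrow>
     (\<forall>j \<in> {1..k + 1}. card (eigenvalues (mat_conj (D j) * (D j)\<^sup>T)) = 1 \<and> mat_rank (D j) \<ge> 2)"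

text \<open>A scalar multiple, possibly zero, of a unitary matrix, where a zero matrix need not be
  square.\<close>

definition one_singular_value :: "'a::real_or_complex mat \<Rightarrow> bool" where
  "one_singular_value M \<longleftrightarrow>
     M = 0\<^sub>m (dim_row M) (dim_col M) \<or> (\<exists>a U. unitary_mat (dim_row M) U \<and> M = a \<cdot>\<^sub>m U)"

definition incidence :: "nat \<Rightarrow> (nat \<Rightarrow> 'a::real_or_complex mat) \<Rightarrow> (nat \<times> nat) set" where
  "incidence k D =
     {(i, j). i \<in> {1..k + 1} \<and> j \<in> {1..k + 1} \<and> i \<noteq> j \<and>
        mat_conj (D i) * (D j)\<^sup>T \<noteq> 0\<^sub>m (dim_row (D i)) (dim_row (D j))}"

definition two_division :: "nat \<Rightarrow> (nat \<Rightarrow> 'a::real_or_complex mat) \<Rightarrow> bool" where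
  "two_division k D \<longleftrightarrow>
     (\<forall>i \<in> {1..k + 1}. \<forall>j \<in> {1..k + 1}. one_singular_value (mat_conj (D i) * (D j)\<^sup>T)) \<and>
     (\<forall>i \<in> {1..k + 1}. \<forall>j \<in> {1..k + 1}. (i, j) \<in> (incidence k D)\<^sup>*)"

text \<open>The indices need not be distinct here.\<close>

definition three_division :: "nat \<Rightarrow> (nat \<Rightarrow> 'a::real_or_complex mat) \<Rightarrow> bool" where
  "three_division k D \<longleftrightarrow>
     (\<forall>j \<in> {1..k + 1}. \<forall>j' \<in> {1..k + 1}. \<forall>j'' \<in> {1..k + 1}.
        card (eigenvalues (Cov D [j, j'', j']) - {0}) \<le> 1)"

definition collection_division ::
  "nat \<Rightarrow> nat \<Rightarrow> (nat \<Rightarrow> 'a::real_or_complex mat) \<Rightarrow> nat \<Rightarrow> bool"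
where
  "collection_division d k D c \<longleftrightarrow>
     (\<forall>js. ordered_collection k c js \<longrightarrow>
        (\<forall>v \<in> column_space ((D (hd js))\<^sup>T).
           \<exists>S. row_separation_subspace d (subset_subproblem D (set js)) S \<and> v \<in> S \<and>
               (\<forall>j \<in> set js. subspace_dim d (S \<inter> column_space ((D j)\<^sup>T)) = 1)))"

text \<open>The recursion adds, level by level, the condition that distinguishes \<open>c\<close>-division from
  \<open>(c - 1)\<close>-division; level \<open>0\<close> only says that the blocks form a row separation problem.\<close>

primrec division_problem ::
  "nat \<Rightarrow> nat \<Rightarrow> (nat \<Rightarrow> 'a::real_or_complex mat) \<Rightarrow> nat \<Rightarrow> bool"
where
  "division_problem d k D 0 \<longleftrightarrow> row_separation_problem d (map D [1..<k + 2])"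
| "division_problem d k D (Suc n) \<longleftrightarrow>
     division_problem d k D n \<and>
     (if n = 0 then one_division k D
      else if n = 1 then two_division k D
      else if n = 2 then three_division k D
      else collection_division d k D (Suc n))"

end

theory Submission
  imports Defs
begin

text \<open>
  Write \<open>V j\<close> for the column space of \<open>(D j)\<^sup>T\<close> and \<open>Gram i j\<close> for \<open>mat_conj (D i) * (D j)\<^sup>T\<close>. By
  \<open>1\<close>-division \<open>Gram j j\<close> is a nonzero scalar matrix, so \<open>cov_factor D j\<close> is a multiple of the
  orthogonal projection onto \<open>V j\<close>. By \<open>2\<close>-division all \<open>V j\<close> have the same dimension \<open>r\<close>, and
  \<open>Gram i j\<close>, which up to a factor is the projection from \<open>V j\<close> to \<open>V i\<close> in coordinates, is a multiple of a unitary
  matrix. The Gram matrices thus behave like a unitary connection on the graph of blocks, and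
  \<open>Cov D js\<close> is the holonomy of the cycle \<open>js\<close>: in coordinates of the first block it is a product
  of Gram matrices, which is zero or a nonzero multiple of a unitary matrix. Since a unitary matrix
  with one eigenvalue is scalar, \<open>Cov D js\<close> has at most one nonzero eigenvalue iff the holonomy is
  scalar (\<open>at_most_one_nonzero_eigenvalue_iff\<close>). What has to be shown is that the separation
  subspaces of \<open>c\<close>-division exist iff the holonomy of every cycle of \<open>c\<close> distinct blocks is scalar.

  In a solution the rows of the matrices \<open>H j * D j\<close> are orthogonal bases of the spaces \<open>V j\<close>, and
  rows that belong to different diagonal blocks are orthogonal. So a separation subspace \<open>S\<close> contains
  some of these basis vectors and is orthogonal to the others, and is therefore invariant under all
  projections (\<open>block_projection_preserves_separation_subspace\<close>). If \<open>S\<close> contains \<open>v \<in> V j\<close>, where \<open>j\<close>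
  is the first index of \<open>js\<close>, then it also contains \<open>Cov D js v\<close>, and if \<open>S\<close> meets \<open>V j\<close> in a line, then \<open>v\<close> is an
  eigenvector. When this holds for all \<open>v\<close>, the holonomy is scalar (\<open>scalar_if_separation_subspaces\<close>).

  Conversely, by the same argument the lower levels make the holonomy scalar for all shorter simple
  cycles. Every closed walk decomposes into simple cycles, so its holonomy is scalar too, and
  transport along paths from a root gives frames of the \<open>V j\<close> in which all Gram matrices are scalar
  (\<open>gauge_to_scalars\<close>). The basis vectors with the same number in all these frames span a space that
  is orthogonal to the corresponding spaces for other numbers. A unitary change of coordinates
  adapted to these \<open>r\<close> spaces (\<open>orthogonal_families_block_diagonal\<close>) is a solution, each of the spaces
  meets every \<open>V j\<close> in a line, and the frames can be turned together so that one of the spaces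
  passes through a prescribed vector (\<open>separation_subspace_exists\<close>).
\<close>

section \<open>Conjugation and adjoint matrices\<close>

interpretation to_complex: field_hom "to_complex :: 'a::real_or_complex \<Rightarrow> complex"
proof
  show "to_complex (0::'a) = 0"
    using to_complex_add[of 0 0] by simp
qed (fact to_complex_add to_complex_mult to_complex_one)+

lemma conjugate_one [simp]: "conjugate (1::'a::real_or_complex) = 1"
  using to_complex_conjugate[of "1::'a"] by (metis complex_cnj_one to_complex.hom_one to_complex.injectivity)

lemma conjugate_diff: "conjugate (x - y) = conjugate x - conjugate (y::'a::conjugatable_ring)"
  by (metis conjugate_dist_add conjugate_neg diff_conv_add_uminus)

lemma to_complex_mult_conjugate:
  "to_complex (conjugate x * x) = of_real ((cmod (to_complex x))\<^sup>2)"
  by (metis complex_norm_square mult.commute to_complex_conjugate to_complex_mult)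

text \<open>
  The class has no order, so positivity of \<open>conjugate x * x\<close> is read off in the complex numbers.
\<close>

lemma sum_conjugate_mult_eq_0D:
  fixes f :: "'b \<Rightarrow> 'a::real_or_complex"
  assumes "finite X" "(\<Sum>x\<in>X. conjugate (f x) * f x) = 0" "x \<in> X"
  shows "f x = 0"
proof -
  have "of_real (\<Sum>x\<in>X. (cmod (to_complex (f x)))\<^sup>2) = to_complex (\<Sum>x\<in>X. conjugate (f x) * f x)"
    by (simp only: to_complex.hom_sum to_complex_mult_conjugate of_real_sum)
  also have "\<dots> = 0"
    using assms(2) by simp
  finally have "(\<Sum>x\<in>X. (cmod (to_complex (f x)))\<^sup>2) = 0"
    using of_real_eq_0_iff by blast
  then have "(cmod (to_complex (f x)))\<^sup>2 = 0"
    using assms(1,3) by (subst (asm) sum_nonneg_eq_0_iff) auto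
  then show ?thesis
    by simp
qed

lemma index_mat_adjoint [simp]:
  "i < dim_col A \<Longrightarrow> j < dim_row A \<Longrightarrow> mat_adjoint A $$ (i, j) = conjugate (A $$ (j, i))"
  by (simp add: mat_adjoint_def mat_of_rows_index)

lemma dim_mat_adjoint [simp]:
  "dim_row (mat_adjoint A) = dim_col A" "dim_col (mat_adjoint A) = dim_row A"
  by (simp_all add: mat_adjoint_def)

lemma mat_adjoint_carrier [simp]: "A \<in> carrier_mat m n \<Longrightarrow> mat_adjoint A \<in> carrier_mat n m"
  by auto

lemma mat_adjoint_adjoint [simp]: "mat_adjoint (mat_adjoint A) = A"
  by (rule eq_matI) auto

lemma mat_adjoint_mult:
  assumes "A \<in> carrier_mat m n" "B \<in> carrier_mat n p"
  shows "mat_adjoint (A * B) = mat_adjoint B * mat_adjoint A"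
  using assms
  by (intro eq_matI) (auto simp: scalar_prod_def sum_conjugate conjugate_dist_mul mult.commute)

lemma mat_adjoint_smult: "mat_adjoint (a \<cdot>\<^sub>m A) = conjugate a \<cdot>\<^sub>m mat_adjoint A"
  by (rule eq_matI) (auto simp: conjugate_dist_mul)

lemma mat_adjoint_one [simp]: "mat_adjoint (1\<^sub>m n :: 'a::real_or_complex mat) = 1\<^sub>m n"
  by (rule eq_matI) auto

lemma mat_adjoint_zero [simp]: "mat_adjoint (0\<^sub>m m n) = 0\<^sub>m n m"
  by (rule eq_matI) auto

lemma mat_adjoint_diff:
  assumes "A \<in> carrier_mat m n" "B \<in> carrier_mat m n"
  shows "mat_adjoint (A - B) = mat_adjoint A - mat_adjoint B"
  using assms by (intro eq_matI) (auto simp: conjugate_diff)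

lemma mat_adjoint_conv: "mat_adjoint A = mat_conj (A\<^sup>T)" "mat_adjoint A = (mat_conj A)\<^sup>T"
  by (rule eq_matI; auto)+

lemma mat_adjoint_transpose: "mat_adjoint (A\<^sup>T) = mat_conj A"
  by (rule eq_matI) auto

lemma mat_conj_conj [simp]: "mat_conj (mat_conj A) = A"
  by (rule eq_matI) auto

lemma mat_conj_mult:
  assumes "A \<in> carrier_mat m n" "B \<in> carrier_mat n p"
  shows "mat_conj (A * B) = mat_conj A * mat_conj B"
  using assms by (intro eq_matI) (auto simp: scalar_prod_def sum_conjugate conjugate_dist_mul)

lemma mat_adjoint_mult_self_eq_0D:
  fixes A :: "'a::real_or_complex mat"
  assumes "A \<in> carrier_mat m n" "mat_adjoint A * A = 0\<^sub>m n n"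
  shows "A = 0\<^sub>m m n"
proof (rule eq_matI)
  fix i j assume ij: "i < dim_row (0\<^sub>m m n :: 'a mat)" "j < dim_col (0\<^sub>m m n :: 'a mat)"
  have "(\<Sum>k\<in>{0..<m}. conjugate (A $$ (k, j)) * A $$ (k, j)) = (mat_adjoint A * A) $$ (j, j)"
    using assms(1) ij by (auto simp: scalar_prod_def)
  also have "\<dots> = 0"
    using assms ij by simp
  finally have "A $$ (i, j) = 0"
    using sum_conjugate_mult_eq_0D[of "{0..<m}" "\<lambda>k. A $$ (k, j)" i] ij by auto
  then show "A $$ (i, j) = 0\<^sub>m m n $$ (i, j)"
    using ij by simp
qed (use assms in auto)

section \<open>Normal matrices with one eigenvalue\<close>

text \<open>
  Each multiplication by \<open>T\<close> moves the possibly nonzero entries one diagonal further up.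
\<close>

lemma strictly_upper_triangular_power:
  fixes T :: "'a::comm_ring_1 mat"
  assumes "T \<in> carrier_mat n n" "\<And>i j. i < n \<Longrightarrow> j \<le> i \<Longrightarrow> T $$ (i, j) = 0"
  shows "i < n \<Longrightarrow> j < n \<Longrightarrow> j < i + k \<Longrightarrow> (T ^\<^sub>m k) $$ (i, j) = 0"
proof (induction k arbitrary: i j)
  case 0
  then show ?case using assms(1) by simp
next
  case (Suc k)
  have c: "T ^\<^sub>m k \<in> carrier_mat n n"
    using assms(1) by simp
  have "(T ^\<^sub>m Suc k) $$ (i, j) = (\<Sum>l\<in>{0..<n}. (T ^\<^sub>m k) $$ (i, l) * T $$ (l, j))"
    using Suc.prems assms(1) c by (auto simp: scalar_prod_def)
  also have "\<dots> = 0"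
  proof (rule sum.neutral, rule ballI)
    fix l assume "l \<in> {0..<n}"
    then show "(T ^\<^sub>m k) $$ (i, l) * T $$ (l, j) = 0"
      using Suc assms(2)[of l j] by (cases "l < i + k") auto
  qed
  finally show ?case .
qed

text \<open>
  The diagonal of a triangular form of \<open>N\<close> consists of eigenvalues, so the form is strictly
  triangular.
\<close>

lemma nilpotent_if_spectrum_zero:
  fixes N :: "complex mat"
  assumes N: "N \<in> carrier_mat n n" and spec: "spectrum N \<subseteq> {0}"
  shows "N ^\<^sub>m n = 0\<^sub>m n n"
proof -
  obtain es where "char_poly N = (\<Prod>a\<leftarrow>es. [:- a, 1:])"
    using char_poly_factorized[OF N] by auto
  from schur_decomposition_exists[OF N this] obtain T where
    T: "T \<in> carrier_mat n n" "upper_triangular T" and sim: "similar_mat N T"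
    by auto
  have "T $$ (i, j) = 0" if "i < n" "j \<le> i" for i j
  proof (cases "j = i")
    case True
    have "poly (char_poly N) (T $$ (i, i)) = 0"
      unfolding char_poly_similar[OF sim] char_poly_upper_triangular[OF T]
      using that T by (auto simp: poly_prod_list prod_list_zero_iff diag_mat_def o_def)
    then have "T $$ (i, i) \<in> spectrum N"
      using spectrum_root_char_poly[OF N] by simp
    then show ?thesis using spec True by auto
  next
    case False
    then show ?thesis
      using that T(1) by (intro upper_triangularD[OF T(2)]) auto
  qed
  from strictly_upper_triangular_power[OF T(1) this] have "T ^\<^sub>m n = 0\<^sub>m n n"
    using T(1) by (intro eq_matI) auto
  moreover obtain P Q where wit: "similar_mat_wit N T P Q"
    using sim by (auto simp: similar_mat_def)
  ultimately show ?thesis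
    using similar_mat_witD2[OF N wit] similar_mat_wit_pow_id[OF wit, of n] by simp
qed

text \<open>
  A normal matrix and its adjoint have the same kernel. If \<open>N\<close> annihilates a power
  \<open>X = N * Y\<close>, then so does the adjoint of \<open>N\<close>, whence \<open>mat_adjoint X * X = 0\<close>; the
  exponent of a vanishing power can therefore be lowered to \<open>1\<close>.
\<close>

lemma nilpotent_normal_mat_eq_0:
  fixes N :: "'a::real_or_complex mat"
  assumes N: "N \<in> carrier_mat n n" and normal: "mat_adjoint N * N = N * mat_adjoint N"
    and "N ^\<^sub>m (Suc k) = 0\<^sub>m n n"
  shows "N = 0\<^sub>m n n"
  using assms(3)
proof (induction k)
  case 0
  then show ?case using N by simp
next
  case (Suc k)
  define X where "X = N ^\<^sub>m Suc k"
  define Y where "Y = N ^\<^sub>m k"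
  have c: "X \<in> carrier_mat n n" "Y \<in> carrier_mat n n" "mat_adjoint N \<in> carrier_mat n n"
    using N by (auto simp: X_def Y_def)
  have comm: "N * N ^\<^sub>m j = N ^\<^sub>m j * N" for j
    by (induction j) (use N in \<open>auto simp: assoc_mult_mat[of _ n n _ n _ n, symmetric]\<close>)
  have XY: "X = N * Y"
    unfolding X_def Y_def using comm by simp
  have NX: "N * X = 0\<^sub>m n n"
    using Suc.prems comm[of "Suc k"] by (simp add: X_def)
  define Z where "Z = mat_adjoint N * X"
  have "mat_adjoint Z * Z = mat_adjoint X * ((N * mat_adjoint N) * X)"
    using N c by (simp add: Z_def mat_adjoint_mult[of _ n n _ n] assoc_mult_mat[of _ n n _ n _ n] mult_carrier_mat[of _ n n _ n])
  also have "\<dots> = mat_adjoint X * (mat_adjoint N * (N * X))"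
    unfolding normal[symmetric] using N c by (simp add: assoc_mult_mat[of _ n n _ n _ n] mult_carrier_mat[of _ n n _ n])
  also have "\<dots> = 0\<^sub>m n n"
    using N c by (simp add: NX)
  finally have Z: "Z = 0\<^sub>m n n"
    using mat_adjoint_mult_self_eq_0D[of Z n n] N c by (auto simp: Z_def)
  have "mat_adjoint X * X = mat_adjoint Y * Z"
    using N c by (simp add: XY Z_def mat_adjoint_mult[of _ n n _ n] assoc_mult_mat[of _ n n _ n _ n] mult_carrier_mat[of _ n n _ n])
  then have "X = 0\<^sub>m n n"
    using mat_adjoint_mult_self_eq_0D[of X n n] c by (simp add: Z)
  then show ?case
    using Suc.IH by (simp add: X_def)
qed

definition scalar_mat :: "nat \<Rightarrow> 'a::semiring_1 mat \<Rightarrow> bool" where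
  "scalar_mat n M \<longleftrightarrow> (\<exists>a. M = a \<cdot>\<^sub>m 1\<^sub>m n)"

lemma mult_diff_smult_one:
  fixes A :: "'a::comm_ring_1 mat"
  assumes "A \<in> carrier_mat n n" "B \<in> carrier_mat n n"
  shows "(A - a \<cdot>\<^sub>m 1\<^sub>m n) * (B - b \<cdot>\<^sub>m 1\<^sub>m n) = A * B - b \<cdot>\<^sub>m A - a \<cdot>\<^sub>m B + (a * b) \<cdot>\<^sub>m 1\<^sub>m n"
proof -
  have "(A - a \<cdot>\<^sub>m 1\<^sub>m n) * (B - b \<cdot>\<^sub>m 1\<^sub>m n)
      = A * (B - b \<cdot>\<^sub>m 1\<^sub>m n) - (a \<cdot>\<^sub>m 1\<^sub>m n) * (B - b \<cdot>\<^sub>m 1\<^sub>m n)"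
    using assms by (intro minus_mult_distrib_mat) auto
  also have "A * (B - b \<cdot>\<^sub>m 1\<^sub>m n) = A * B - b \<cdot>\<^sub>m A"
    using assms by (subst mult_minus_distrib_mat[of _ n n _ n])
      (auto simp: mult_smult_distrib[of _ n n _ n])
  also have "(a \<cdot>\<^sub>m 1\<^sub>m n) * (B - b \<cdot>\<^sub>m 1\<^sub>m n) = a \<cdot>\<^sub>m (B - b \<cdot>\<^sub>m 1\<^sub>m n)"
    using assms by (subst mult_smult_assoc_mat[of _ n n _ n]) auto
  also have "A * B - b \<cdot>\<^sub>m A - a \<cdot>\<^sub>m (B - b \<cdot>\<^sub>m 1\<^sub>m n)
      = A * B - b \<cdot>\<^sub>m A - a \<cdot>\<^sub>m B + (a * b) \<cdot>\<^sub>m 1\<^sub>m n"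
    using assms by (intro eq_matI) (auto simp: algebra_simps)
  finally show ?thesis .
qed

lemma smult_mat_mult_vec:
  fixes A :: "'a::comm_semiring_0 mat"
  assumes "A \<in> carrier_mat m n" "v \<in> carrier_vec n"
  shows "(a \<cdot>\<^sub>m A) *\<^sub>v v = a \<cdot>\<^sub>v (A *\<^sub>v v)"
  using assms by (intro eq_vecI) (auto simp: scalar_prod_def sum_distrib_left mult.assoc)

lemma to_complex_mat_adjoint:
  "map_mat to_complex (mat_adjoint M) = mat_adjoint (map_mat to_complex M)"
  by (rule eq_matI) (auto simp: to_complex_conjugate)

text \<open>
  Subtracting the eigenvalue leaves a normal matrix with spectrum zero, which vanishes. The
  eigenvalue lies in the complex numbers, but it equals the diagonal entries of \<open>M\<close> and so comes
  from the field itself.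
\<close>

lemma normal_one_eigenvalue_scalar_mat:
  fixes M :: "'a::real_or_complex mat"
  assumes M: "M \<in> carrier_mat n n" and normal: "mat_adjoint M * M = M * mat_adjoint M"
    and ev: "eigenvalues M \<subseteq> {\<mu>}"
  shows "scalar_mat n M"
proof (cases n)
  case 0
  then have "M = 0 \<cdot>\<^sub>m 1\<^sub>m n"
    using M by (intro eq_matI) auto
  then show ?thesis
    by (auto simp: scalar_mat_def)
next
  case (Suc k)
  define A where "A = map_mat to_complex M"
  define N where "N = A - \<mu> \<cdot>\<^sub>m 1\<^sub>m n"
  have A: "A \<in> carrier_mat n n" and N: "N \<in> carrier_mat n n"
    using M by (auto simp: A_def N_def)
  have "mat_adjoint A * A = A * mat_adjoint A"
    using arg_cong[OF normal, of "map_mat to_complex"] M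
    by (simp add: to_complex.mat_hom_mult[of _ n n _ n] to_complex_mat_adjoint A_def)
  moreover have adj: "mat_adjoint N = mat_adjoint A - cnj \<mu> \<cdot>\<^sub>m 1\<^sub>m n"
    using A by (simp add: N_def mat_adjoint_diff[of _ n n] mat_adjoint_smult)
  ultimately have N_normal: "mat_adjoint N * N = N * mat_adjoint N"
    unfolding adj unfolding N_def using A
    by (subst (1 2) mult_diff_smult_one) (auto intro!: eq_matI simp: algebra_simps)
  have "spectrum N \<subseteq> {0}"
  proof
    fix x assume "x \<in> spectrum N"
    then obtain v where v: "v \<in> carrier_vec n" "v \<noteq> 0\<^sub>v n" "N *\<^sub>v v = x \<cdot>\<^sub>v v"
      using N by (auto simp: spectrum_def eigenvalue_def eigenvector_def)
    have "A *\<^sub>v v = N *\<^sub>v v + \<mu> \<cdot>\<^sub>v v"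
    proof -
      have "N *\<^sub>v v = A *\<^sub>v v - (\<mu> \<cdot>\<^sub>m 1\<^sub>m n) *\<^sub>v v"
        unfolding N_def using A v(1) by (intro minus_mult_distrib_mat_vec) auto
      also have "(\<mu> \<cdot>\<^sub>m 1\<^sub>m n) *\<^sub>v v = \<mu> \<cdot>\<^sub>v v"
        using v(1) by (simp add: smult_mat_mult_vec[of _ n n])
      finally show ?thesis
        using A v(1) by (intro eq_vecI) auto
    qed
    also have "\<dots> = (x + \<mu>) \<cdot>\<^sub>v v"
      by (simp add: v(3) add_smult_distrib_vec)
    finally have "x + \<mu> \<in> eigenvalues M"
      using v A by (auto simp: eigenvalues_def spectrum_def eigenvalue_def eigenvector_def A_def)
    then show "x \<in> {0}"
      using ev by auto
  qed
  then have "N ^\<^sub>m Suc k = 0\<^sub>m n n"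
    using nilpotent_if_spectrum_zero[OF N] Suc by simp
  then have "N = 0\<^sub>m n n"
    by (rule nilpotent_normal_mat_eq_0[OF N N_normal])
  then have "(A - \<mu> \<cdot>\<^sub>m 1\<^sub>m n) $$ (i, j) = 0" if "i < n" "j < n" for i j
    using that by (simp add: N_def)
  then have entry: "to_complex (M $$ (i, j)) = (if i = j then \<mu> else 0)" if "i < n" "j < n" for i j
    using that M unfolding A_def by (fastforce split: if_splits)
  have "M = M $$ (0, 0) \<cdot>\<^sub>m 1\<^sub>m n"
  proof (rule eq_matI)
    fix i j assume "i < dim_row (M $$ (0, 0) \<cdot>\<^sub>m 1\<^sub>m n)" "j < dim_col (M $$ (0, 0) \<cdot>\<^sub>m 1\<^sub>m n)"
    then have ij: "i < n" "j < n" by auto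
    then have "to_complex (M $$ (i, j)) = to_complex ((M $$ (0, 0) \<cdot>\<^sub>m 1\<^sub>m n) $$ (i, j))"
      using entry[of i j] entry[of 0 0] Suc by simp
    then show "M $$ (i, j) = (M $$ (0, 0) \<cdot>\<^sub>m 1\<^sub>m n) $$ (i, j)"
      using to_complex.injectivity by blast
  qed (use M in auto)
  then show ?thesis
    by (auto simp: scalar_mat_def)
qed

text \<open>
  Unit vectors show that \<open>M\<close> is diagonal, sums of two unit vectors that its diagonal is constant.
\<close>

lemma scalar_mat_if_all_eigenvectors:
  fixes M :: "'a::comm_ring_1 mat"
  assumes M: "M \<in> carrier_mat n n"
    and eigen: "\<And>w. w \<in> carrier_vec n \<Longrightarrow> \<exists>a. M *\<^sub>v w = a \<cdot>\<^sub>v w"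
  shows "scalar_mat n M"
proof -
  have offdiag: "M $$ (i, j) = 0" if "i < n" "j < n" "i \<noteq> j" for i j
  proof -
    obtain a where "M *\<^sub>v unit_vec n j = a \<cdot>\<^sub>v unit_vec n j"
      using eigen[of "unit_vec n j"] by auto
    from arg_cong[OF this, of "\<lambda>v. v $ i"] show ?thesis
      using that M by (auto simp: scalar_prod_right_unit)
  qed
  have diag: "M $$ (i, i) = M $$ (j, j)" if ij: "i < n" "j < n" for i j
  proof (cases "i = j")
    case False
    let ?w = "unit_vec n i + unit_vec n j :: 'a vec"
    obtain a where a: "M *\<^sub>v ?w = a \<cdot>\<^sub>v ?w"
      using eigen[of ?w] by auto
    have "(M *\<^sub>v ?w) $ l = M $$ (l, i) + M $$ (l, j)" if "l < n" for l
      using that ij M by (auto simp: scalar_prod_add_distrib[of _ n] scalar_prod_right_unit)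
    from this[of i] this[of j] show ?thesis
      using False ij offdiag[of i j] offdiag[of j i] by (simp add: a)
  qed simp
  have "M = M $$ (0, 0) \<cdot>\<^sub>m 1\<^sub>m n"
  proof (rule eq_matI)
    fix i j assume "i < dim_row (M $$ (0, 0) \<cdot>\<^sub>m 1\<^sub>m n)" "j < dim_col (M $$ (0, 0) \<cdot>\<^sub>m 1\<^sub>m n)"
    then show "M $$ (i, j) = (M $$ (0, 0) \<cdot>\<^sub>m 1\<^sub>m n) $$ (i, j)"
      using offdiag[of i j] diag[of i 0] by auto
  qed (use M in auto)
  then show ?thesis
    by (auto simp: scalar_mat_def)
qed

section \<open>Unitary matrices\<close>

lemma unitary_mat_carrier: "unitary_mat n U \<Longrightarrow> U \<in> carrier_mat n n"
  by (simp add: unitary_mat_def)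

lemma unitary_mat_left: "unitary_mat n U \<Longrightarrow> mat_adjoint U * U = 1\<^sub>m n"
  and unitary_mat_right: "unitary_mat n U \<Longrightarrow> U * mat_adjoint U = 1\<^sub>m n"
  by (simp_all add: unitary_mat_def)

lemma unitary_mat_one: "unitary_mat n (1\<^sub>m n :: 'a::real_or_complex mat)"
  by (simp add: unitary_mat_def)

lemma mult_mat_middle:
  fixes A :: "'a::semiring_0 mat"
  assumes "A \<in> carrier_mat n m" "B \<in> carrier_mat m p" "C \<in> carrier_mat p q" "D \<in> carrier_mat q r"
  shows "(A * B) * (C * D) = A * ((B * C) * D)"
proof -
  have "(A * B) * (C * D) = A * (B * (C * D))"
    using assms by (intro assoc_mult_mat) auto
  also have "B * (C * D) = (B * C) * D"
    using assms by (intro assoc_mult_mat[symmetric]) auto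
  finally show ?thesis .
qed

lemma unitary_mat_mult:
  assumes "unitary_mat n U" "unitary_mat n V"
  shows "unitary_mat n (U * V)"
proof -
  have c: "U \<in> carrier_mat n n" "V \<in> carrier_mat n n" "mat_adjoint U \<in> carrier_mat n n" "mat_adjoint V \<in> carrier_mat n n"
    using assms by (auto simp: unitary_mat_def)
  have "(U * V) * (mat_adjoint V * mat_adjoint U) = U * ((V * mat_adjoint V) * mat_adjoint U)"
    and "(mat_adjoint V * mat_adjoint U) * (U * V) = mat_adjoint V * ((mat_adjoint U * U) * V)"
    by (rule mult_mat_middle[OF c(1,2,4,3)], rule mult_mat_middle[OF c(4,3,1,2)])
  moreover have "U * ((V * mat_adjoint V) * mat_adjoint U) = 1\<^sub>m n"
    and "mat_adjoint V * ((mat_adjoint U * U) * V) = 1\<^sub>m n"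
    using c by (simp_all add: unitary_mat_left[OF assms(1)] unitary_mat_right[OF assms(1)]
      unitary_mat_left[OF assms(2)] unitary_mat_right[OF assms(2)])
  ultimately have "(U * V) * (mat_adjoint V * mat_adjoint U) = 1\<^sub>m n"
    and "(mat_adjoint V * mat_adjoint U) * (U * V) = 1\<^sub>m n"
    by metis+
  then show ?thesis
    unfolding unitary_mat_def mat_adjoint_mult[OF c(1,2)] using c by simp
qed

lemma unitary_mat_transpose: "unitary_mat n U \<Longrightarrow> unitary_mat n (U\<^sup>T)"
proof -
  assume U: "unitary_mat n U"
  have c: "U \<in> carrier_mat n n" "mat_adjoint U \<in> carrier_mat n n"
    using U by (auto simp: unitary_mat_def)
  have adj: "(mat_adjoint U)\<^sup>T = mat_conj U"
    by (rule eq_matI) auto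
  have "(U\<^sup>T) * mat_adjoint (U\<^sup>T) = (mat_adjoint U * U)\<^sup>T"
       "mat_adjoint (U\<^sup>T) * (U\<^sup>T) = (U * mat_adjoint U)\<^sup>T"
    using c adj by (simp_all add: transpose_mult[of _ n n _ n] mat_adjoint_transpose)
  then show ?thesis
    using U c by (simp add: unitary_mat_def)
qed

lemma real_in_range_to_complex: "\<exists>y::'a::real_or_complex. to_complex y = of_real x"
  using range_to_complex[where 'a='a]
  by (metis Reals_of_real UNIV_I rangeE)

lemma self_conjugate_if_real: "to_complex x = of_real r \<Longrightarrow> conjugate x = x"
  by (metis complex_cnj_complex_of_real to_complex.injectivity to_complex_conjugate)

text \<open>
  Besides normalising \<open>w\<close>, the factor makes one entry real. This is what lets a single reflection
  map a unit vector to a multiple of \<open>w\<close>.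
\<close>

lemma unit_vec_rescaling:
  fixes w :: "'a::real_or_complex vec"
  assumes w: "w \<in> carrier_vec n" "w \<noteq> 0\<^sub>v n" and k: "k < n"
  obtains t where "t \<noteq> 0" "conjugate (t * w $ k) = t * w $ k"
    "(\<Sum>i\<in>{0..<n}. conjugate (t * w $ i) * (t * w $ i)) = 1"
proof -
  define s where "s = (\<Sum>i\<in>{0..<n}. (cmod (to_complex (w $ i)))\<^sup>2)"
  have s: "to_complex (\<Sum>i\<in>{0..<n}. conjugate (w $ i) * w $ i) = of_real s"
    by (simp only: to_complex.hom_sum to_complex_mult_conjugate of_real_sum s_def)
  have "s \<noteq> 0"
  proof
    assume "s = 0"
    then have "(\<Sum>i\<in>{0..<n}. conjugate (w $ i) * w $ i) = 0"
      using s by simp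
    then have "w $ i = 0" if "i < n" for i
      using sum_conjugate_mult_eq_0D[of "{0..<n}" "\<lambda>i. w $ i" i] that by auto
    then show False
      using w by (auto simp: vec_eq_iff)
  qed
  then have "s > 0"
    using sum_nonneg[of "{0..<n}" "\<lambda>i. (cmod (to_complex (w $ i)))\<^sup>2"] by (simp add: s_def)
  obtain y :: 'a where y: "to_complex y = of_real (1 / sqrt s)"
    using real_in_range_to_complex by blast
  obtain p :: 'a where p: "conjugate p * p = 1" "conjugate (p * w $ k) = p * w $ k"
  proof (cases "w $ k = 0")
    case True
    then show ?thesis using that[of 1] by simp
  next
    case False
    define c where "c = cmod (to_complex (w $ k))"
    have c: "c \<noteq> 0" using False by (simp add: c_def)
    obtain z :: 'a where z: "to_complex z = of_real (1 / c)"
      using real_in_range_to_complex by blast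
    have "to_complex (conjugate (conjugate (w $ k) * z) * (conjugate (w $ k) * z)) = of_real ((cmod (to_complex (conjugate (w $ k) * z)))\<^sup>2)"
      by (rule to_complex_mult_conjugate)
    also have "\<dots> = to_complex 1"
      using c by (simp add: to_complex_mult z to_complex_conjugate norm_mult norm_divide c_def)
    finally have 1: "conjugate (conjugate (w $ k) * z) * (conjugate (w $ k) * z) = 1"
      using to_complex.injectivity by blast
    have "to_complex (conjugate (w $ k) * z * w $ k) = to_complex (conjugate (w $ k) * w $ k) * to_complex z"
      by (simp add: to_complex_mult)
    also have "\<dots> = of_real (c\<^sup>2 * (1 / c))"
      by (simp only: to_complex_mult_conjugate z c_def of_real_mult)
    finally show ?thesis
      using that[OF 1] self_conjugate_if_real by blast
  qed
  \<comment> \<open>The modulus is corrected by \<open>y\<close>, the phase of the \<open>k\<close>-th entry by \<open>p\<close>.\<close>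
  have yy: "to_complex (y * y) = of_real (1 / s)"
    using \<open>s > 0\<close> unfolding to_complex_mult y of_real_mult[symmetric] by (simp flip: real_sqrt_mult)
  have cy: "conjugate y = y"
    using self_conjugate_if_real[OF y] .
  show ?thesis
  proof (rule that[of "p * y"])
    have "p \<noteq> 0" using p(1) by auto
    moreover have "y \<noteq> 0" using y \<open>s > 0\<close> by auto
    ultimately show "p * y \<noteq> 0" by simp
    have "conjugate (p * y * w $ k) = conjugate (p * w $ k) * conjugate y"
      by (simp add: conjugate_dist_mul mult_ac)
    then show "conjugate (p * y * w $ k) = p * y * w $ k"
      by (simp add: p cy mult_ac)
    have "conjugate (p * y * w $ i) * (p * y * w $ i) = (conjugate p * p) * (y * y) * (conjugate (w $ i) * w $ i)" for i
      by (simp add: conjugate_dist_mul cy mult_ac)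
    then have "(\<Sum>i\<in>{0..<n}. conjugate (p * y * w $ i) * (p * y * w $ i))
        = (y * y) * (\<Sum>i\<in>{0..<n}. conjugate (w $ i) * w $ i)"
      by (simp only: p(1) sum_distrib_left mult_1)
    moreover have "to_complex ((y * y) * (\<Sum>i\<in>{0..<n}. conjugate (w $ i) * w $ i)) = to_complex 1"
      unfolding to_complex_mult[of "y * y"] yy s using \<open>s > 0\<close> by simp
    ultimately show "(\<Sum>i\<in>{0..<n}. conjugate (p * y * w $ i) * (p * y * w $ i)) = 1"
      using to_complex.injectivity by metis
  qed
qed

text \<open>
  With \<open>u\<close> the difference of the rescaled \<open>w\<close> and the \<open>k\<close>-th unit vector, the matrix is the Householder
  reflection along \<open>u\<close>. Its coefficient \<open>- 2 / \<parallel>u\<parallel>\<^sup>2\<close> simplifies to \<open>1 / u k\<close>, since both vectors have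
  norm one and \<open>u k\<close> is real.
\<close>

lemma unitary_mat_with_column:
  fixes w :: "'a::real_or_complex vec"
  assumes w: "w \<in> carrier_vec n" "w \<noteq> 0\<^sub>v n" and k: "k < n"
  obtains U t where "unitary_mat n U" "t \<noteq> 0" "col U k = t \<cdot>\<^sub>v w"
proof -
  obtain t where t: "t \<noteq> 0" "conjugate (t * w $ k) = t * w $ k"
    "(\<Sum>i\<in>{0..<n}. conjugate (t * w $ i) * (t * w $ i)) = 1"
    by (rule unit_vec_rescaling[OF assms])
  define u where "u i = t * w $ i - (if i = k then 1 else 0)" for i
  have uk: "conjugate (u k) = u k"
    using t(2) by (simp add: u_def conjugate_diff)
  \<comment> \<open>For unit vectors with real inner product, half of the squared distance is one minus it.\<close>
  have norm_u: "(\<Sum>i\<in>{0..<n}. conjugate (u i) * u i) = - 2 * u k"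
  proof -
    have "(\<Sum>i\<in>{0..<n}. conjugate (u i) * u i) = (\<Sum>i\<in>{0..<n}. conjugate (t * w $ i) * (t * w $ i)
        + (if i = k then 1 - conjugate (t * w $ i) - t * w $ i else 0))"
      by (intro sum.cong) (auto simp: u_def conjugate_diff algebra_simps)
    also have "\<dots> = 1 + (1 - conjugate (t * w $ k) - t * w $ k)"
      using k by (simp add: sum.distrib t(3))
    finally show ?thesis
      using t(2) by (simp add: u_def)
  qed
  show ?thesis
  proof (cases "u k = 0")
    case True
    then have "u i = 0" if "i < n" for i
      using sum_conjugate_mult_eq_0D[of "{0..<n}" u i] norm_u that by auto
    then have "col (1\<^sub>m n) k = t \<cdot>\<^sub>v w"
      using w k by (intro eq_vecI) (auto simp: u_def)
    then show ?thesis
      using that[OF unitary_mat_one t(1)] by simp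
  next
    case False
    define U where "U = mat n n (\<lambda>(i, j). (if i = j then 1 else 0) + u i * conjugate (u j) / u k)"
    have conj_div: "conjugate (x / u k) = conjugate x / u k" for x
    proof -
      have "conjugate (x / u k) * conjugate (u k) = conjugate x"
        using False by (simp flip: conjugate_dist_mul)
      then show ?thesis
        using False by (simp add: uk field_simps)
    qed
    have c: "U \<in> carrier_mat n n" by (simp add: U_def)
    have adj: "mat_adjoint U = U"
      by (rule eq_matI) (auto simp: U_def conj_div conjugate_dist_add conjugate_dist_mul mult.commute)
    have "U * U = 1\<^sub>m n"
    proof (rule eq_matI)
      fix i j assume "i < dim_row (1\<^sub>m n :: 'a mat)" "j < dim_col (1\<^sub>m n :: 'a mat)"
      then have ij: "i < n" "j < n" by auto
      have "(U * U) $$ (i, j) = (\<Sum>l\<in>{0..<n}. ((if i = l then 1 else 0) + u i * conjugate (u l) / u k)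
          * ((if l = j then 1 else 0) + u l * conjugate (u j) / u k))"
        using ij by (simp add: U_def scalar_prod_def)
      also have "\<dots> = (\<Sum>l\<in>{0..<n}. (if l = i then (if i = j then 1 else 0) + u i * conjugate (u j) / u k else 0)
          + (if l = j then u i * conjugate (u j) / u k else 0)
          + u i * conjugate (u j) / (u k * u k) * (conjugate (u l) * u l))"
        by (intro sum.cong) (auto simp: algebra_simps)
      also have "\<dots> = (if i = j then 1 else 0) + u i * conjugate (u j) / u k + u i * conjugate (u j) / u k
          + u i * conjugate (u j) / (u k * u k) * (- 2 * u k)"
        by (simp only: sum.distrib sum_distrib_left[symmetric] norm_u) (use ij in simp)
      also have "\<dots> = 1\<^sub>m n $$ (i, j)"
        using ij False by (simp add: field_simps)
      finally show "(U * U) $$ (i, j) = 1\<^sub>m n $$ (i, j)" .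
    qed (use c in auto)
    then have "unitary_mat n U"
      using c by (simp add: unitary_mat_def adj)
    moreover have "col U k = t \<cdot>\<^sub>v w"
    proof (rule eq_vecI)
      fix i assume "i < dim_vec (t \<cdot>\<^sub>v w)"
      then have "i < n" using w by simp
      then have "col U k $ i = (if i = k then 1 else 0) + u i"
        using k False by (simp add: U_def uk)
      then show "col U k $ i = (t \<cdot>\<^sub>v w) $ i"
        using \<open>i < n\<close> w by (simp add: u_def)
    qed (use c w in auto)
    ultimately show ?thesis
      using that t(1) by blast
  qed
qed

lemma unitary_mat_four_block:
  fixes U V :: "'a::real_or_complex mat"
  assumes U: "unitary_mat m U" and V: "unitary_mat n V"
  shows "unitary_mat (m + n) (four_block_mat U (0\<^sub>m m n) (0\<^sub>m n m) V)" (is "unitary_mat _ ?F")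
proof -
  have c: "U \<in> carrier_mat m m" "V \<in> carrier_mat n n" "mat_adjoint U \<in> carrier_mat m m" "mat_adjoint V \<in> carrier_mat n n"
    using assms by (auto simp: unitary_mat_def)
  have adj: "mat_adjoint ?F = four_block_mat (mat_adjoint U) (0\<^sub>m m n) (0\<^sub>m n m) (mat_adjoint V)"
    using c by (intro eq_matI) auto
  have "?F * mat_adjoint ?F = 1\<^sub>m (m + n)"
    unfolding adj using c unitary_mat_right[OF U] unitary_mat_right[OF V]
    by (subst mult_four_block_mat[of _ m m _ n _ n _ _ m _ n]) auto
  moreover have "mat_adjoint ?F * ?F = 1\<^sub>m (m + n)"
    unfolding adj using c unitary_mat_left[OF U] unitary_mat_left[OF V]
    by (subst mult_four_block_mat[of _ m m _ n _ n _ _ m _ n]) auto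
  ultimately show ?thesis
    using c by (simp add: unitary_mat_def)
qed

section \<open>Block diagonal form of orthogonal families of rows\<close>

text \<open>
  As long as some nonzero vector is annihilated, a unitary change of coordinates makes it the last
  basis vector and thereby clears a column. The columns that cannot be cleared form the injective
  matrix \<open>B\<close>.
\<close>

lemma kernel_column_split:
  fixes A :: "'a::real_or_complex mat"
  assumes "A \<in> carrier_mat m d"
  shows "\<exists>L e f B. unitary_mat d L \<and> d = e + f \<and> B \<in> carrier_mat m e \<and>
    A * L = four_block_mat B (0\<^sub>m m f) (0\<^sub>m 0 e) (0\<^sub>m 0 f) \<and>
    (\<forall>x \<in> carrier_vec e. B *\<^sub>v x = 0\<^sub>v m \<longrightarrow> x = 0\<^sub>v e)"
  using assms
proof (induction d arbitrary: A)
  case 0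
  then show ?case
    by (intro exI[of _ "1\<^sub>m 0"] exI[of _ 0] exI[of _ A] conjI) (auto simp: unitary_mat_one)
next
  case (Suc d)
  show ?case
  proof (cases "\<forall>x \<in> carrier_vec (Suc d). A *\<^sub>v x = 0\<^sub>v m \<longrightarrow> x = 0\<^sub>v (Suc d)")
    case True
    have "A * 1\<^sub>m (Suc d) = four_block_mat A (0\<^sub>m m 0) (0\<^sub>m 0 (Suc d)) (0\<^sub>m 0 0)"
      using Suc.prems by (intro eq_matI) auto
    then show ?thesis
      using Suc.prems True unitary_mat_one
      by (intro exI[of _ "1\<^sub>m (Suc d)"] exI[of _ "Suc d"] exI[of _ 0] exI[of _ A]) auto
  next
    case False
    then obtain w where w: "w \<in> carrier_vec (Suc d)" "A *\<^sub>v w = 0\<^sub>v m" "w \<noteq> 0\<^sub>v (Suc d)"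
      by auto
    obtain U t where U: "unitary_mat (Suc d) U" "col U d = t \<cdot>\<^sub>v w"
      using unitary_mat_with_column[OF w(1,3), of d] by blast
    have Uc: "U \<in> carrier_mat (Suc d) (Suc d)"
      using U(1) by (rule unitary_mat_carrier)
    define A' where "A' = mat m d (\<lambda>(i, j). (A * U) $$ (i, j))"
    have A': "A' \<in> carrier_mat m d" by (simp add: A'_def)
    have "(A * U) $$ (i, d) = 0" if "i < m" for i
    proof -
      have "(A * U) $$ (i, d) = (A *\<^sub>v (t \<cdot>\<^sub>v w)) $ i"
        using that Suc.prems Uc by (simp flip: U(2))
      also have "A *\<^sub>v (t \<cdot>\<^sub>v w) = 0\<^sub>v m"
      proof -
        have "t \<cdot>\<^sub>v 0\<^sub>v m = 0\<^sub>v m"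
          by (intro eq_vecI) auto
        then show ?thesis
          using Suc.prems w by (simp add: mult_mat_vec)
      qed
      finally show ?thesis using that by simp
    qed
    then have AU: "A * U = four_block_mat A' (0\<^sub>m m 1) (0\<^sub>m 0 d) (0\<^sub>m 0 1)"
      using Suc.prems Uc by (intro eq_matI) (auto simp: A'_def less_Suc_eq simp del: index_mult_mat(1))
    obtain L e f B where IH: "unitary_mat d L" "d = e + f" "B \<in> carrier_mat m e"
      "A' * L = four_block_mat B (0\<^sub>m m f) (0\<^sub>m 0 e) (0\<^sub>m 0 f)"
      "\<forall>x \<in> carrier_vec e. B *\<^sub>v x = 0\<^sub>v m \<longrightarrow> x = 0\<^sub>v e"
      using Suc.IH[OF A'] by blast
    define F where "F = four_block_mat L (0\<^sub>m d 1) (0\<^sub>m 1 d) (1\<^sub>m 1)"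
    have F: "unitary_mat (Suc d) F"
      using unitary_mat_four_block[OF IH(1) unitary_mat_one[of 1]] by (simp add: F_def)
    have Lc: "L \<in> carrier_mat d d" using IH(1) by (rule unitary_mat_carrier)
    have "A * (U * F) = (A * U) * F"
      using Suc.prems Uc unitary_mat_carrier[OF F] by simp
    also have "\<dots> = four_block_mat (A' * L) (0\<^sub>m m 1) (0\<^sub>m 0 d) (0\<^sub>m 0 1)"
      unfolding AU F_def using A' Lc
      by (subst mult_four_block_mat[of _ m d _ 1 _ 0 _ _ d _ 1]) auto
    also have "\<dots> = four_block_mat B (0\<^sub>m m (Suc f)) (0\<^sub>m 0 e) (0\<^sub>m 0 (Suc f))"
      unfolding IH(4) using IH(2,3) by (intro eq_matI) auto
    finally show ?thesis
      using unitary_mat_mult[OF U(1) F] IH(2,3,5)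
      by (intro exI[of _ "U * F"] exI[of _ e] exI[of _ "Suc f"] exI[of _ B]) auto
  qed
qed

lemma mult_eq_0_if_injective:
  fixes B :: "'a::comm_ring_1 mat"
  assumes "B \<in> carrier_mat m e" "Z \<in> carrier_mat e p" "B * Z = 0\<^sub>m m p"
    and inj: "\<And>x. x \<in> carrier_vec e \<Longrightarrow> B *\<^sub>v x = 0\<^sub>v m \<Longrightarrow> x = 0\<^sub>v e"
  shows "Z = 0\<^sub>m e p"
proof (rule eq_matI)
  fix i j assume "i < dim_row (0\<^sub>m e p :: 'a mat)" "j < dim_col (0\<^sub>m e p :: 'a mat)"
  then have ij: "i < e" "j < p" by auto
  have "B *\<^sub>v col Z j = col (B * Z) j"
    by (rule col_mult2[OF assms(1,2) ij(2), symmetric])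
  also have "\<dots> = 0\<^sub>v m"
    unfolding assms(3) using ij by (intro eq_vecI) auto
  finally have "col Z j = 0\<^sub>v e"
    using inj[of "col Z j"] assms(2) by auto
  then have "col Z j $ i = 0"
    using ij by simp
  then show "Z $$ (i, j) = 0\<^sub>m e p $$ (i, j)"
    using ij assms(2) by simp
qed (use assms in auto)

lemma stack_rows_Nil [simp]: "stack_rows d [] = 0\<^sub>m 0 d"
  by (rule eq_matI) (auto simp: stack_rows_def)

lemma dim_stack_rows [simp]:
  "dim_row (stack_rows d As) = sum_list (map dim_row As)" "dim_col (stack_rows d As) = d"
  by (auto simp: stack_rows_def length_concat o_def)

lemma stack_rows_carrier [simp]: "stack_rows d As \<in> carrier_mat (sum_list (map dim_row As)) d"
  by (rule carrier_matI) auto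

lemma stack_rows_Cons:
  assumes "dim_col A = d"
  shows "stack_rows d (A # As) = A @\<^sub>r stack_rows d As"
  using assms
  by (intro eq_matI) (auto simp: stack_rows_def append_rows_def mat_of_rows_index nth_append length_concat o_def)

lemma index_append_rows:
  assumes "A \<in> carrier_mat m d" "B \<in> carrier_mat n d" "i < m + n" "j < d"
  shows "(A @\<^sub>r B) $$ (i, j) = (if i < m then A $$ (i, j) else B $$ (i - m, j))"
  using assms by (auto simp: append_rows_def)

lemma append_rows_mult:
  fixes A :: "'a::semiring_0 mat"
  assumes "A \<in> carrier_mat m d" "B \<in> carrier_mat n d" "L \<in> carrier_mat d d'"
  shows "(A @\<^sub>r B) * L = (A * L) @\<^sub>r (B * L)"
proof (rule eq_matI)
  fix i j assume "i < dim_row ((A * L) @\<^sub>r (B * L))" "j < dim_col ((A * L) @\<^sub>r (B * L))"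
  then have ij: "i < m + n" "j < d'"
    using assms by (simp_all add: append_rows_def)
  have "((A @\<^sub>r B) * L) $$ (i, j) = (\<Sum>l\<in>{0..<d}. (A @\<^sub>r B) $$ (i, l) * L $$ (l, j))"
    using ij assms by (simp add: append_rows_def scalar_prod_def del: index_mat_four_block(1))
  also have "\<dots> = ((A * L) @\<^sub>r (B * L)) $$ (i, j)"
    using ij assms
    by (subst index_append_rows[of _ m d' _ n])
      (auto simp: scalar_prod_def index_append_rows[OF assms(1,2)] intro!: sum.cong)
  finally show "((A @\<^sub>r B) * L) $$ (i, j) = ((A * L) @\<^sub>r (B * L)) $$ (i, j)" .
qed (use assms in \<open>simp_all add: append_rows_def\<close>)

lemma stack_rows_mult:
  fixes L :: "'a::semiring_0 mat"
  assumes "\<forall>A \<in> set As. dim_col A = d" "L \<in> carrier_mat d d'"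
  shows "stack_rows d As * L = stack_rows d' (map (\<lambda>A. A * L) As)"
  using assms(1)
proof (induction As)
  case Nil
  then show ?case using assms(2) by simp
next
  case (Cons A As)
  have "stack_rows d (A # As) * L = (A * L) @\<^sub>r (stack_rows d As * L)"
  proof -
    have A: "A \<in> carrier_mat (dim_row A) d" "dim_col A = d"
      using Cons.prems by auto
    show ?thesis
      unfolding stack_rows_Cons[OF A(2)] by (rule append_rows_mult[OF A(1) stack_rows_carrier assms(2)])
  qed
  also have "\<dots> = stack_rows d' (map (\<lambda>A. A * L) (A # As))"
    using Cons assms(2) by (simp add: stack_rows_Cons)
  finally show ?case .
qed

lemma stack_rows_zero_columns:
  fixes Ys :: "'a::semiring_0 mat list"
  assumes "\<forall>Y \<in> set Ys. dim_col Y = f"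
  shows "stack_rows (e + f) (map (\<lambda>Y. four_block_mat (0\<^sub>m (dim_row Y) e) Y (0\<^sub>m 0 e) (0\<^sub>m 0 f)) Ys)
    = four_block_mat (0\<^sub>m (sum_list (map dim_row Ys)) e) (stack_rows f Ys) (0\<^sub>m 0 e) (0\<^sub>m 0 f)"
  using assms
proof (induction Ys)
  case Nil
  then show ?case by (intro eq_matI) auto
next
  case (Cons Y Ys)
  let ?n = "sum_list (map dim_row Ys)"
  have "stack_rows (e + f) (map (\<lambda>Y. four_block_mat (0\<^sub>m (dim_row Y) e) Y (0\<^sub>m 0 e) (0\<^sub>m 0 f)) (Y # Ys))
    = four_block_mat (0\<^sub>m (dim_row Y) e) Y (0\<^sub>m 0 e) (0\<^sub>m 0 f) @\<^sub>r
      four_block_mat (0\<^sub>m ?n e) (stack_rows f Ys) (0\<^sub>m 0 e) (0\<^sub>m 0 f)"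
    using Cons by (simp add: stack_rows_Cons)
  also have "\<dots> = four_block_mat (0\<^sub>m (dim_row Y + ?n) e) (Y @\<^sub>r stack_rows f Ys) (0\<^sub>m 0 e) (0\<^sub>m 0 f)"
    using Cons.prems by (intro eq_matI) (auto simp: append_rows_def)
  finally show ?case
    using Cons.prems by (simp add: stack_rows_Cons)
qed


text \<open>
  Rows orthogonal to all rows of \<open>A\<close> vanish in the coordinates that the rows of \<open>A\<close> occupy: their
  part \<open>X\<close> in these coordinates satisfies \<open>B * mat_adjoint X = 0\<close>, and \<open>B\<close> is injective.
\<close>

lemma orthogonal_to_injective_rows:
  fixes A :: "'a::real_or_complex mat"
  assumes A: "A \<in> carrier_mat m d" and C: "C \<in> carrier_mat p d" and orth: "C * mat_adjoint A = 0\<^sub>m p m"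
    and L: "unitary_mat d L" and d: "d = e + f" and B: "B \<in> carrier_mat m e"
    and AL: "A * L = four_block_mat B (0\<^sub>m m f) (0\<^sub>m 0 e) (0\<^sub>m 0 f)"
    and inj: "\<forall>x \<in> carrier_vec e. B *\<^sub>v x = 0\<^sub>v m \<longrightarrow> x = 0\<^sub>v e"
  obtains Y where "Y \<in> carrier_mat p f" "C * L = four_block_mat (0\<^sub>m p e) Y (0\<^sub>m 0 e) (0\<^sub>m 0 f)"
proof -
  have Lc: "L \<in> carrier_mat d d" using L by (rule unitary_mat_carrier)
  have CL: "C * L \<in> carrier_mat p d" using C Lc by simp
  define X where "X = mat p e (\<lambda>(i, j). (C * L) $$ (i, j))"
  define Y where "Y = mat p f (\<lambda>(i, j). (C * L) $$ (i, e + j))"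
  have c: "X \<in> carrier_mat p e" "Y \<in> carrier_mat p f" "mat_adjoint X \<in> carrier_mat e p" by (simp_all add: X_def Y_def)
  have CL_eq: "C * L = four_block_mat X Y (0\<^sub>m 0 e) (0\<^sub>m 0 f)"
    using CL d by (intro eq_matI) (auto simp: X_def Y_def simp del: index_mult_mat(1))
  have "(A * L) * mat_adjoint (C * L) = (A * L) * (mat_adjoint L * mat_adjoint C)"
    by (simp add: mat_adjoint_mult[OF C Lc])
  also have "\<dots> = A * ((L * mat_adjoint L) * mat_adjoint C)"
    by (rule mult_mat_middle[OF A Lc mat_adjoint_carrier[OF Lc] mat_adjoint_carrier[OF C]])
  also have "\<dots> = A * mat_adjoint C"
    using C unitary_mat_right[OF L] left_mult_one_mat[OF mat_adjoint_carrier[OF C]] by simp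
  also have "\<dots> = mat_adjoint (C * mat_adjoint A)"
    by (subst mat_adjoint_mult[OF C mat_adjoint_carrier[OF A]]) simp
  finally have *: "(A * L) * mat_adjoint (C * L) = 0\<^sub>m m p"
    by (simp add: orth)
  have "mat_adjoint (C * L) = four_block_mat (mat_adjoint X) (0\<^sub>m e 0) (mat_adjoint Y) (0\<^sub>m f 0)"
    unfolding CL_eq using c by (intro eq_matI) auto
  then have "(A * L) * mat_adjoint (C * L) = four_block_mat (B * mat_adjoint X) (0\<^sub>m m 0) (0\<^sub>m 0 p) (0\<^sub>m 0 0)"
    using c B unfolding AL
    by (simp only:) (subst mult_four_block_mat[of _ m e _ f _ 0 _ _ p _ 0], auto)
  also have "\<dots> = B * mat_adjoint X"
    using c B by (intro eq_matI) auto
  finally have "B * mat_adjoint X = 0\<^sub>m m p"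
    using * by simp
  then have "mat_adjoint X = 0\<^sub>m e p"
    using mult_eq_0_if_injective[OF B c(3)] inj by blast
  then have "X = 0\<^sub>m p e"
    by (metis mat_adjoint_adjoint mat_adjoint_zero)
  then show ?thesis
    using that[OF c(2)] CL_eq by simp
qed

text \<open>
  The families are given one coordinate range after the other. The empty block at the end takes
  the columns that correspond to vectors orthogonal to all rows.
\<close>

lemma orthogonal_families_block_diagonal:
  fixes As :: "'a::real_or_complex mat list"
  assumes "\<forall>A \<in> set As. dim_col A = d"
    and "sorted_wrt (\<lambda>A C. C * mat_adjoint A = 0\<^sub>m (dim_row C) (dim_row A)) As"
  shows "\<exists>L Bs. unitary_mat d L \<and> map dim_row Bs = map dim_row As @ [0] \<and>
    stack_rows d As * L = diag_block_mat Bs"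
  using assms
proof (induction "length As" arbitrary: As d)
  case 0
  then show ?case
    by (intro exI[of _ "1\<^sub>m d"] exI[of _ "[0\<^sub>m 0 d]"]) (simp add: unitary_mat_one)
next
  case (Suc l All)
  obtain A As where All: "All = A # As"
    using Suc.hyps(2) by (cases All) auto
  note prems = Suc.prems[unfolded All]
  define m where "m = dim_row A"
  have A: "A \<in> carrier_mat m d" using prems by (auto simp: m_def)
  obtain L e f B where L: "unitary_mat d L" "d = e + f" "B \<in> carrier_mat m e"
    "A * L = four_block_mat B (0\<^sub>m m f) (0\<^sub>m 0 e) (0\<^sub>m 0 f)"
    "\<forall>x \<in> carrier_vec e. B *\<^sub>v x = 0\<^sub>v m \<longrightarrow> x = 0\<^sub>v e"
    using kernel_column_split[OF A] by blast
  have Lc: "L \<in> carrier_mat d d" using L(1) by (rule unitary_mat_carrier)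
  let ?pad = "\<lambda>Y. four_block_mat (0\<^sub>m (dim_row Y) e) Y (0\<^sub>m 0 e) (0\<^sub>m 0 f)"
  have "\<exists>Y. dim_row Y = dim_row C \<and> dim_col Y = f \<and> C * L = ?pad Y" if "C \<in> set As" for C
  proof -
    have "C \<in> carrier_mat (dim_row C) d" "C * mat_adjoint A = 0\<^sub>m (dim_row C) m"
      using prems that by (auto simp: m_def)
    from orthogonal_to_injective_rows[OF A this L] show ?thesis
      by (metis carrier_matD)
  qed
  then obtain y where y: "\<And>C. C \<in> set As \<Longrightarrow> dim_row (y C) = dim_row C \<and> dim_col (y C) = f \<and> C * L = ?pad (y C)"
    by metis
  define Ys where "Ys = map y As"
  have rows_Ys: "map dim_row Ys = map dim_row As" using y by (simp add: Ys_def)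
  have cols_Ys: "\<forall>Y \<in> set Ys. dim_col Y = f" using y by (auto simp: Ys_def)
  have "y C * mat_adjoint (y A') = 0\<^sub>m (dim_row (y C)) (dim_row (y A'))"
    if AC: "A' \<in> set As" "C \<in> set As" "C * mat_adjoint A' = 0\<^sub>m (dim_row C) (dim_row A')" for A' C
  proof -
    obtain p q where c: "A' \<in> carrier_mat p d" "C \<in> carrier_mat q d"
      "y A' \<in> carrier_mat p f" "y C \<in> carrier_mat q f"
      using prems y AC by (metis carrier_matI list.set_intros(2))
    have pad: "A' * L = four_block_mat (0\<^sub>m p e) (y A') (0\<^sub>m 0 e) (0\<^sub>m 0 f)"
      "C * L = four_block_mat (0\<^sub>m q e) (y C) (0\<^sub>m 0 e) (0\<^sub>m 0 f)"
      using y AC c by auto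
    have "(C * L) * mat_adjoint (A' * L) = (C * L) * (mat_adjoint L * mat_adjoint A')"
      by (simp add: mat_adjoint_mult[OF c(1) Lc])
    also have "\<dots> = C * ((L * mat_adjoint L) * mat_adjoint A')"
      by (rule mult_mat_middle[OF c(2) Lc mat_adjoint_carrier[OF Lc] mat_adjoint_carrier[OF c(1)]])
    also have "\<dots> = C * mat_adjoint A'"
      using unitary_mat_right[OF L(1)] left_mult_one_mat[OF mat_adjoint_carrier[OF c(1)]] by simp
    finally have *: "(C * L) * mat_adjoint (A' * L) = 0\<^sub>m q p"
      using AC(3) c by simp
    have "mat_adjoint (A' * L) = four_block_mat (0\<^sub>m e p) (0\<^sub>m e 0) (mat_adjoint (y A')) (0\<^sub>m f 0)"
      unfolding pad using c(3) by (intro eq_matI) auto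
    then have "(C * L) * mat_adjoint (A' * L) = four_block_mat (0\<^sub>m q e) (y C) (0\<^sub>m 0 e) (0\<^sub>m 0 f)
        * four_block_mat (0\<^sub>m e p) (0\<^sub>m e 0) (mat_adjoint (y A')) (0\<^sub>m f 0)"
      by (simp only: pad)
    also have "\<dots> = four_block_mat (y C * mat_adjoint (y A')) (0\<^sub>m q 0) (0\<^sub>m 0 p) (0\<^sub>m 0 0)"
      using c(3,4) by (subst mult_four_block_mat[of _ q e _ f _ 0 _ _ p _ 0]) auto
    also have "\<dots> = y C * mat_adjoint (y A')"
      using c(3,4) by (intro eq_matI) auto
    finally show ?thesis
      using * c by simp
  qed
  then have "sorted_wrt (\<lambda>A C. C * mat_adjoint A = 0\<^sub>m (dim_row C) (dim_row A)) Ys"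
    using prems(2) unfolding Ys_def sorted_wrt_map
    by (auto intro: sorted_wrt_mono_rel[rotated])
  moreover have "l = length Ys"
    using Suc.hyps(2) by (simp add: All Ys_def)
  ultimately obtain L' Bs where L': "unitary_mat f L'"
    "map dim_row Bs = map dim_row Ys @ [0]" "stack_rows f Ys * L' = diag_block_mat Bs"
    using Suc.hyps(1)[OF _ cols_Ys] by blast
  have L'c: "L' \<in> carrier_mat f f" using L'(1) by (rule unitary_mat_carrier)
  \<comment> \<open>The coordinates of the first family are kept, the others are changed by induction.\<close>
  define F where "F = four_block_mat (1\<^sub>m e) (0\<^sub>m e f) (0\<^sub>m f e) L'"
  define n where "n = sum_list (map dim_row Ys)"
  have F: "unitary_mat d F"
    using unitary_mat_four_block[OF unitary_mat_one L'(1)] by (simp add: F_def L(2))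
  have stack_c: "stack_rows f Ys \<in> carrier_mat n f" by (simp add: n_def)
  have Bs_c: "diag_block_mat Bs \<in> carrier_mat n f"
    using stack_c L'c by (simp flip: L'(3))
  have map_eq: "map (\<lambda>A. A * L) As = map ?pad Ys" using y by (auto simp: Ys_def)
  have "stack_rows d As * L = stack_rows d (map (\<lambda>A. A * L) As)"
    using prems by (intro stack_rows_mult Lc) auto
  also have "\<dots> = four_block_mat (0\<^sub>m n e) (stack_rows f Ys) (0\<^sub>m 0 e) (0\<^sub>m 0 f)"
    unfolding map_eq L(2) n_def by (rule stack_rows_zero_columns[OF cols_Ys])
  finally have As_L: "stack_rows d As * L = four_block_mat (0\<^sub>m n e) (stack_rows f Ys) (0\<^sub>m 0 e) (0\<^sub>m 0 f)" .
  have "stack_rows d (A # As) * L = (A * L) @\<^sub>r (stack_rows d As * L)"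
    using prems append_rows_mult[OF A stack_rows_carrier Lc] by (simp add: stack_rows_Cons)
  also have "\<dots> = four_block_mat B (0\<^sub>m m f) (0\<^sub>m n e) (stack_rows f Ys)"
    unfolding As_L L(4) using L(3) stack_c by (intro eq_matI) (auto simp: append_rows_def)
  finally have "stack_rows d (A # As) * (L * F) = four_block_mat B (0\<^sub>m m f) (0\<^sub>m n e) (stack_rows f Ys) * F"
    using assoc_mult_mat[OF stack_rows_carrier Lc unitary_mat_carrier[OF F], of "A # As"] by simp
  also have "\<dots> = four_block_mat B (0\<^sub>m m f) (0\<^sub>m n e) (stack_rows f Ys * L')"
    unfolding F_def using L(3) stack_c L'c
    by (subst mult_four_block_mat[of _ m e _ f _ n _ _ e _ f]) auto
  also have "\<dots> = diag_block_mat (B # Bs)"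
    using L(3) Bs_c by (simp add: L'(3) Let_def)
  finally have "stack_rows d (A # As) * (L * F) = diag_block_mat (B # Bs)" .
  moreover have "map dim_row (B # Bs) = map dim_row (A # As) @ [0]"
    using L(3) A L'(2) rows_Ys by simp
  ultimately show ?case
    using unitary_mat_mult[OF L(1) F] unfolding All by blast
qed

section \<open>Connections with scalar holonomy\<close>

text \<open>
  The product of \<open>G\<close> over the consecutive pairs of a walk, that is, parallel transport along it.
  On a closed walk \<open>js @ [hd js]\<close> it is the holonomy of the cycle \<open>js\<close>.
\<close>

fun path_product :: "nat \<Rightarrow> ('i \<Rightarrow> 'i \<Rightarrow> 'a::semiring_1 mat) \<Rightarrow> 'i list \<Rightarrow> 'a mat" where
  "path_product r G (x # y # zs) = G x y * path_product r G (y # zs)"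
| "path_product r G xs = 1\<^sub>m r"

locale unitary_connection =
  fixes C :: "'i set" and r :: nat and G :: "'i \<Rightarrow> 'i \<Rightarrow> 'a::real_or_complex mat"
  assumes carrier: "i \<in> C \<Longrightarrow> j \<in> C \<Longrightarrow> G i j \<in> carrier_mat r r"
    and adjoint: "i \<in> C \<Longrightarrow> j \<in> C \<Longrightarrow> G j i = mat_adjoint (G i j)"
    and edge: "i \<in> C \<Longrightarrow> j \<in> C \<Longrightarrow> G i j \<noteq> 0\<^sub>m r r \<Longrightarrow> \<exists>a U. unitary_mat r U \<and> G i j = a \<cdot>\<^sub>m U"
begin

lemma path_product_carrier: "set xs \<subseteq> C \<Longrightarrow> path_product r G xs \<in> carrier_mat r r"
proof (induction xs rule: induct_list012)
  case (3 x y zs)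
  then show ?case
    using carrier[of x y] by (auto intro: mult_carrier_mat)
qed simp_all

lemma path_product_split:
  "set (xs @ y # zs) \<subseteq> C \<Longrightarrow>
    path_product r G (xs @ y # zs) = path_product r G (xs @ [y]) * path_product r G (y # zs)"
proof (induction xs rule: induct_list012)
  case 1
  then show ?case
    using path_product_carrier[of "y # zs"] by simp
next
  case (2 x)
  then show ?case
    using carrier[of x y] path_product_carrier[of "y # zs"] by simp
next
  case (3 x x' xs)
  have "path_product r G (x # x' # xs @ y # zs)
      = G x x' * (path_product r G (x' # xs @ [y]) * path_product r G (y # zs))"
    using 3 by simp
  also have "\<dots> = (G x x' * path_product r G (x' # xs @ [y])) * path_product r G (y # zs)"
    using 3(3) carrier[of x x'] path_product_carrier[of "x' # xs @ [y]"] path_product_carrier[of "y # zs"]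
    by (intro assoc_mult_mat[symmetric]) auto
  finally show ?case by simp
qed

lemma path_product_rev:
  "set xs \<subseteq> C \<Longrightarrow> path_product r G (rev xs) = mat_adjoint (path_product r G xs)"
proof (induction xs rule: induct_list012)
  case (3 x y zs)
  have "path_product r G (rev (x # y # zs)) = path_product r G (rev zs @ y # [x])"
    by simp
  also have "\<dots> = path_product r G (rev (y # zs)) * path_product r G [y, x]"
    using 3(3) by (subst path_product_split) auto
  also have "\<dots> = mat_adjoint (path_product r G (y # zs)) * mat_adjoint (G x y)"
    using 3 carrier[of x y] by (simp add: adjoint[of x y])
  also have "\<dots> = mat_adjoint (G x y * path_product r G (y # zs))"
    using 3(3) carrier[of x y] path_product_carrier[of "y # zs"]
    by (intro mat_adjoint_mult[symmetric]) auto
  finally show ?case by simp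
qed simp_all

text \<open>
  A walk that visits \<open>y\<close> twice is a shorter closed walk with another closed walk inserted at \<open>y\<close>.
  The inserted one acts as a scalar and can be pulled out. An absent edge only makes the
  product vanish.
\<close>

lemma closed_walk_scalar:
  assumes simple: "\<And>js. js \<noteq> [] \<Longrightarrow> distinct js \<Longrightarrow> set js \<subseteq> C \<Longrightarrow> scalar_mat r (path_product r G (js @ [hd js]))"
  shows "js \<noteq> [] \<Longrightarrow> set js \<subseteq> C \<Longrightarrow> scalar_mat r (path_product r G (js @ [hd js]))"
proof (induction "length js" arbitrary: js rule: less_induct)
  case less
  show ?case
  proof (cases "distinct js")
    case True
    then show ?thesis using simple less.prems by blast
  next
    case False
    then obtain xs ys zs y where js: "js = xs @ [y] @ ys @ [y] @ zs"
      using not_distinct_decomp by blast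
    define h where "h = hd js"
    have h: "h = hd (xs @ [y] @ zs)" "h \<in> C"
      using less.prems by (cases xs; auto simp: h_def js)+
    have sub: "set xs \<subseteq> C" "set ys \<subseteq> C" "set zs \<subseteq> C" "y \<in> C"
      using less.prems(2) by (auto simp: js)
    have "scalar_mat r (path_product r G ((y # ys) @ [hd (y # ys)]))"
      using less.hyps[of "y # ys"] sub by (simp add: js)
    then obtain a where a: "path_product r G (y # ys @ [y]) = a \<cdot>\<^sub>m 1\<^sub>m r"
      by (auto simp: scalar_mat_def)
    have "scalar_mat r (path_product r G ((xs @ [y] @ zs) @ [hd (xs @ [y] @ zs)]))"
      using less.hyps[of "xs @ [y] @ zs"] sub by (simp add: js)
    then obtain b where b: "path_product r G (xs @ y # zs @ [h]) = b \<cdot>\<^sub>m 1\<^sub>m r"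
      by (auto simp: scalar_mat_def h(1))
    have c: "path_product r G (xs @ [y]) \<in> carrier_mat r r" "path_product r G (y # zs @ [h]) \<in> carrier_mat r r"
      using sub h(2) by (auto intro!: path_product_carrier)
    have "path_product r G (js @ [h])
        = path_product r G (xs @ [y]) * path_product r G (y # ys @ y # zs @ [h])"
      using path_product_split[of xs y "ys @ y # zs @ [h]"] sub h(2) by (simp add: js)
    also have "path_product r G (y # ys @ y # zs @ [h])
        = path_product r G (y # ys @ [y]) * path_product r G (y # zs @ [h])"
      using path_product_split[of "y # ys" y "zs @ [h]"] sub h(2) by simp
    also have "\<dots> = a \<cdot>\<^sub>m path_product r G (y # zs @ [h])"
      unfolding a using c by (simp add: mult_smult_assoc_mat[of _ r r _ r])
    also have "path_product r G (xs @ [y]) * \<dots>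
        = a \<cdot>\<^sub>m (path_product r G (xs @ [y]) * path_product r G (y # zs @ [h]))"
      using c by (rule mult_smult_distrib)
    also have "path_product r G (xs @ [y]) * path_product r G (y # zs @ [h]) = b \<cdot>\<^sub>m 1\<^sub>m r"
      using path_product_split[of xs y "zs @ [h]"] sub h(2) b by simp
    also have "a \<cdot>\<^sub>m (b \<cdot>\<^sub>m 1\<^sub>m r) = (a * b) \<cdot>\<^sub>m (1\<^sub>m r :: 'a mat)"
      by (intro eq_matI) auto
    finally show ?thesis
      by (auto simp: scalar_mat_def h_def)
  qed
qed

definition edges :: "('i \<times> 'i) set" where
  "edges = {(i, j). i \<in> C \<and> j \<in> C \<and> G i j \<noteq> 0\<^sub>m r r}"

lemma unitary_path:
  assumes "(i, j) \<in> edges\<^sup>*" "i \<in> C"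
  shows "\<exists>p a U. p \<noteq> [] \<and> set p \<subseteq> C \<and> hd p = i \<and> last p = j \<and>
    a \<noteq> 0 \<and> unitary_mat r U \<and> path_product r G p = a \<cdot>\<^sub>m U"
  using assms
proof (induction rule: converse_rtrancl_induct)
  case base
  have "1\<^sub>m r = (1 :: 'a) \<cdot>\<^sub>m 1\<^sub>m r" by (intro eq_matI) auto
  then show ?case
    using base unitary_mat_one by (intro exI[of _ "[j]"] exI[of _ 1] exI[of _ "1\<^sub>m r"]) auto
next
  case (step i k)
  have k: "i \<in> C" "k \<in> C" "G i k \<noteq> 0\<^sub>m r r"
    using step(1) by (auto simp: edges_def)
  obtain a U where a: "unitary_mat r U" "G i k = a \<cdot>\<^sub>m U"
    using edge[OF k] by blast
  have "a \<noteq> 0"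
    using k(3) unitary_mat_carrier[OF a(1)] by (auto simp: a(2))
  obtain p b V where p: "p \<noteq> []" "set p \<subseteq> C" "hd p = k" "last p = j" "b \<noteq> 0" "unitary_mat r V"
    "path_product r G p = b \<cdot>\<^sub>m V"
    using step.IH k(2) by blast
  obtain p' where p': "p = k # p'" using p by (cases p) auto
  have c: "U \<in> carrier_mat r r" "V \<in> carrier_mat r r"
    using a(1) p(6) by (auto intro: unitary_mat_carrier)
  have "path_product r G (i # p) = (a \<cdot>\<^sub>m U) * (b \<cdot>\<^sub>m V)"
    using p(7) by (simp add: p' a(2))
  also have "\<dots> = (a * b) \<cdot>\<^sub>m (U * V)"
    using c by (intro eq_matI) (auto simp: mult_ac)
  finally show ?case
    using p k unitary_mat_mult[OF a(1) p(6)] \<open>a \<noteq> 0\<close>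
    by (intro exI[of _ "i # p"] exI[of _ "a * b"] exI[of _ "U * V"]) auto
qed

text \<open>
  Every index is joined to the root of its connected component by a path along nonzero edges, and
  the unitary part of the transport along that path serves as its frame. Expressed in the frames, an
  edge is the holonomy of the closed walk that goes from the root to one end of the edge, crosses
  it, and returns to the root from the other end.
\<close>

lemma gauge_to_scalars:
  assumes simple: "\<And>js. js \<noteq> [] \<Longrightarrow> distinct js \<Longrightarrow> set js \<subseteq> C \<Longrightarrow> scalar_mat r (path_product r G (js @ [hd js]))"
  obtains U where "\<And>i. i \<in> C \<Longrightarrow> unitary_mat r (U i)"
    "\<And>i j. i \<in> C \<Longrightarrow> j \<in> C \<Longrightarrow> scalar_mat r (mat_adjoint (U i) * G i j * U j)"
proof -
  \<comment> \<open>Adjacent indices can reach the same indices, so this choice gives them the same root.\<close>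
  define root where "root i = (SOME k. (i, k) \<in> edges\<^sup>*)" for i
  have root: "(i, root i) \<in> edges\<^sup>*" for i
    unfolding root_def by (rule someI[of _ i]) simp
  have "sym edges"
  proof (rule symI)
    fix i j assume ij: "(i, j) \<in> edges"
    then have "G i j = mat_adjoint (G j i)" by (intro adjoint) (auto simp: edges_def)
    then have "G j i \<noteq> 0\<^sub>m r r" using ij by (auto simp: edges_def)
    then show "(j, i) \<in> edges" using ij by (simp add: edges_def)
  qed
  have root_eq: "root i = root j" if "(i, j) \<in> edges" for i j
  proof -
    have "(j, i) \<in> edges" using \<open>sym edges\<close> that by (rule symD)
    with that have "(i, k) \<in> edges\<^sup>* \<longleftrightarrow> (j, k) \<in> edges\<^sup>*" for k
      by (meson converse_rtrancl_into_rtrancl)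
    then show ?thesis by (simp add: root_def)
  qed
  have "\<forall>i. \<exists>p a U. i \<in> C \<longrightarrow> p \<noteq> [] \<and> set p \<subseteq> C \<and> hd p = i \<and> last p = root i \<and>
      a \<noteq> 0 \<and> unitary_mat r U \<and> path_product r G p = a \<cdot>\<^sub>m U"
    using unitary_path[OF root] by blast
  then obtain p a U where pU: "\<And>i. i \<in> C \<Longrightarrow> p i \<noteq> [] \<and> set (p i) \<subseteq> C \<and> hd (p i) = i \<and> last (p i) = root i \<and>
      a i \<noteq> 0 \<and> unitary_mat r (U i) \<and> path_product r G (p i) = a i \<cdot>\<^sub>m U i"
    by metis
  have "scalar_mat r (mat_adjoint (U i) * G i j * U j)" if ij: "i \<in> C" "j \<in> C" for i j
  proof -
    have c: "U i \<in> carrier_mat r r" "U j \<in> carrier_mat r r" "G i j \<in> carrier_mat r r"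
        "mat_adjoint (U i) \<in> carrier_mat r r"
      using pU[OF ij(1)] pU[OF ij(2)] carrier[OF ij] unitary_mat_carrier[of r "U i"] unitary_mat_carrier[of r "U j"]
      by auto
    show ?thesis
    proof (cases "G i j = 0\<^sub>m r r")
      case True
      have "mat_adjoint (U i) * G i j * U j = 0 \<cdot>\<^sub>m 1\<^sub>m r"
        unfolding True using c by (intro eq_matI) auto
      then show ?thesis unfolding scalar_mat_def by blast
    next
      case False
      then have "(i, j) \<in> edges" using ij by (simp add: edges_def)
      note root_ij = root_eq[OF this]
      obtain p1 where p1: "p i = i # p1" using pU[OF ij(1)] by (cases "p i") auto
      obtain p2 where p2: "p j = j # p2" using pU[OF ij(2)] by (cases "p j") auto
      \<comment> \<open>The concatenated walk starts and ends at the common root.\<close>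
      define js where "js = butlast (rev (p i) @ p j)"
      have len: "js \<noteq> []" by (simp add: js_def p1 p2 butlast_append)
      have closed: "rev (p i) @ p j = js @ [hd js]"
      proof -
        have "last (rev (p i) @ p j) = hd (rev (p i) @ p j)"
        proof -
          have "last (rev (p i) @ p j) = root j"
            using pU[OF ij(2)] by simp
          moreover have "hd (rev (p i) @ p j) = root i"
            using pU[OF ij(1)] by (simp add: hd_append hd_rev)
          ultimately show ?thesis using root_ij by simp
        qed
        moreover have "hd js = hd (rev (p i) @ p j)"
          by (simp add: js_def p1 p2 butlast_append hd_append)
        ultimately show ?thesis
          using append_butlast_last_id[of "rev (p i) @ p j"] pU[OF ij(1)] by (simp add: js_def)
      qed
      have "set (js @ [hd js]) \<subseteq> C"
        unfolding closed[symmetric] using pU[OF ij(1)] pU[OF ij(2)] by auto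
      then obtain b where "path_product r G (rev (p i) @ p j) = b \<cdot>\<^sub>m 1\<^sub>m r"
        using closed_walk_scalar[OF simple len] by (auto simp: closed scalar_mat_def)
      moreover have "path_product r G (rev (p i) @ p j)
          = path_product r G (rev (p i)) * path_product r G (i # p j)"
        using path_product_split[of "rev p1" i "p j"] pU[OF ij(1)] pU[OF ij(2)] by (simp add: p1)
      moreover have "path_product r G (i # p j) = G i j * path_product r G (p j)"
        by (simp add: p2)
      moreover have "path_product r G (rev (p i)) = conjugate (a i) \<cdot>\<^sub>m mat_adjoint (U i)"
        using path_product_rev[of "p i"] pU[OF ij(1)] by (simp add: mat_adjoint_smult)
      ultimately have "b \<cdot>\<^sub>m 1\<^sub>m r = (conjugate (a i) \<cdot>\<^sub>m mat_adjoint (U i)) * (G i j * (a j \<cdot>\<^sub>m U j))"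
        using pU[OF ij(2)] by simp
      also have "\<dots> = (conjugate (a i) * a j) \<cdot>\<^sub>m (mat_adjoint (U i) * G i j * U j)"
      proof -
        have "G i j * (a j \<cdot>\<^sub>m U j) = a j \<cdot>\<^sub>m (G i j * U j)"
          using c by (intro mult_smult_distrib)
        moreover have "mat_adjoint (U i) * (G i j * U j) = mat_adjoint (U i) * G i j * U j"
          using c by (intro assoc_mult_mat[symmetric])
        moreover have "(x \<cdot>\<^sub>m M) * (y \<cdot>\<^sub>m N) = (x * y) \<cdot>\<^sub>m (M * N)"
          if "M \<in> carrier_mat r r" "N \<in> carrier_mat r r" for x y and M N :: "'a mat"
          using that by (intro eq_matI) (auto simp: mult_ac)
        ultimately show ?thesis
          using c by (metis mult_carrier_mat)
      qed
      finally have eq: "(conjugate (a i) * a j) \<cdot>\<^sub>m (mat_adjoint (U i) * G i j * U j) = b \<cdot>\<^sub>m 1\<^sub>m r" ..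
      have "conjugate (a i) * a j \<noteq> 0" using pU[OF ij(1)] pU[OF ij(2)] by simp
      then have "mat_adjoint (U i) * G i j * U j = (b / (conjugate (a i) * a j)) \<cdot>\<^sub>m 1\<^sub>m r"
      proof -
        have "M = (b / x) \<cdot>\<^sub>m 1\<^sub>m r" if "x \<noteq> 0" "x \<cdot>\<^sub>m M = b \<cdot>\<^sub>m 1\<^sub>m r" for x and M :: "'a mat"
        proof -
          have "M = (1 / x) \<cdot>\<^sub>m (x \<cdot>\<^sub>m M)"
            using that(1) by (intro eq_matI) auto
          also have "\<dots> = (b / x) \<cdot>\<^sub>m 1\<^sub>m r"
            unfolding that(2) by (intro eq_matI) auto
          finally show ?thesis .
        qed
        then show ?thesis
          using eq \<open>conjugate (a i) * a j \<noteq> 0\<close> by blast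
      qed
      then show ?thesis unfolding scalar_mat_def by blast
    qed
  qed
  then show ?thesis
    using that pU by blast
qed

lemma path_product_zero_or_unitary:
  "set xs \<subseteq> C \<Longrightarrow> path_product r G xs = 0\<^sub>m r r \<or>
    (\<exists>a U. a \<noteq> 0 \<and> unitary_mat r U \<and> path_product r G xs = a \<cdot>\<^sub>m U)"
proof (induction xs rule: induct_list012)
  case (3 x y zs)
  have sub: "x \<in> C" "y \<in> C" "set (y # zs) \<subseteq> C" using 3(3) by auto
  note c = carrier[OF sub(1,2)] path_product_carrier[OF sub(3)]
  consider "G x y = 0\<^sub>m r r" | "path_product r G (y # zs) = 0\<^sub>m r r"
    | a U b V where "G x y \<noteq> 0\<^sub>m r r" "unitary_mat r U" "G x y = a \<cdot>\<^sub>m U"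
      "b \<noteq> 0" "unitary_mat r V" "path_product r G (y # zs) = b \<cdot>\<^sub>m V"
    using edge[OF sub(1,2)] 3(2)[OF sub(3)] by blast
  then show ?case
  proof cases
    case 3
    have UV: "U \<in> carrier_mat r r" "V \<in> carrier_mat r r"
      using 3(2,5) by (auto intro: unitary_mat_carrier)
    have "a \<noteq> 0" using 3(1,3) UV by auto
    have "path_product r G (x # y # zs) = (a * b) \<cdot>\<^sub>m (U * V)"
      unfolding path_product.simps 3(3,6) using UV by (intro eq_matI) (auto simp: mult_ac)
    then show ?thesis
      using unitary_mat_mult[OF 3(2,5)] \<open>a \<noteq> 0\<close> 3(4)
      by (intro disjI2 exI[of _ "a * b"] exI[of _ "U * V"]) auto
  qed (use c in auto)
next
  case 1
  have "1\<^sub>m r = (1 :: 'a) \<cdot>\<^sub>m 1\<^sub>m r" by (intro eq_matI) auto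
  then show ?case using unitary_mat_one by (metis one_neq_zero path_product.simps(2))
next
  case (2 x)
  have "1\<^sub>m r = (1 :: 'a) \<cdot>\<^sub>m 1\<^sub>m r" by (intro eq_matI) auto
  then show ?case using unitary_mat_one by (metis one_neq_zero path_product.simps(3))
qed

end

section \<open>Eigenvalues of covariance products\<close>

lemma card_le_1_iff_subset_singleton: "finite A \<Longrightarrow> card A \<le> 1 \<longleftrightarrow> (\<exists>x. A \<subseteq> {x})"
proof
  assume "finite A" "card A \<le> 1"
  then show "\<exists>x. A \<subseteq> {x}"
    by (cases "A = {}") (auto simp: le_Suc_eq card_1_singleton_iff)
next
  assume "\<exists>x. A \<subseteq> {x}"
  then show "card A \<le> 1"
    using card_mono[of "{_}" A] by fastforce
qed

lemma smult_vec_eq_0D: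
  fixes v :: "'a::field vec"
  assumes "v \<in> carrier_vec n" "v \<noteq> 0\<^sub>v n" "a \<cdot>\<^sub>v v = 0\<^sub>v n"
  shows "a = 0"
proof (rule ccontr)
  assume "a \<noteq> 0"
  then have "v $ i = 0" if "i < n" for i
    using arg_cong[OF assms(3), of "\<lambda>v. v $ i"] assms(1) that by simp
  then show False
    using assms(1,2) by (auto simp: vec_eq_iff)
qed

lemma smult_vec_right_cancel:
  fixes v :: "'a::field vec"
  assumes "v \<in> carrier_vec n" "v \<noteq> 0\<^sub>v n" "a \<cdot>\<^sub>v v = b \<cdot>\<^sub>v v"
  shows "a = b"
proof -
  obtain i where i: "i < n" "v $ i \<noteq> 0"
    using assms(1,2) by (auto simp: vec_eq_iff)
  then show ?thesis
    using arg_cong[OF assms(3), of "\<lambda>v. v $ i"] assms(1) by simp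
qed

text \<open>
  \<open>A\<close> is injective because \<open>B * A\<close> is a nonzero scalar matrix, so it carries eigenvectors of \<open>M\<close>
  to eigenvectors of \<open>A * M * B\<close>.
\<close>

lemma eigenvalue_conjugation:
  fixes M :: "'a::field mat"
  assumes A: "A \<in> carrier_mat d r" and B: "B \<in> carrier_mat r d" and M: "M \<in> carrier_mat r r"
    and BA: "B * A = s \<cdot>\<^sub>m 1\<^sub>m r" and s: "s \<noteq> 0" and ev: "eigenvalue M \<nu>"
  shows "eigenvalue (A * M * B) (s * \<nu>)"
proof -
  obtain v where v: "v \<in> carrier_vec r" "v \<noteq> 0\<^sub>v r" "M *\<^sub>v v = \<nu> \<cdot>\<^sub>v v"
    using ev M by (auto simp: eigenvalue_def eigenvector_def)
  define x where "x = A *\<^sub>v v"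
  have x: "x \<in> carrier_vec d" using A v by (simp add: x_def)
  have "B *\<^sub>v x = (B * A) *\<^sub>v v"
    using A B v by (simp add: x_def)
  also have "\<dots> = s \<cdot>\<^sub>v v"
    unfolding BA using v(1) by (simp add: smult_mat_mult_vec[of _ r r])
  finally have Bx: "B *\<^sub>v x = s \<cdot>\<^sub>v v" .
  have "x \<noteq> 0\<^sub>v d"
  proof
    assume "x = 0\<^sub>v d"
    moreover have "B *\<^sub>v 0\<^sub>v d = 0\<^sub>v r" using B by (intro eq_vecI) auto
    ultimately have "s \<cdot>\<^sub>v v = 0\<^sub>v r" using Bx by simp
    then show False using smult_vec_eq_0D[OF v(1,2)] s by simp
  qed
  moreover have "(A * M * B) *\<^sub>v x = (s * \<nu>) \<cdot>\<^sub>v x"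
  proof -
    have "(A * M * B) *\<^sub>v x = A *\<^sub>v (M *\<^sub>v (B *\<^sub>v x))"
      using A B M x by (simp add: assoc_mult_mat_vec[of _ d r _ d] assoc_mult_mat_vec[of _ d r _ r])
    also have "\<dots> = (s * \<nu>) \<cdot>\<^sub>v x"
      unfolding Bx using A M v by (simp add: mult_mat_vec[of _ r r] mult_mat_vec[of _ d r] x_def smult_smult_assoc)
    finally show ?thesis .
  qed
  ultimately show ?thesis
    using x A B M by (auto simp: eigenvalue_def eigenvector_def)
qed

lemma eigenvalue_scalar_conjugation:
  fixes A :: "'a::field mat"
  assumes A: "A \<in> carrier_mat d r" and B: "B \<in> carrier_mat r d"
    and BA: "B * A = s \<cdot>\<^sub>m 1\<^sub>m r" and ev: "eigenvalue (A * (a \<cdot>\<^sub>m 1\<^sub>m r) * B) \<mu>" and "\<mu> \<noteq> 0"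
  shows "\<mu> = s * a"
proof -
  obtain x where x: "x \<in> carrier_vec d" "x \<noteq> 0\<^sub>v d" "(A * (a \<cdot>\<^sub>m 1\<^sub>m r) * B) *\<^sub>v x = \<mu> \<cdot>\<^sub>v x"
    using ev A B by (auto simp: eigenvalue_def eigenvector_def)
  define y where "y = B *\<^sub>v x"
  have y: "y \<in> carrier_vec r" using B x by (simp add: y_def)
  have "(A * (a \<cdot>\<^sub>m 1\<^sub>m r) * B) *\<^sub>v x = A *\<^sub>v ((a \<cdot>\<^sub>m 1\<^sub>m r) *\<^sub>v y)"
    using A B x(1) by (simp add: y_def assoc_mult_mat_vec[of _ d r _ d] assoc_mult_mat_vec[of _ d r _ r])
  also have "(a \<cdot>\<^sub>m 1\<^sub>m r) *\<^sub>v y = a \<cdot>\<^sub>v y"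
    using y by (simp add: smult_mat_mult_vec[of _ r r])
  finally have eq: "\<mu> \<cdot>\<^sub>v x = a \<cdot>\<^sub>v (A *\<^sub>v y)"
    using A y x(3) by (simp add: mult_mat_vec)
  have "\<mu> \<cdot>\<^sub>v y = B *\<^sub>v (\<mu> \<cdot>\<^sub>v x)"
    using B x(1) by (simp add: y_def mult_mat_vec)
  also have "\<dots> = a \<cdot>\<^sub>v ((B * A) *\<^sub>v y)"
    unfolding eq using A B y by (simp add: mult_mat_vec[of _ r d])
  also have "\<dots> = (s * a) \<cdot>\<^sub>v y"
    unfolding BA using y by (simp add: smult_mat_mult_vec[of _ r r] smult_smult_assoc mult.commute)
  finally have *: "\<mu> \<cdot>\<^sub>v y = (s * a) \<cdot>\<^sub>v y" .
  have "y \<noteq> 0\<^sub>v r"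
  proof
    assume "y = 0\<^sub>v r"
    then have "\<mu> \<cdot>\<^sub>v x = 0\<^sub>v d" unfolding eq using A by auto
    then show False using smult_vec_eq_0D[OF x(1,2)] \<open>\<mu> \<noteq> 0\<close> by simp
  qed
  then show ?thesis using smult_vec_right_cancel[OF y _ *] by simp
qed

lemma to_complex_smult_mat: "map_mat to_complex (a \<cdot>\<^sub>m M) = to_complex a \<cdot>\<^sub>m map_mat to_complex M"
  by (rule eq_matI) (auto simp: to_complex_mult)

text \<open>
  The conclusions that are drawn from \<open>2\<close>-division: the column spaces of the \<open>(D j)\<^sup>T\<close> are
  subspaces of dimension \<open>r\<close>, and the orthogonal projection from one to another is a multiple of an
  isometry.
\<close>

locale isoclinic_blocks =
  fixes d r :: nat and I :: "nat set" and D :: "nat \<Rightarrow> 'a::real_or_complex mat" and \<sigma> :: "nat \<Rightarrow> 'a"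
  assumes block_carrier: "j \<in> I \<Longrightarrow> D j \<in> carrier_mat r d"
    and block_norm: "j \<in> I \<Longrightarrow> mat_conj (D j) * (D j)\<^sup>T = \<sigma> j \<cdot>\<^sub>m 1\<^sub>m r"
    and sigma_nonzero: "j \<in> I \<Longrightarrow> \<sigma> j \<noteq> 0"
    and singular_value: "i \<in> I \<Longrightarrow> j \<in> I \<Longrightarrow> one_singular_value (mat_conj (D i) * (D j)\<^sup>T)"
begin

abbreviation Gram :: "nat \<Rightarrow> nat \<Rightarrow> 'a mat" where
  "Gram i j \<equiv> mat_conj (D i) * (D j)\<^sup>T"

lemma conj_carrier: "j \<in> I \<Longrightarrow> mat_conj (D j) \<in> carrier_mat r d"
  and transpose_carrier: "j \<in> I \<Longrightarrow> (D j)\<^sup>T \<in> carrier_mat d r"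
  using block_carrier[of j] by auto

sublocale unitary_connection I r Gram
proof
  fix i j assume ij: "i \<in> I" "j \<in> I"
  show c: "Gram i j \<in> carrier_mat r r"
    using conj_carrier[OF ij(1)] transpose_carrier[OF ij(2)] by simp
  have "mat_adjoint (Gram i j) = mat_adjoint ((D j)\<^sup>T) * mat_adjoint (mat_conj (D i))"
    by (rule mat_adjoint_mult[OF conj_carrier[OF ij(1)] transpose_carrier[OF ij(2)]])
  then show "Gram j i = mat_adjoint (Gram i j)"
    by (simp only: mat_adjoint_transpose mat_adjoint_conv(2)[of "mat_conj (D i)"] mat_conj_conj)
  show "\<exists>a U. unitary_mat r U \<and> Gram i j = a \<cdot>\<^sub>m U" if "Gram i j \<noteq> 0\<^sub>m r r"
    using singular_value[OF ij] that block_carrier[OF ij(1)] block_carrier[OF ij(2)]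
    by (auto simp: one_singular_value_def)
qed

text \<open>
  Regrouping the factors of \<open>Cov\<close> turns the product of projections into the holonomy of the cycle,
  expressed in the coordinates of the first block.
\<close>

lemma Cov_conv_path_product:
  assumes "js \<noteq> []" "set js \<subseteq> I"
  shows "Cov D js = (D (hd js))\<^sup>T * path_product r Gram (js @ [hd js]) * mat_conj (D (hd js))"
proof -
  have "foldr (\<lambda>j M. cov_factor D j * M) js (cov_factor D h)
      = (D (hd js))\<^sup>T * path_product r Gram (js @ [h]) * mat_conj (D h)" if h: "h \<in> I" for h
    using assms
  proof (induction js rule: induct_list012)
    case (2 j)
    have j: "j \<in> I" using 2 by simp
    note c = conj_carrier[OF j] transpose_carrier[OF j] conj_carrier[OF h] transpose_carrier[OF h]
    have "cov_factor D j * cov_factor D h = (D j)\<^sup>T * (Gram j h * mat_conj (D h))"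
      by (rule mult_mat_middle[OF c(2,1,4,3)])
    also have "\<dots> = (D j)\<^sup>T * Gram j h * mat_conj (D h)"
      using c carrier[OF j h] by (intro assoc_mult_mat[symmetric])
    finally show ?case using right_mult_one_mat[OF carrier[OF j h]] by simp
  next
    case (3 j j' js)
    have j: "j \<in> I" "j' \<in> I" using 3 by auto
    define X where "X = path_product r Gram (j' # js @ [h])"
    have X: "X \<in> carrier_mat r r"
      unfolding X_def using 3(4) h by (intro path_product_carrier) auto
    note c = conj_carrier[OF j(1)] transpose_carrier[OF j(1)] transpose_carrier[OF j(2)] conj_carrier[OF h]
      carrier[OF j]
    have Xc: "X * mat_conj (D h) \<in> carrier_mat r d" using X c(4) by simp
    have "foldr (\<lambda>j M. cov_factor D j * M) (j # j' # js) (cov_factor D h)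
        = cov_factor D j * ((D j')\<^sup>T * X * mat_conj (D h))"
      using 3 by (simp add: X_def)
    also have "(D j')\<^sup>T * X * mat_conj (D h) = (D j')\<^sup>T * (X * mat_conj (D h))"
      by (rule assoc_mult_mat[OF c(3) X c(4)])
    also have "cov_factor D j * \<dots> = (D j)\<^sup>T * (Gram j j' * (X * mat_conj (D h)))"
      by (rule mult_mat_middle[OF c(2,1,3) Xc])
    also have "Gram j j' * (X * mat_conj (D h)) = (Gram j j' * X) * mat_conj (D h)"
      by (rule assoc_mult_mat[OF c(5) X c(4), symmetric])
    also have "(D j)\<^sup>T * \<dots> = (D j)\<^sup>T * (Gram j j' * X) * mat_conj (D h)"
      by (rule assoc_mult_mat[OF c(2) mult_carrier_mat[OF c(5) X] c(4), symmetric])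
    finally show ?case by (simp add: X_def)
  qed simp
  moreover have "hd js \<in> I"
    using assms hd_in_set by blast
  ultimately show ?thesis
    unfolding Cov_def by blast
qed

text \<open>
  The nonzero eigenvalues of \<open>Cov D js\<close> are those of the holonomy up to the factor \<open>\<sigma> (hd js)\<close>. The holonomy
  is zero or a nonzero multiple of a unitary matrix. In the second case it is normal and invertible,
  so a single nonzero eigenvalue is a single eigenvalue and forces it to be scalar.
\<close>

lemma at_most_one_nonzero_eigenvalue_iff:
  assumes js: "js \<noteq> []" "set js \<subseteq> I"
  shows "card (eigenvalues (Cov D js) - {0}) \<le> 1 \<longleftrightarrow> scalar_mat r (path_product r Gram (js @ [hd js]))"
proof -
  define h where "h = hd js"
  define M where "M = path_product r Gram (js @ [h])"
  let ?c = "map_mat to_complex"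
  let ?s = "to_complex (\<sigma> h)"
  have h: "h \<in> I" using js by (auto simp: h_def)
  have sub: "set (js @ [h]) \<subseteq> I" using js h by simp
  have M: "M \<in> carrier_mat r r" unfolding M_def by (rule path_product_carrier[OF sub])
  note c = transpose_carrier[OF h] conj_carrier[OF h]
  have Cov: "Cov D js = (D h)\<^sup>T * M * mat_conj (D h)"
    using Cov_conv_path_product[OF js] by (simp add: M_def h_def)
  have Cov_c: "Cov D js \<in> carrier_mat d d" unfolding Cov using c M by simp
  have fin: "finite (eigenvalues (Cov D js) - {0})"
    using card_finite_spectrum(1)[of "?c (Cov D js)" d] Cov_c by (simp add: eigenvalues_def)
  have Cov': "?c (Cov D js) = ?c ((D h)\<^sup>T) * ?c M * ?c (mat_conj (D h))"
    unfolding Cov to_complex.mat_hom_mult[OF mult_carrier_mat[OF c(1) M] c(2)]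
      to_complex.mat_hom_mult[OF c(1) M] ..
  have A: "?c ((D h)\<^sup>T) \<in> carrier_mat d r" and B: "?c (mat_conj (D h)) \<in> carrier_mat r d"
    using c by auto
  have "?c (mat_conj (D h)) * ?c ((D h)\<^sup>T) = ?c (\<sigma> h \<cdot>\<^sub>m 1\<^sub>m r)"
    unfolding block_norm[OF h, symmetric] using c by (simp add: to_complex.mat_hom_mult[of _ r d _ r])
  then have BA: "?c (mat_conj (D h)) * ?c ((D h)\<^sup>T) = ?s \<cdot>\<^sub>m 1\<^sub>m r"
    by (simp add: to_complex_smult_mat to_complex.mat_hom_one)
  have s: "?s \<noteq> 0" using sigma_nonzero[OF h] by simp
  show ?thesis
  proof
    assume "scalar_mat r (path_product r Gram (js @ [hd js]))"
    then obtain a where "M = a \<cdot>\<^sub>m 1\<^sub>m r" by (auto simp: scalar_mat_def M_def h_def)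
    then have "?c M = to_complex a \<cdot>\<^sub>m 1\<^sub>m r"
      by (simp add: to_complex_smult_mat to_complex.mat_hom_one)
    then have "eigenvalues (Cov D js) - {0} \<subseteq> {?s * to_complex a}"
      using eigenvalue_scalar_conjugation[OF A B BA]
      by (auto simp: eigenvalues_def spectrum_def Cov')
    then show "card (eigenvalues (Cov D js) - {0}) \<le> 1"
      using card_le_1_iff_subset_singleton[OF fin] by blast
  next
    assume "card (eigenvalues (Cov D js) - {0}) \<le> 1"
    then obtain t where t: "eigenvalues (Cov D js) - {0} \<subseteq> {t}"
      using card_le_1_iff_subset_singleton[OF fin] by blast
    consider "M = 0\<^sub>m r r" | a U where "a \<noteq> 0" "unitary_mat r U" "M = a \<cdot>\<^sub>m U"
      using path_product_zero_or_unitary[OF sub] unfolding M_def by blast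
    then have "scalar_mat r M"
    proof cases
      case 1
      then have "M = 0 \<cdot>\<^sub>m 1\<^sub>m r" by (intro eq_matI) auto
      then show ?thesis unfolding scalar_mat_def by blast
    next
      case (2 a U)
      have U: "U \<in> carrier_mat r r" using 2(2) by (rule unitary_mat_carrier)
      have adj: "mat_adjoint M = conjugate a \<cdot>\<^sub>m mat_adjoint U" by (simp add: 2(3) mat_adjoint_smult)
      have prod: "(x \<cdot>\<^sub>m X) * (y \<cdot>\<^sub>m Y) = (x * y) \<cdot>\<^sub>m (X * Y)"
        if "X \<in> carrier_mat r r" "Y \<in> carrier_mat r r" for x y and X Y :: "'a mat"
        using that by (intro eq_matI) (auto simp: mult_ac)
      have adjM: "mat_adjoint M * M = (conjugate a * a) \<cdot>\<^sub>m 1\<^sub>m r"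
        unfolding adj unfolding 2(3) prod[OF mat_adjoint_carrier[OF U] U] unitary_mat_left[OF 2(2)] ..
      have Madj: "M * mat_adjoint M = (a * conjugate a) \<cdot>\<^sub>m 1\<^sub>m r"
        unfolding adj unfolding 2(3) prod[OF U mat_adjoint_carrier[OF U]] unitary_mat_right[OF 2(2)] ..
      have "eigenvalues M \<subseteq> {t / ?s}"
      proof
        fix \<nu> assume "\<nu> \<in> eigenvalues M"
        then have ev: "eigenvalue (?c M) \<nu>" by (simp add: eigenvalues_def spectrum_def)
        have "\<nu> \<noteq> 0"
        proof
          assume "\<nu> = 0"
          then obtain v where v: "v \<in> carrier_vec r" "v \<noteq> 0\<^sub>v r" "?c M *\<^sub>v v = 0 \<cdot>\<^sub>v v"
            using ev M by (auto simp: eigenvalue_def eigenvector_def)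
          have "?c (mat_adjoint M) * ?c M = ?c ((conjugate a * a) \<cdot>\<^sub>m 1\<^sub>m r)"
            unfolding adjM[symmetric] using M by (simp add: to_complex.mat_hom_mult[of _ r r _ r])
          then have "(?c (mat_adjoint M) * ?c M) *\<^sub>v v = to_complex (conjugate a * a) \<cdot>\<^sub>v v"
            using v(1) by (simp add: to_complex_smult_mat to_complex.mat_hom_one smult_mat_mult_vec[of _ r r])
          moreover have "(?c (mat_adjoint M) * ?c M) *\<^sub>v v = ?c (mat_adjoint M) *\<^sub>v (0 \<cdot>\<^sub>v v)"
            unfolding v(3)[symmetric] using M v(1) by (intro assoc_mult_mat_vec[of _ r r _ r]) auto
          moreover have "0 \<cdot>\<^sub>v v = 0\<^sub>v r" using v(1) by auto
          moreover have "?c (mat_adjoint M) *\<^sub>v 0\<^sub>v r = 0\<^sub>v r" using M by (intro eq_vecI) auto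
          ultimately have "to_complex (conjugate a * a) = 0"
            using smult_vec_eq_0D[OF v(1,2)] by metis
          then show False using 2(1) by (simp add: to_complex_mult)
        qed
        have "eigenvalue (?c (Cov D js)) (?s * \<nu>)"
          unfolding Cov' using eigenvalue_conjugation[OF A B _ BA s ev] M by simp
        then have "?s * \<nu> = t"
          using t s \<open>\<nu> \<noteq> 0\<close> by (auto simp: eigenvalues_def spectrum_def)
        then show "\<nu> \<in> {t / ?s}" using s by auto
      qed
      moreover have "mat_adjoint M * M = M * mat_adjoint M"
        unfolding adjM Madj by (simp add: mult.commute)
      ultimately show ?thesis
        using normal_one_eigenvalue_scalar_mat[OF M] by blast
    qed
    then show "scalar_mat r (path_product r Gram (js @ [hd js]))"
      by (simp add: M_def h_def)
  qed
qed

end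

section \<open>Column spaces and lines\<close>

lemma column_space_eq_range:
  "column_space A = {A *\<^sub>v x | x. x \<in> carrier_vec (dim_col A)}"
  unfolding column_space_def vec_space.col_space_eq[OF carrier_matI[OF refl refl]]
  by (auto intro: mult_mat_vec_carrier[OF carrier_matI])

context vec_space
begin

lemma span_empty_eq: "span {} = {0\<^sub>v n}"
  by (subst finite_span) (auto simp: lincomb_def)

lemma span_singleton_eq:
  assumes "u \<in> carrier_vec n"
  shows "span {u} = {a \<cdot>\<^sub>v u | a. True}"
proof -
  have "lincomb a {u} = a u \<cdot>\<^sub>v u" for a
    using assms by (simp add: lincomb_def)
  moreover have "\<exists>f :: 'a vec \<Rightarrow> 'a. a \<cdot>\<^sub>v u = f u \<cdot>\<^sub>v u" for a
    by (rule exI[of _ "\<lambda>_. a"]) simp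
  ultimately show ?thesis
    using assms by (subst finite_span) auto
qed

text \<open>
  The bound on the cardinality shows that a line has dimension at most one.
\<close>

lemma basis_of_span:
  assumes A: "finite A" "A \<subseteq> carrier_vec n"
  obtains \<beta> where "finite \<beta>" "\<beta> \<subseteq> carrier_vec n" "span \<beta> = span A"
    "vectorspace.dim class_ring (vs (span A)) = card \<beta>" "card \<beta> \<le> card A"
proof -
  have sub: "submodule class_ring (span A) V"
    using A by (intro span_is_submodule) simp
  interpret W: vectorspace class_ring "vs (span A)"
    using A by (intro subspace_is_vs span_is_subspace) simp
  have A_in: "A \<subseteq> span A" using A in_own_span by simp
  have gen: "W.gen_set A"
    using span_li_not_depend(1)[OF A_in sub] by simp
  then have fin: "W.fin_dim" unfolding W.fin_dim_def using A A_in by auto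
  obtain \<beta> where \<beta>: "finite \<beta>" "W.basis \<beta>" using W.finite_basis_exists[OF fin] by blast
  have \<beta>_in: "\<beta> \<subseteq> span A" using \<beta>(2) by (simp add: W.basis_def)
  have "span \<beta> = span A"
    using span_li_not_depend(1)[OF \<beta>_in sub] \<beta>(2) by (simp add: W.basis_def)
  moreover have "span A \<subseteq> carrier_vec n"
    using A span_is_subset2 by simp
  moreover have "W.dim = card \<beta>" using W.dim_basis[OF \<beta>] .
  moreover have "W.dim \<le> card A" using W.gen_ge_dim[OF A(1) _ gen] A_in by simp
  ultimately show ?thesis
    using that \<beta>(1) \<beta>_in by simp
qed

end

lemma subspace_dim_line:
  fixes u :: "'a::real_or_complex vec"
  assumes u: "u \<in> carrier_vec d" "u \<noteq> 0\<^sub>v d"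
  shows "subspace_dim d {a \<cdot>\<^sub>v u | a. True} = 1"
proof -
  interpret vec_space "TYPE('a)" d .
  obtain \<beta> where \<beta>: "finite \<beta>" "\<beta> \<subseteq> carrier_vec d" "span \<beta> = span {u}"
    "subspace_dim d (span {u}) = card \<beta>" "card \<beta> \<le> card {u}"
    using basis_of_span[of "{u}"] u(1) unfolding subspace_dim_def by auto
  have "card \<beta> \<noteq> 0"
  proof
    assume "card \<beta> = 0"
    then have "span {u} = {0\<^sub>v d}" using \<beta>(1,3) span_empty_eq by simp
    then show False using u in_own_span[of "{u}"] by auto
  qed
  then show ?thesis using \<beta>(4,5) span_singleton_eq[OF u(1)] by simp
qed

lemma subspace_dim_1D:
  fixes M :: "'a::real_or_complex mat"
  assumes M: "M \<in> carrier_mat d m" and dim: "subspace_dim d (column_space M) = 1"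
    and v: "v \<in> column_space M" "v \<noteq> 0\<^sub>v d" and x: "x \<in> column_space M"
  obtains a where "x = a \<cdot>\<^sub>v v"
proof -
  interpret vec_space "TYPE('a)" d .
  have cs: "column_space M = span (set (cols M))"
    using M by (simp add: column_space_def col_space_def)
  have cols: "set (cols M) \<subseteq> carrier_vec d" using M cols_dim[of M] by simp
  obtain \<beta> where \<beta>: "finite \<beta>" "\<beta> \<subseteq> carrier_vec d" "span \<beta> = span (set (cols M))" "card \<beta> = 1"
    using basis_of_span[OF finite_set cols] dim unfolding subspace_dim_def cs by metis
  then obtain b where b: "\<beta> = {b}" "b \<in> carrier_vec d" by (auto simp: card_1_singleton_iff)
  then have "column_space M = {a \<cdot>\<^sub>v b | a. True}" using \<beta>(3) cs span_singleton_eq by simp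
  then obtain p q where pq: "v = p \<cdot>\<^sub>v b" "x = q \<cdot>\<^sub>v b" using v x by auto
  have "p \<noteq> 0"
  proof
    assume "p = 0"
    then have "v = 0\<^sub>v d" unfolding pq(1) using b(2) by (intro eq_vecI) auto
    with v(2) show False ..
  qed
  then have "x = (q / p) \<cdot>\<^sub>v v" using b(2) by (simp add: pq smult_smult_assoc)
  then show ?thesis by (rule that)
qed

section \<open>Invariance of separation subspaces\<close>

lemma diag_block_mat_disjoint_rows:
  assumes "t < length Bs" "i < dim_row (Bs ! t)" "i' < sum_list (map dim_row Bs)"
    "\<not> (\<exists>q < dim_row (Bs ! t). i' = sum_list (map dim_row (take t Bs)) + q)"
    "j < sum_list (map dim_col Bs)"
  shows "diag_block_mat Bs $$ (sum_list (map dim_row (take t Bs)) + i, j) = 0 \<or> diag_block_mat Bs $$ (i', j) = 0"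
  using assms
proof (induction Bs arbitrary: t i' j)
  case (Cons B Bs)
  note dims = dim_diag_block_mat[of Bs]
  show ?case
  proof (cases t)
    case 0
    then have "\<not> i' < dim_row B" using Cons.prems by auto
    then show ?thesis
      using Cons.prems 0 by (cases "j < dim_col B") (simp_all add: Let_def dims)
  next
    case (Suc s)
    have ih: "diag_block_mat Bs $$ (sum_list (map dim_row (take s Bs)) + i, j - dim_col B) = 0
        \<or> diag_block_mat Bs $$ (i' - dim_row B, j - dim_col B) = 0"
      if "\<not> i' < dim_row B" "\<not> j < dim_col B"
    proof (rule Cons.IH)
      show "\<not> (\<exists>q < dim_row (Bs ! s). i' - dim_row B = sum_list (map dim_row (take s Bs)) + q)"
        using Cons.prems(4) that(1) by (auto simp: Suc)
    qed (use Cons.prems that in \<open>auto simp: Suc\<close>)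
    have "s < length Bs" using Cons.prems(1) Suc by simp
    then have "sum_list (map dim_row Bs) = sum_list (map dim_row (take s Bs)) + sum_list (map dim_row (drop s Bs))"
      by (metis append_take_drop_id map_append sum_list_append)
    moreover have "drop s Bs = Bs ! s # drop (Suc s) Bs"
      using \<open>s < length Bs\<close> by (simp add: Cons_nth_drop_Suc)
    ultimately have lt: "sum_list (map dim_row (take s Bs)) + i < sum_list (map dim_row Bs)"
      using Cons.prems(2) by (simp add: Suc)
    show ?thesis
    proof (cases "j < dim_col B")
      case True
      then show ?thesis
        using Suc Cons.prems lt by (simp add: Let_def dims)
    next
      case False
      then show ?thesis
        using Suc Cons.prems lt ih by (cases "i' < dim_row B") (simp_all add: Let_def dims)
    qed
  qed
qed simp

lemma uniform_index_less: "i < (m::nat) \<Longrightarrow> q < r \<Longrightarrow> i * r + q < m * r"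
  by (metis add.commute less_add_eq_less mult_Suc mult_le_mono1 Suc_leI add_less_cancel_left order_less_le_trans)

lemma index_stack_rows:
  fixes As :: "'a::zero mat list"
  assumes "\<forall>A \<in> set As. A \<in> carrier_mat r d" "i < length As" "q < r" "j < d"
  shows "stack_rows d As $$ (i * r + q, j) = As ! i $$ (q, j)"
  using assms
proof (induction As arbitrary: i)
  case (Cons A As)
  have n: "sum_list (map dim_row As) = length As * r"
    using Cons.prems(1) by (induction As) auto
  have A: "A \<in> carrier_mat r d" using Cons.prems(1) by simp
  then have stack: "stack_rows d (A # As) = A @\<^sub>r stack_rows d As"
    by (intro stack_rows_Cons) auto
  have lt: "i * r + q < r + length As * r"
    using uniform_index_less[of i "Suc (length As)" q r] Cons.prems(2,3) by simp
  have split: "stack_rows d (A # As) $$ (i * r + q, j)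
      = (if i * r + q < r then A $$ (i * r + q, j) else stack_rows d As $$ (i * r + q - r, j))"
    unfolding stack using lt Cons.prems(4) by (subst index_append_rows[OF A stack_rows_carrier]) (simp_all add: n)
  show ?case
  proof (cases i)
    case 0
    then show ?thesis using split Cons.prems(3) by simp
  next
    case (Suc i')
    then show ?thesis using split Cons.IH[of i'] Cons.prems by simp
  qed
qed simp

lemma diag_block_mat_mult_stack_rows:
  fixes As :: "'a::semiring_0 mat list"
  assumes "list_all2 (\<lambda>H A. H \<in> carrier_mat (dim_row A) (dim_row A) \<and> dim_col A = d) Hs As"
  shows "diag_block_mat Hs * stack_rows d As = stack_rows d (map2 (*) Hs As)"
  using assms
proof (induction rule: list_all2_induct)
  case Nil
  show ?case by (intro eq_matI) auto
next
  case (Cons H Hs A As)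
  obtain m where H: "H \<in> carrier_mat m m" and A: "A \<in> carrier_mat m d"
    using Cons.hyps(1) by auto
  define n where "n = sum_list (map dim_row As)"
  have "map dim_row Hs = map dim_row As" "map dim_col Hs = map dim_row As"
    using Cons.hyps(2) by (induction rule: list_all2_induct) auto
  then have Dg: "diag_block_mat Hs \<in> carrier_mat n n"
    by (intro carrier_matI) (simp_all add: dim_diag_block_mat n_def)
  have R: "stack_rows d As \<in> carrier_mat n d" by (simp add: n_def)
  have "diag_block_mat (H # Hs) * stack_rows d (A # As)
      = four_block_mat H (0\<^sub>m m n) (0\<^sub>m n m) (diag_block_mat Hs)
        * four_block_mat A (0\<^sub>m m 0) (stack_rows d As) (0\<^sub>m n 0)"
    using H A Dg R by (simp add: stack_rows_Cons append_rows_def Let_def n_def)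
  also have "\<dots> = four_block_mat (H * A) (0\<^sub>m m 0) (diag_block_mat Hs * stack_rows d As) (0\<^sub>m n 0)"
    using H A Dg R by (subst mult_four_block_mat[of _ m m _ n _ n _ _ d _ 0]) auto
  also have "\<dots> = (H * A) @\<^sub>r stack_rows d (map2 (*) Hs As)"
    unfolding append_rows_def using H A Dg R by (simp add: Cons.IH[symmetric])
  finally show ?case using A H by (simp add: stack_rows_Cons)
qed

lemma permutation_mat_mult_index:
  fixes X :: "'a::real_or_complex mat"
  assumes "p permutes {..<n}" "X \<in> carrier_mat n d" "a < n" "j < d"
  shows "(mat n n (\<lambda>(i, j). if p i = j then 1 else 0) * X) $$ (a, j) = X $$ (p a, j)"
proof -
  have "p a < n" using permutes_in_image[OF assms(1)] assms(3) by auto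
  have "(mat n n (\<lambda>(i, j). if p i = j then 1 else 0) * X) $$ (a, j)
      = (\<Sum>l\<in>{0..<n}. (if p a = l then 1 else 0) * X $$ (l, j))"
    using assms by (simp add: scalar_prod_def)
  also have "\<dots> = (\<Sum>l\<in>{0..<n}. if l = p a then X $$ (l, j) else 0)"
    by (intro sum.cong) auto
  also have "\<dots> = X $$ (p a, j)"
    using \<open>p a < n\<close> by simp
  finally show ?thesis .
qed

lemma offset_le: "t < length Bs \<Longrightarrow>
    sum_list (map dim_row (take t Bs)) + dim_row (Bs ! t) \<le> sum_list (map dim_row Bs)"
  by (induction Bs arbitrary: t) (auto simp: nth_Cons' take_Cons' split: nat.splits)

lemma index_mult_mat_vec_eq_sum:
  assumes "A \<in> carrier_mat m n" "z \<in> carrier_vec n" "j < m"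
  shows "(A *\<^sub>v z) $ j = (\<Sum>q\<in>{0..<n}. A $$ (j, q) * z $ q)"
  using assms by (simp add: scalar_prod_def)

definition row_slice :: "'a mat \<Rightarrow> nat \<Rightarrow> nat \<Rightarrow> 'a mat" where
  "row_slice N off b = mat b (dim_col N) (\<lambda>(i, j). N $$ (off + i, j))"

lemma conj_mult_transpose_unitary:
  assumes "unitary_mat n L"
  shows "mat_conj L * L\<^sup>T = 1\<^sub>m n"
proof -
  have "mat_conj L * L\<^sup>T = mat_adjoint (L\<^sup>T) * L\<^sup>T" by (simp add: mat_adjoint_transpose)
  then show ?thesis using unitary_mat_left[OF unitary_mat_transpose[OF assms]] by simp
qed

lemma transpose_mult_conj_unitary:
  assumes "unitary_mat n L"
  shows "L\<^sup>T * mat_conj L = 1\<^sub>m n"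
proof -
  have "L\<^sup>T * mat_conj L = L\<^sup>T * mat_adjoint (L\<^sup>T)" by (simp add: mat_adjoint_transpose)
  then show ?thesis using unitary_mat_right[OF unitary_mat_transpose[OF assms]] by simp
qed

text \<open>
  Undoing the unitary change of coordinates, the separation subspace of block \<open>t\<close> is spanned by the
  transposed rows of \<open>N\<close> that lie in block row \<open>t\<close>.
\<close>

lemma separation_subspace_eq_row_span:
  fixes L :: "'a::real_or_complex mat"
  assumes L: "unitary_mat d L" and N: "N \<in> carrier_mat n d" and NL: "N * L = diag_block_mat Bs"
    and t: "t < length Bs"
  defines "off \<equiv> sum_list (map dim_row (take t Bs))"
  shows "mat_conj L * (block_row Bs t)\<^sup>T = (row_slice N off (dim_row (Bs ! t)))\<^sup>T"
proof -
  define b where "b = dim_row (Bs ! t)"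
  define N1 where "N1 = row_slice N off b"
  have Lc: "L \<in> carrier_mat d d" "mat_conj L \<in> carrier_mat d d" "L\<^sup>T \<in> carrier_mat d d"
    using unitary_mat_carrier[OF L] by auto
  have N1: "N1 \<in> carrier_mat b d" using N by (simp add: N1_def row_slice_def)
  have dims: "dim_row (diag_block_mat Bs) = n" "dim_col (diag_block_mat Bs) = d"
    using N Lc by (auto simp flip: NL)
  have le: "off + b \<le> n"
    using offset_le[OF t] dims(1) by (simp add: off_def b_def dim_diag_block_mat)
  have "block_row Bs t = N1 * L"
  proof (rule eq_matI)
    fix i j assume "i < dim_row (N1 * L)" "j < dim_col (N1 * L)"
    then have ij: "i < b" "j < d" using N1 Lc by auto
    have "block_row Bs t $$ (i, j) = (N * L) $$ (off + i, j)"
      using ij dims(2) by (simp add: block_row_def b_def off_def NL)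
    also have "\<dots> = (N1 * L) $$ (i, j)"
      using ij le N N1 Lc by (simp add: scalar_prod_def N1_def row_slice_def)
    finally show "block_row Bs t $$ (i, j) = (N1 * L) $$ (i, j)" .
  qed (use N1 Lc dims in \<open>auto simp: block_row_def b_def\<close>)
  then have "mat_conj L * (block_row Bs t)\<^sup>T = mat_conj L * (L\<^sup>T * N1\<^sup>T)"
    using N1 Lc by (simp add: transpose_mult)
  also have "\<dots> = (mat_conj L * L\<^sup>T) * N1\<^sup>T"
    using N1 Lc by (intro assoc_mult_mat[symmetric]) auto
  also have "\<dots> = N1\<^sup>T"
    unfolding conj_mult_transpose_unitary[OF L] using N1 by simp
  finally show ?thesis by (simp add: N1_def b_def)
qed

lemma block_rows_orthogonal:
  fixes L :: "'a::real_or_complex mat"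
  assumes L: "unitary_mat d L" and N: "N \<in> carrier_mat n d" and NL: "N * L = diag_block_mat Bs"
    and t: "t < length Bs" and q: "q < dim_row (Bs ! t)" and a: "a < n"
    and out: "\<not> (\<exists>q < dim_row (Bs ! t). a = sum_list (map dim_row (take t Bs)) + q)"
  shows "(\<Sum>j\<in>{0..<d}. N $$ (sum_list (map dim_row (take t Bs)) + q, j) * conjugate (N $$ (a, j))) = 0"
proof -
  define b where "b = sum_list (map dim_row (take t Bs)) + q"
  have Lc: "L \<in> carrier_mat d d" using unitary_mat_carrier[OF L] .
  have dims: "dim_row (diag_block_mat Bs) = n" "dim_col (diag_block_mat Bs) = d"
    using N Lc by (auto simp flip: NL)
  have b: "b < n" using offset_le[OF t] q dims(1) by (simp add: b_def dim_diag_block_mat)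
  have disj: "diag_block_mat Bs $$ (b, j) = 0 \<or> diag_block_mat Bs $$ (a, j) = 0" if "j < d" for j
    unfolding b_def using diag_block_mat_disjoint_rows[OF t q _ out, of j] a that dims
    by (simp add: dim_diag_block_mat)
  have "(N * L) * mat_adjoint (N * L) = (N * L) * (mat_adjoint L * mat_adjoint N)"
    by (simp add: mat_adjoint_mult[OF N Lc])
  also have "\<dots> = N * ((L * mat_adjoint L) * mat_adjoint N)"
    by (rule mult_mat_middle[OF N Lc mat_adjoint_carrier[OF Lc] mat_adjoint_carrier[OF N]])
  also have "\<dots> = N * mat_adjoint N"
    unfolding unitary_mat_right[OF L] left_mult_one_mat[OF mat_adjoint_carrier[OF N]] ..
  finally have "(N * mat_adjoint N) $$ (b, a) = (diag_block_mat Bs * mat_adjoint (diag_block_mat Bs)) $$ (b, a)"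
    by (simp add: NL)
  also have "\<dots> = (\<Sum>j\<in>{0..<d}. diag_block_mat Bs $$ (b, j) * conjugate (diag_block_mat Bs $$ (a, j)))"
    using a b dims by (simp add: scalar_prod_def)
  also have "\<dots> = 0"
    using disj by (intro sum.neutral ballI) fastforce
  finally show ?thesis
    using a b N by (simp add: scalar_prod_def b_def)
qed

text \<open>
  The rows of \<open>K = H * A\<close>, where \<open>H\<close> is the factor of \<open>A\<close> in the solution, form an orthogonal basis of the column space of \<open>A\<^sup>T\<close>.
  Each of them lies either in block row \<open>t\<close>, hence in the separation subspace, or in another block
  row, and is then orthogonal to it. In the expansion of the projection of \<open>x\<close> in this basis only the
  vectors of the first kind have nonzero coefficients.
\<close>

lemma block_projection_preserves_separation_subspace:
  fixes Ds :: "'a::real_or_complex mat list"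
  assumes sol: "row_separation_solution d Ds E Hs L Bs" and t: "t < length Bs"
    and Ds: "\<forall>A \<in> set Ds. A \<in> carrier_mat r d" and A: "A \<in> set Ds"
    and x: "x \<in> column_space (mat_conj L * (block_row Bs t)\<^sup>T)"
  shows "(A\<^sup>T * mat_conj A) *\<^sub>v x \<in> column_space (mat_conj L * (block_row Bs t)\<^sup>T)"
proof -
  obtain i where i: "i < length Ds" "A = Ds ! i" using A by (metis in_set_conv_nth)
  define n where "n = length Ds * r"
  have rows: "sum_list (map dim_row Ds) = n"
    using Ds unfolding n_def by (induction Ds) auto
  have Ds_nth: "dim_row (Ds ! l) = r" if "l < length Ds" for l
    using Ds that by (metis carrier_matD(1) nth_mem)
  then have Hs: "unitary_mat r (Hs ! l)" if "l < length Ds" for l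
    using sol that by (simp add: row_separation_solution_def)
  have L: "unitary_mat d L" and len: "length Hs = length Ds"
    and "permutation_mat n E" and eq: "E * diag_block_mat Hs * stack_rows d Ds * L = diag_block_mat Bs"
    using sol Ds rows by (auto simp: row_separation_solution_def)
  then obtain p where p: "p permutes {..<n}" "E = mat n n (\<lambda>(i, j). if p i = j then 1 else 0)"
    by (auto simp: permutation_mat_def)
  define Ks where "Ks = map2 (*) Hs Ds"
  have Ks: "\<forall>K \<in> set Ks. K \<in> carrier_mat r d"
    using Ds Hs len by (fastforce simp: Ks_def set_zip dest: unitary_mat_carrier)
  have lenK: "length Ks = length Ds" using len by (simp add: Ks_def)
  have Dg: "diag_block_mat Hs \<in> carrier_mat n n"
  proof -
    have "map dim_row Hs = map dim_row Ds" "map dim_col Hs = map dim_row Ds"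
      using len carrier_matD[OF unitary_mat_carrier[OF Hs]] by (auto intro!: nth_equalityI simp: Ds_nth)
    then show ?thesis by (intro carrier_matI) (simp_all add: dim_diag_block_mat rows)
  qed
  have stack: "stack_rows d Ds \<in> carrier_mat n d" by (simp add: rows[symmetric])
  have Ec: "E \<in> carrier_mat n n" by (simp add: p)
  define N where "N = E * stack_rows d Ks"
  have "list_all2 (\<lambda>H A. H \<in> carrier_mat (dim_row A) (dim_row A) \<and> dim_col A = d) Hs Ds"
    using len unitary_mat_carrier[OF Hs] Ds nth_mem[of _ Ds] by (auto simp: list_all2_conv_all_nth Ds_nth)
  then have HD: "diag_block_mat Hs * stack_rows d Ds = stack_rows d Ks"
    unfolding Ks_def by (rule diag_block_mat_mult_stack_rows)
  then have N_eq: "E * diag_block_mat Hs * stack_rows d Ds = N"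
    unfolding N_def using assoc_mult_mat[OF Ec Dg stack] by simp
  have stackK: "stack_rows d Ks \<in> carrier_mat n d"
    using Dg stack by (simp flip: HD)
  then have N: "N \<in> carrier_mat n d" using Ec by (simp add: N_def)
  have NL: "N * L = diag_block_mat Bs" using eq by (simp add: N_eq)
  define off where "off = sum_list (map dim_row (take t Bs))"
  define b where "b = dim_row (Bs ! t)"
  define N1 where "N1 = row_slice N off b"
  have N1: "N1 \<in> carrier_mat b d" using N by (simp add: N1_def row_slice_def)
  have M_eq: "mat_conj L * (block_row Bs t)\<^sup>T = N1\<^sup>T"
    unfolding N1_def off_def b_def by (rule separation_subspace_eq_row_span[OF L N NL t])
  obtain y where y: "y \<in> carrier_vec b" "x = N1\<^sup>T *\<^sub>v y"
    using x N1 unfolding M_eq by (auto simp: column_space_eq_range)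
  have xc: "x \<in> carrier_vec d" using y N1 by simp
  define K where "K = Ks ! i"
  have K: "K \<in> carrier_mat r d" using Ks lenK i(1) by (simp add: K_def)
  have Ac: "A \<in> carrier_mat r d" using Ds A by simp
  define H where "H = Hs ! i"
  have H: "unitary_mat r H" using Hs i(1) by (simp add: H_def)
  note Hc = unitary_mat_carrier[OF H]
  have K_eq: "K = H * A" using i len by (simp add: K_def Ks_def H_def)
  have proj: "A\<^sup>T * mat_conj A = K\<^sup>T * mat_conj K"
  proof -
    have c: "A\<^sup>T \<in> carrier_mat d r" "H\<^sup>T \<in> carrier_mat r r" "mat_conj H \<in> carrier_mat r r"
      "mat_conj A \<in> carrier_mat r d" using Ac Hc by auto
    have "K\<^sup>T * mat_conj K = (A\<^sup>T * H\<^sup>T) * (mat_conj H * mat_conj A)"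
      unfolding K_eq transpose_mult[OF Hc Ac] mat_conj_mult[OF Hc Ac] ..
    also have "\<dots> = A\<^sup>T * ((H\<^sup>T * mat_conj H) * mat_conj A)"
      by (rule mult_mat_middle[OF c])
    also have "\<dots> = A\<^sup>T * mat_conj A"
      unfolding transpose_mult_conj_unitary[OF H] using c(4) by simp
    finally show ?thesis ..
  qed
  define z where "z = mat_conj K *\<^sub>v x"
  have z: "z \<in> carrier_vec r" using K xc by (simp add: z_def)
  \<comment> \<open>For every basis vector, either it lies in the subspace or its coefficient is zero.\<close>
  have row: "\<exists>w. w \<in> carrier_vec b \<and> (\<forall>j < d. (N1\<^sup>T *\<^sub>v w) $ j * z $ q = K $$ (q, j) * z $ q)"
    if q: "q < r" for q
  proof -
    have "i * r + q < n" using uniform_index_less[of i "length Ds" q r] i(1) q by (simp add: n_def)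
    then obtain a where a: "a < n" "p a = i * r + q"
      using p(1) by (metis lessThan_iff permutes_image imageE)
    have N_row: "N $$ (a, j) = K $$ (q, j)" if "j < d" for j
    proof -
      have "N $$ (a, j) = stack_rows d Ks $$ (i * r + q, j)"
        unfolding N_def p(2) using permutation_mat_mult_index[OF p(1) stackK a(1) that] by (simp add: a(2))
      also have "\<dots> = K $$ (q, j)"
        unfolding K_def using i(1) lenK q that by (intro index_stack_rows[OF Ks]) auto
      finally show ?thesis .
    qed
    show ?thesis
    proof (cases "\<exists>q' < b. a = off + q'")
      case True
      then obtain q' where q': "q' < b" "a = off + q'" by blast
      have "(N1\<^sup>T *\<^sub>v unit_vec b q') $ j = K $$ (q, j)" if "j < d" for j
        using that q' N1 N N_row[OF that]
        by (simp add: scalar_prod_right_unit) (simp add: N1_def row_slice_def)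
      then show ?thesis by (intro exI[of _ "unit_vec b q'"]) simp
    next
      case False
      have "z $ q = (\<Sum>j\<in>{0..<d}. conjugate (N $$ (a, j)) * (\<Sum>l\<in>{0..<b}. N $$ (off + l, j) * y $ l))"
        using q K y N1 N N_row by (auto simp: z_def scalar_prod_def N1_def row_slice_def intro!: sum.cong)
      also have "\<dots> = (\<Sum>l\<in>{0..<b}. y $ l * (\<Sum>j\<in>{0..<d}. N $$ (off + l, j) * conjugate (N $$ (a, j))))"
        unfolding sum_distrib_left by (subst sum.swap) (simp add: mult_ac)
      also have "\<dots> = 0"
        using block_rows_orthogonal[OF L N NL t _ a(1)] False
        by (intro sum.neutral) (auto simp: off_def b_def)
      finally show ?thesis by (intro exI[of _ "0\<^sub>v b"]) simp
    qed
  qed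
  then obtain w where w: "\<And>q. q < r \<Longrightarrow> w q \<in> carrier_vec b \<and> (\<forall>j < d. (N1\<^sup>T *\<^sub>v w q) $ j * z $ q = K $$ (q, j) * z $ q)"
    by metis
  define Y where "Y = mat_of_cols b (map w [0..<r])"
  have Y: "Y \<in> carrier_mat b r" unfolding Y_def by (intro carrier_matI) auto
  have colY: "col Y q = w q" if "q < r" for q
    using that w by (simp add: Y_def)
  have "K\<^sup>T *\<^sub>v z = N1\<^sup>T *\<^sub>v (Y *\<^sub>v z)"
  proof (rule eq_vecI)
    fix j assume "j < dim_vec (N1\<^sup>T *\<^sub>v (Y *\<^sub>v z))"
    then have j: "j < d" using N1 by simp
    have "(N1\<^sup>T *\<^sub>v (Y *\<^sub>v z)) $ j = ((N1\<^sup>T * Y) *\<^sub>v z) $ j"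
      using N1 Y z by (simp add: assoc_mult_mat_vec[of _ d b _ r])
    also have "\<dots> = (\<Sum>q\<in>{0..<r}. (N1\<^sup>T * Y) $$ (j, q) * z $ q)"
      using j z by (intro index_mult_mat_vec_eq_sum[OF mult_carrier_mat[OF _ Y]]) (use N1 in auto)
    also have "\<dots> = (\<Sum>q\<in>{0..<r}. K $$ (q, j) * z $ q)"
    proof (rule sum.cong)
      fix q assume "q \<in> {0..<r}"
      then have q: "q < r" by simp
      have "(N1\<^sup>T * Y) $$ (j, q) = (N1\<^sup>T *\<^sub>v w q) $ j"
        using j q N1 Y colY[OF q] by simp
      then show "(N1\<^sup>T * Y) $$ (j, q) * z $ q = K $$ (q, j) * z $ q"
        using w[OF q] j by simp
    qed simp
    also have "\<dots> = (K\<^sup>T *\<^sub>v z) $ j"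
      using j K z by (simp add: scalar_prod_def)
    finally show "(K\<^sup>T *\<^sub>v z) $ j = (N1\<^sup>T *\<^sub>v (Y *\<^sub>v z)) $ j" by simp
  qed (use K N1 in simp)
  moreover have "(A\<^sup>T * mat_conj A) *\<^sub>v x = K\<^sup>T *\<^sub>v z"
    unfolding proj z_def using K xc by (intro assoc_mult_mat_vec) auto
  moreover have "Y *\<^sub>v z \<in> carrier_vec (dim_col (N1\<^sup>T))" using Y z N1 by simp
  ultimately show ?thesis
    unfolding M_eq column_space_eq_range by (intro CollectI exI[of _ "Y *\<^sub>v z"]) simp
qed


context isoclinic_blocks
begin

lemma block_column_space: "j \<in> I \<Longrightarrow> column_space ((D j)\<^sup>T) = {(D j)\<^sup>T *\<^sub>v z | z. z \<in> carrier_vec r}"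
  using block_carrier[of j] by (simp add: column_space_eq_range)

lemma conj_block_mult_vec:
  assumes j: "j \<in> I" and z: "z \<in> carrier_vec r"
  shows "mat_conj (D j) *\<^sub>v ((D j)\<^sup>T *\<^sub>v z) = \<sigma> j \<cdot>\<^sub>v z"
proof -
  have "mat_conj (D j) *\<^sub>v ((D j)\<^sup>T *\<^sub>v z) = Gram j j *\<^sub>v z"
    by (rule assoc_mult_mat_vec[OF conj_carrier[OF j] transpose_carrier[OF j] z, symmetric])
  then show ?thesis
    using z by (simp add: block_norm[OF j] smult_mat_mult_vec[of _ r r])
qed

lemma cov_factor_carrier: "j \<in> I \<Longrightarrow> cov_factor D j \<in> carrier_mat d d"
  using conj_carrier[of j] transpose_carrier[of j] by simp

lemma cov_factor_mult_vec:
  assumes j: "j \<in> I" and z: "z \<in> carrier_vec r"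
  shows "cov_factor D j *\<^sub>v ((D j)\<^sup>T *\<^sub>v z) = \<sigma> j \<cdot>\<^sub>v ((D j)\<^sup>T *\<^sub>v z)"
proof -
  have "cov_factor D j *\<^sub>v ((D j)\<^sup>T *\<^sub>v z) = (D j)\<^sup>T *\<^sub>v (mat_conj (D j) *\<^sub>v ((D j)\<^sup>T *\<^sub>v z))"
    using conj_carrier[OF j] transpose_carrier[OF j] z by (intro assoc_mult_mat_vec) auto
  then show ?thesis
    using transpose_carrier[OF j] z by (simp add: conj_block_mult_vec[OF j z] mult_mat_vec)
qed

text \<open>
  Invariance of \<open>S\<close> under each single projection is enough, in whatever order the factors come.
\<close>

lemma Cov_mult_vec_in:
  assumes js: "js \<noteq> []" "set js \<subseteq> I" and S: "S \<subseteq> carrier_vec d" and x: "x \<in> S"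
    and closed: "\<And>j y. j \<in> set js \<Longrightarrow> y \<in> S \<Longrightarrow> cov_factor D j *\<^sub>v y \<in> S"
  shows "Cov D js *\<^sub>v x \<in> S"
proof -
  define h where "h = hd js"
  have h: "h \<in> set js" using js(1) by (simp add: h_def)
  have "foldr (\<lambda>j M. cov_factor D j * M) ks (cov_factor D h) \<in> carrier_mat d d \<and>
      foldr (\<lambda>j M. cov_factor D j * M) ks (cov_factor D h) *\<^sub>v x \<in> S" if "set ks \<subseteq> set js" for ks
    using that
  proof (induction ks)
    case Nil
    then show ?case using closed[OF h x] cov_factor_carrier[of h] h js(2) by auto
  next
    case (Cons j ks)
    let ?M = "foldr (\<lambda>j M. cov_factor D j * M) ks (cov_factor D h)"
    have IH: "?M \<in> carrier_mat d d" "?M *\<^sub>v x \<in> S" using Cons by auto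
    have c: "cov_factor D j \<in> carrier_mat d d" using Cons.prems js(2) by (intro cov_factor_carrier) auto
    have "(cov_factor D j * ?M) *\<^sub>v x = cov_factor D j *\<^sub>v (?M *\<^sub>v x)"
      using c IH(1) x S by (intro assoc_mult_mat_vec) auto
    moreover have "cov_factor D j *\<^sub>v (?M *\<^sub>v x) \<in> S" using closed IH(2) Cons.prems by auto
    ultimately show ?case using mult_carrier_mat[OF c IH(1)] by simp
  qed
  from this[of js] show ?thesis by (simp add: Cov_def h_def)
qed

text \<open>
  A separation subspace \<open>S\<close> through \<open>v\<close> is invariant under the projections, so it contains \<open>Cov D js v\<close>,
  which also lies in the column space of the first block. As \<open>S\<close> meets that space in a line, \<open>v\<close> is an
  eigenvector. Since \<open>v\<close> is arbitrary, the holonomy is scalar.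
\<close>

lemma scalar_if_separation_subspaces:
  assumes js: "js \<noteq> []" "set js \<subseteq> I"
    and sub: "\<And>v. v \<in> column_space ((D (hd js))\<^sup>T) \<Longrightarrow>
      \<exists>S. row_separation_subspace d (subset_subproblem D (set js)) S \<and> v \<in> S \<and>
        subspace_dim d (S \<inter> column_space ((D (hd js))\<^sup>T)) = 1"
  shows "scalar_mat r (path_product r Gram (js @ [hd js]))"
proof -
  define h where "h = hd js"
  have h: "h \<in> I" "h \<in> set js" using js by (auto simp: h_def)
  define M where "M = path_product r Gram (js @ [h])"
  have M: "M \<in> carrier_mat r r" unfolding M_def using js h by (intro path_product_carrier) auto
  note c = transpose_carrier[OF h(1)] conj_carrier[OF h(1)]
  have Cov: "Cov D js = (D h)\<^sup>T * M * mat_conj (D h)"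
    using Cov_conv_path_product[OF js] by (simp add: M_def h_def)
  have "\<exists>a. M *\<^sub>v w = a \<cdot>\<^sub>v w" if w: "w \<in> carrier_vec r" for w
  proof (cases "w = 0\<^sub>v r")
    case True
    then show ?thesis using M by (intro exI[of _ 0] eq_vecI) auto
  next
    case False
    define v where "v = (D h)\<^sup>T *\<^sub>v w"
    have v: "v \<in> column_space ((D h)\<^sup>T)" "v \<in> carrier_vec d"
      using w c block_column_space[OF h(1)] by (auto simp: v_def)
    have conj_v: "mat_conj (D h) *\<^sub>v v = \<sigma> h \<cdot>\<^sub>v w"
      unfolding v_def by (rule conj_block_mult_vec[OF h(1) w])
    have v0: "v \<noteq> 0\<^sub>v d"
    proof
      assume "v = 0\<^sub>v d"
      moreover have "mat_conj (D h) *\<^sub>v 0\<^sub>v d = 0\<^sub>v r" using c(2) by (intro eq_vecI) auto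
      ultimately show False
        using conj_v smult_vec_eq_0D[OF w False] sigma_nonzero[OF h(1)] by metis
    qed
    obtain S where S: "row_separation_subspace d (subset_subproblem D (set js)) S" "v \<in> S"
      "subspace_dim d (S \<inter> column_space ((D h)\<^sup>T)) = 1"
      using sub v(1) unfolding h_def by blast
    define Ds where "Ds = subset_subproblem D (set js)"
    obtain E Hs L Bs t where sol: "row_separation_solution d Ds E Hs L Bs" "t < length Bs"
      and S_eq: "S = column_space (mat_conj L * (block_row Bs t)\<^sup>T)"
      using S(1) unfolding row_separation_subspace_def Ds_def by blast
    define X where "X = mat_conj L * (block_row Bs t)\<^sup>T"
    have set_Ds: "set Ds = D ` set js" by (simp add: Ds_def subset_subproblem_def)
    have Ds: "\<forall>A \<in> set Ds. A \<in> carrier_mat r d" using js(2) block_carrier by (auto simp: set_Ds)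
    have closed: "cov_factor D j *\<^sub>v y \<in> S" if "j \<in> set js" "y \<in> S" for j y
      using block_projection_preserves_separation_subspace[OF sol Ds, of "D j" y] that
      unfolding S_eq by (simp add: set_Ds)
    have L: "L \<in> carrier_mat d d"
      using sol(1) by (auto simp: row_separation_solution_def unitary_mat_def)
    have "dim_row X = d" using L by (simp add: X_def)
    then obtain m where X: "X \<in> carrier_mat d m" by (metis carrier_matI)
    have S_range: "S = {X *\<^sub>v y | y. y \<in> carrier_vec m}"
      using X by (simp add: S_eq column_space_eq_range flip: X_def)
    have S_c: "S \<subseteq> carrier_vec d" using X S_range by auto
    have P: "cov_factor D h \<in> carrier_mat d d" by (rule cov_factor_carrier[OF h(1)])
    have PX: "cov_factor D h * X \<in> carrier_mat d m" using P X by (rule mult_carrier_mat)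
    \<comment> \<open>As the column space of a matrix the intersection is finite-dimensional, so that its dimension
      is the size of a basis.\<close>
    have inter: "S \<inter> column_space ((D h)\<^sup>T) = column_space (cov_factor D h * X)"
    proof (intro equalityI subsetI)
      fix x assume x: "x \<in> S \<inter> column_space ((D h)\<^sup>T)"
      then obtain y z where y: "y \<in> carrier_vec m" "x = X *\<^sub>v y" and z: "z \<in> carrier_vec r" "x = (D h)\<^sup>T *\<^sub>v z"
        using S_range block_column_space[OF h(1)] by auto
      have "(cov_factor D h * X) *\<^sub>v ((1 / \<sigma> h) \<cdot>\<^sub>v y) = cov_factor D h *\<^sub>v (X *\<^sub>v ((1 / \<sigma> h) \<cdot>\<^sub>v y))"
        using y(1) by (intro assoc_mult_mat_vec[OF P X]) auto
      also have "\<dots> = (1 / \<sigma> h) \<cdot>\<^sub>v (cov_factor D h *\<^sub>v x)"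
        using P X y by (simp add: mult_mat_vec[OF X] mult_mat_vec[OF P])
      also have "cov_factor D h *\<^sub>v x = \<sigma> h \<cdot>\<^sub>v x"
        unfolding z(2) by (rule cov_factor_mult_vec[OF h(1) z(1)])
      also have "(1 / \<sigma> h) \<cdot>\<^sub>v (\<sigma> h \<cdot>\<^sub>v x) = x"
        using sigma_nonzero[OF h(1)] by (simp add: smult_smult_assoc)
      finally show "x \<in> column_space (cov_factor D h * X)"
        using PX y(1) unfolding column_space_eq_range
        by (intro CollectI exI[of _ "(1 / \<sigma> h) \<cdot>\<^sub>v y"]) auto
    next
      fix x assume "x \<in> column_space (cov_factor D h * X)"
      then obtain y where y: "y \<in> carrier_vec m" "x = (cov_factor D h * X) *\<^sub>v y"
        using PX by (auto simp: column_space_eq_range)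
      have Xy: "X *\<^sub>v y \<in> S" using y S_range by auto
      have x: "x = cov_factor D h *\<^sub>v (X *\<^sub>v y)"
        unfolding y(2) using y(1) by (intro assoc_mult_mat_vec[OF P X])
      then have "x \<in> S" using closed[OF h(2) Xy] by simp
      moreover have "x = (D h)\<^sup>T *\<^sub>v (mat_conj (D h) *\<^sub>v (X *\<^sub>v y))"
        unfolding x using c X y by (intro assoc_mult_mat_vec) auto
      then have "x \<in> column_space ((D h)\<^sup>T)"
        unfolding block_column_space[OF h(1)] using c(2) X y(1)
        by (intro CollectI exI[of _ "mat_conj (D h) *\<^sub>v (X *\<^sub>v y)"]) auto
      ultimately show "x \<in> S \<inter> column_space ((D h)\<^sup>T)" by simp
    qed
    have Cov_S: "Cov D js *\<^sub>v v \<in> S"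
      by (rule Cov_mult_vec_in[OF js S_c S(2)]) (rule closed)
    have "Cov D js *\<^sub>v v = (D h)\<^sup>T *\<^sub>v (M *\<^sub>v (mat_conj (D h) *\<^sub>v v))"
    proof -
      have "Cov D js *\<^sub>v v = ((D h)\<^sup>T * M) *\<^sub>v (mat_conj (D h) *\<^sub>v v)"
        unfolding Cov by (rule assoc_mult_mat_vec[OF mult_carrier_mat[OF c(1) M] c(2) v(2)])
      also have "\<dots> = (D h)\<^sup>T *\<^sub>v (M *\<^sub>v (mat_conj (D h) *\<^sub>v v))"
        using c(2) v(2) by (intro assoc_mult_mat_vec[OF c(1) M]) auto
      finally show ?thesis .
    qed
    also have "\<dots> = (D h)\<^sup>T *\<^sub>v (\<sigma> h \<cdot>\<^sub>v (M *\<^sub>v w))"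
      unfolding conj_v using mult_mat_vec[OF M w] by simp
    finally have Cov_v: "Cov D js *\<^sub>v v = (D h)\<^sup>T *\<^sub>v (\<sigma> h \<cdot>\<^sub>v (M *\<^sub>v w))" .
    have Mw: "M *\<^sub>v w \<in> carrier_vec r" using M w by simp
    have "Cov D js *\<^sub>v v \<in> column_space ((D h)\<^sup>T)"
      unfolding Cov_v block_column_space[OF h(1)] using Mw by auto
    then have "Cov D js *\<^sub>v v \<in> column_space (cov_factor D h * X)" "v \<in> column_space (cov_factor D h * X)"
      using Cov_S S(2) v(1) inter by auto
    then obtain a where a: "Cov D js *\<^sub>v v = a \<cdot>\<^sub>v v"
      using subspace_dim_1D[OF PX _ _ v0] S(3) inter by metis
    have "\<sigma> h \<cdot>\<^sub>v (\<sigma> h \<cdot>\<^sub>v (M *\<^sub>v w)) = mat_conj (D h) *\<^sub>v (a \<cdot>\<^sub>v v)"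
      using conj_block_mult_vec[OF h(1), of "\<sigma> h \<cdot>\<^sub>v (M *\<^sub>v w)"] Mw by (simp flip: a add: Cov_v)
    also have "\<dots> = a \<cdot>\<^sub>v (\<sigma> h \<cdot>\<^sub>v w)"
      using mult_mat_vec[OF c(2) v(2)] by (simp add: conj_v)
    finally have eq: "\<sigma> h \<cdot>\<^sub>v (\<sigma> h \<cdot>\<^sub>v (M *\<^sub>v w)) = a \<cdot>\<^sub>v (\<sigma> h \<cdot>\<^sub>v w)" .
    define y where "y = M *\<^sub>v w"
    have "y = (a / \<sigma> h) \<cdot>\<^sub>v w"
    proof (rule eq_vecI)
      fix i assume "i < dim_vec ((a / \<sigma> h) \<cdot>\<^sub>v w)"
      then have "i < r" using w by simp
      then have "\<sigma> h * (\<sigma> h * y $ i) = a * (\<sigma> h * w $ i)"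
        using arg_cong[OF eq[folded y_def], of "\<lambda>v. v $ i"] w Mw by (simp add: y_def[symmetric])
      then show "y $ i = ((a / \<sigma> h) \<cdot>\<^sub>v w) $ i"
        using sigma_nonzero[OF h(1)] \<open>i < r\<close> w by (simp add: field_simps)
    qed (use M w in \<open>simp add: y_def\<close>)
    then show ?thesis unfolding y_def by blast
  qed
  then show ?thesis
    using scalar_mat_if_all_eigenvectors[OF M] by (simp add: M_def h_def)
qed

end

section \<open>Construction of separation subspaces\<close>

text \<open>
  The perfect shuffle: it reorders \<open>c\<close> blocks of \<open>r\<close> rows into \<open>r\<close> families of \<open>c\<close> rows, the \<open>l\<close>-th of
  which collects the \<open>l\<close>-th row of every block. Its inverse is the shuffle with \<open>c\<close> and \<open>r\<close>
  exchanged.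
\<close>

definition shuffle :: "nat \<Rightarrow> nat \<Rightarrow> nat \<Rightarrow> nat" where
  "shuffle c r a = (if a < c * r then (a mod c) * r + a div c else a)"

lemma shuffle_index: "l < r \<Longrightarrow> i < c \<Longrightarrow> shuffle c r (l * c + i) = i * r + l"
  using uniform_index_less[of l r i c] by (simp add: shuffle_def mult.commute)

lemma index_decompose:
  assumes "a < c * (r::nat)"
  obtains l i where "l < r" "i < c" "a = l * c + i"
proof -
  have "c > 0" using assms by (cases c) auto
  then have "a mod c < c" "a = (a div c) * c + a mod c" by simp_all
  moreover have "a div c < r"
    using assms by (simp add: less_mult_imp_div_less mult.commute)
  ultimately show ?thesis using that by blast
qed

lemma shuffle_permutes: "shuffle c r permutes {..<c * r}"
proof (rule bij_imp_permutes)
  show "bij_betw (shuffle c r) {..<c * r} {..<c * r}"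
  proof (rule bij_betw_byWitness[where f' = "shuffle r c"])
    show "\<forall>a \<in> {..<c * r}. shuffle r c (shuffle c r a) = a"
    proof
      fix a assume "a \<in> {..<c * r}"
      then obtain l i where "l < r" "i < c" "a = l * c + i" using index_decompose by blast
      then show "shuffle r c (shuffle c r a) = a" by (simp add: shuffle_index)
    qed
    show "\<forall>a \<in> {..<c * r}. shuffle c r (shuffle r c a) = a"
    proof
      fix a assume "a \<in> {..<c * r}"
      then obtain l i where "l < c" "i < r" "a = l * r + i"
        using index_decompose[of a r c] by (auto simp: mult.commute)
      then show "shuffle c r (shuffle r c a) = a" by (simp add: shuffle_index)
    qed
    show "shuffle c r ` {..<c * r} \<subseteq> {..<c * r}"
    proof (intro image_subsetI)
      fix a assume "a \<in> {..<c * r}"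
      then obtain l i where "l < r" "i < c" "a = l * c + i" using index_decompose by blast
      then show "shuffle c r a \<in> {..<c * r}" using uniform_index_less[of i c l r] by (simp add: shuffle_index)
    qed
    show "shuffle r c ` {..<c * r} \<subseteq> {..<c * r}"
    proof (intro image_subsetI)
      fix a assume "a \<in> {..<c * r}"
      then obtain l i where "l < c" "i < r" "a = l * r + i"
        using index_decompose[of a r c] by (auto simp: mult.commute)
      then show "shuffle r c a \<in> {..<c * r}"
        using uniform_index_less[of i r l c] by (simp add: shuffle_index mult.commute)
    qed
  qed
qed (simp add: shuffle_def)

text \<open>
  If the rows \<open>m\<close> and \<open>l\<close> of any two of the rotated blocks are orthogonal whenever \<open>m \<noteq> l\<close>, then the
  families of equally numbered rows are mutually orthogonal and can be made block diagonal.
  The last equation describes the first separation subspace: it is spanned by the first rows.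
\<close>

lemma aligned_bases_separation_solution:
  fixes Ds :: "'a::real_or_complex mat list" and X :: "nat \<Rightarrow> 'a mat"
  assumes Ds: "\<forall>A \<in> set Ds. A \<in> carrier_mat r d" and r: "r > 0"
    and X: "\<And>i. i < length Ds \<Longrightarrow> unitary_mat r (X i)"
    and orth: "\<And>i j m l. i < length Ds \<Longrightarrow> j < length Ds \<Longrightarrow> m < r \<Longrightarrow> l < r \<Longrightarrow> m \<noteq> l \<Longrightarrow>
      (X i * Ds ! i * mat_adjoint (X j * Ds ! j)) $$ (m, l) = 0"
  shows "\<exists>E Hs L Bs. row_separation_solution d Ds E Hs L Bs \<and> 0 < length Bs \<and>
    mat_conj L * (block_row Bs 0)\<^sup>T = (mat (length Ds) d (\<lambda>(i, j). (X i * Ds ! i) $$ (0, j)))\<^sup>T"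
proof -
  define c where "c = length Ds"
  define K where "K i = X i * Ds ! i" for i
  have K: "K i \<in> carrier_mat r d" if "i < c" for i
    using that Ds unitary_mat_carrier[OF X] unfolding K_def c_def by (meson mult_carrier_mat nth_mem)
  define A where "A l = mat c d (\<lambda>(i, j). K i $$ (l, j))" for l
  define As where "As = map A [0..<r]"
  have Ac: "A l \<in> carrier_mat c d" for l by (simp add: A_def)
  have A_orth: "A m * mat_adjoint (A l) = 0\<^sub>m (dim_row (A m)) (dim_row (A l))" if ml: "m < r" "l < r" "m \<noteq> l" for m l
  proof (rule eq_matI)
    fix i j assume "i < dim_row (0\<^sub>m (dim_row (A m)) (dim_row (A l)) :: 'a mat)"
      "j < dim_col (0\<^sub>m (dim_row (A m)) (dim_row (A l)) :: 'a mat)"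
    then have ij: "i < c" "j < c" by (auto simp: A_def)
    have "(A m * mat_adjoint (A l)) $$ (i, j) = (\<Sum>s\<in>{0..<d}. K i $$ (m, s) * conjugate (K j $$ (l, s)))"
      using ij by (simp add: A_def scalar_prod_def)
    also have "\<dots> = (K i * mat_adjoint (K j)) $$ (m, l)"
      using ml K[OF ij(1)] K[OF ij(2)] by (simp add: scalar_prod_def)
    also have "\<dots> = 0"
      unfolding K_def using orth ij ml by (simp add: c_def)
    finally show "(A m * mat_adjoint (A l)) $$ (i, j) = 0\<^sub>m (dim_row (A m)) (dim_row (A l)) $$ (i, j)"
      using ij by (simp add: A_def)
  qed (simp_all add: A_def)
  have "sorted_wrt (\<lambda>A C. C * mat_adjoint A = 0\<^sub>m (dim_row C) (dim_row A)) As"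
    using A_orth by (simp add: As_def sorted_wrt_iff_nth_less)
  moreover have "\<forall>M \<in> set As. dim_col M = d" by (auto simp: As_def A_def)
  ultimately obtain L Bs where L: "unitary_mat d L" "map dim_row Bs = map dim_row As @ [0]"
    "stack_rows d As * L = diag_block_mat Bs"
    using orthogonal_families_block_diagonal by blast
  have lenB: "length Bs = Suc r" using arg_cong[OF L(2), of length] by (simp add: As_def)
  have B0: "dim_row (Bs ! 0) = c"
  proof -
    have "dim_row (Bs ! 0) = map dim_row Bs ! 0" using lenB by simp
    also have "\<dots> = c" unfolding L(2) using r by (simp add: As_def nth_append A_def)
    finally show ?thesis .
  qed
  define Hs where "Hs = map X [0..<c]"
  define Ks where "Ks = map K [0..<c]"
  \<comment> \<open>Row \<open>l * c + i\<close> after the permutation is row \<open>l\<close> of block \<open>i\<close>, which is row \<open>i * r + l\<close> before it.\<close>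
  define E :: "'a mat" where "E = mat (c * r) (c * r) (\<lambda>(i, j). if shuffle c r i = j then 1 else 0)"
  have Ds_nth: "Ds ! i \<in> carrier_mat r d" if "i < c" for i using Ds that by (simp add: c_def)
  have Hc: "X i \<in> carrier_mat r r" if "i < c" for i using X that unitary_mat_carrier by (auto simp: c_def)
  have rows_Ds: "sum_list (map dim_row Ds) = c * r"
    using Ds unfolding c_def by (induction Ds) auto
  have "list_all2 (\<lambda>H A. H \<in> carrier_mat (dim_row A) (dim_row A) \<and> dim_col A = d) Hs Ds"
    using Hc carrier_matD[OF Ds_nth] by (auto simp: list_all2_conv_all_nth Hs_def c_def)
  then have "diag_block_mat Hs * stack_rows d Ds = stack_rows d (map2 (*) Hs Ds)"
    by (rule diag_block_mat_mult_stack_rows)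
  moreover have "map2 (*) Hs Ds = Ks"
    by (rule nth_equalityI) (auto simp: Hs_def Ks_def K_def c_def)
  ultimately have HD: "diag_block_mat Hs * stack_rows d Ds = stack_rows d Ks" by simp
  have Ks: "\<forall>M \<in> set Ks. M \<in> carrier_mat r d" using K by (auto simp: Ks_def)
  have "map dim_row Hs = map dim_row Ds" "map dim_col Hs = map dim_row Ds"
    using carrier_matD[OF Hc] carrier_matD[OF Ds_nth] by (auto intro!: nth_equalityI simp: Hs_def c_def)
  then have Dg: "diag_block_mat Hs \<in> carrier_mat (c * r) (c * r)"
    by (intro carrier_matI) (simp_all add: dim_diag_block_mat rows_Ds)
  have stackD: "stack_rows d Ds \<in> carrier_mat (c * r) d" by (simp add: rows_Ds[symmetric])
  have stackK: "stack_rows d Ks \<in> carrier_mat (c * r) d"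
    using mult_carrier_mat[OF Dg stackD] by (simp add: HD)
  have Ec: "E \<in> carrier_mat (c * r) (c * r)" by (simp add: E_def)
  have rows_As: "sum_list (map dim_row As) = c * r"
    by (simp add: As_def o_def A_def sum_list_triv mult.commute)
  have As: "\<forall>M \<in> set As. M \<in> carrier_mat c d" using Ac by (auto simp: As_def)
  have EK: "E * stack_rows d Ks = stack_rows d As"
  proof (rule eq_matI)
    fix a j assume "a < dim_row (stack_rows d As)" "j < dim_col (stack_rows d As)"
    then have a: "a < c * r" and j: "j < d" by (simp_all add: rows_As)
    then obtain l i where li: "l < r" "i < c" "a = l * c + i" using index_decompose by blast
    have "(E * stack_rows d Ks) $$ (a, j) = stack_rows d Ks $$ (i * r + l, j)"
      unfolding E_def using permutation_mat_mult_index[OF shuffle_permutes stackK a j] li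
      by (simp add: shuffle_index)
    also have "\<dots> = Ks ! i $$ (l, j)"
      using li j by (intro index_stack_rows[OF Ks]) (auto simp: Ks_def)
    also have "\<dots> = As ! l $$ (i, j)"
      using li j by (simp add: Ks_def As_def A_def)
    also have "\<dots> = stack_rows d As $$ (a, j)"
      unfolding li(3) using li j by (intro index_stack_rows[OF As, symmetric]) (auto simp: As_def)
    finally show "(E * stack_rows d Ks) $$ (a, j) = stack_rows d As $$ (a, j)" .
  qed (use Ec in \<open>simp_all add: rows_As\<close>)
  have N_eq: "E * diag_block_mat Hs * stack_rows d Ds = stack_rows d As"
    unfolding EK[symmetric] HD[symmetric] by (rule assoc_mult_mat[OF Ec Dg stackD])
  have "permutation_mat (sum_list (map dim_row Ds)) E"
    unfolding permutation_mat_def rows_Ds E_def using shuffle_permutes by blast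
  moreover have "\<forall>i < length Ds. unitary_mat (dim_row (Ds ! i)) (Hs ! i)"
    using X carrier_matD(1)[OF Ds_nth] by (simp add: Hs_def c_def)
  ultimately have sol: "row_separation_solution d Ds E Hs L Bs"
    unfolding row_separation_solution_def N_eq using L by (simp add: Hs_def c_def)
  have stackA: "stack_rows d As \<in> carrier_mat (c * r) d" by (simp add: rows_As[symmetric])
  have "row_slice (stack_rows d As) 0 c = A 0"
  proof (rule eq_matI)
    fix i j assume "i < dim_row (A 0)" "j < dim_col (A 0)"
    then have ij: "i < c" "j < d" by (simp_all add: A_def)
    then show "row_slice (stack_rows d As) 0 c $$ (i, j) = A 0 $$ (i, j)"
      using index_stack_rows[OF As, of 0 i j] r by (simp add: row_slice_def As_def)
  qed (simp_all add: row_slice_def A_def)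
  then have "mat_conj L * (block_row Bs 0)\<^sup>T = (A 0)\<^sup>T"
    using separation_subspace_eq_row_span[OF L(1) stackA L(3), of 0] lenB by (simp add: B0)
  then show ?thesis
    using sol lenB unfolding A_def K_def c_def
    by (intro exI[of _ E] exI[of _ Hs] exI[of _ L] exI[of _ Bs]) simp
qed

context isoclinic_blocks
begin

text \<open>
  A common unitary factor \<open>W\<close> on the right keeps the Gram matrices scalar and is free to direct the
  first vector of one frame.
\<close>

lemma aligned_unitary_frames:
  assumes C: "C \<subseteq> I" and h: "h \<in> C" and r: "r > 0"
    and simple: "\<And>js. js \<noteq> [] \<Longrightarrow> distinct js \<Longrightarrow> set js \<subseteq> C \<Longrightarrow>
      scalar_mat r (path_product r Gram (js @ [hd js]))"
    and w: "w \<in> carrier_vec r" "w \<noteq> 0\<^sub>v r"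
  obtains Y t where "\<And>j. j \<in> C \<Longrightarrow> unitary_mat r (Y j)"
    "\<And>i j. i \<in> C \<Longrightarrow> j \<in> C \<Longrightarrow> scalar_mat r (mat_adjoint (Y i) * Gram i j * Y j)"
    "t \<noteq> 0" "col (Y h) 0 = t \<cdot>\<^sub>v w"
proof -
  interpret C: unitary_connection C r Gram
  proof
    fix i j assume "i \<in> C" "j \<in> C"
    then have ij: "i \<in> I" "j \<in> I" using C by auto
    show "Gram i j \<in> carrier_mat r r" by (rule carrier[OF ij])
    show "Gram j i = mat_adjoint (Gram i j)" by (rule adjoint[OF ij])
    show "\<exists>a U. unitary_mat r U \<and> Gram i j = a \<cdot>\<^sub>m U" if "Gram i j \<noteq> 0\<^sub>m r r"
      by (rule edge[OF ij that])
  qed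
  obtain U where U: "\<And>i. i \<in> C \<Longrightarrow> unitary_mat r (U i)"
    "\<And>i j. i \<in> C \<Longrightarrow> j \<in> C \<Longrightarrow> scalar_mat r (mat_adjoint (U i) * Gram i j * U j)"
    using C.gauge_to_scalars[OF simple] by blast
  \<comment> \<open>The first column of \<open>U h * W\<close> is a multiple of \<open>w\<close> if that of \<open>W\<close> is one of \<open>w'\<close>.\<close>
  define w' where "w' = mat_adjoint (U h) *\<^sub>v w"
  note Uh = unitary_mat_carrier[OF U(1)[OF h]]
  have w': "w' \<in> carrier_vec r" unfolding w'_def by (rule mult_mat_vec_carrier[OF mat_adjoint_carrier[OF Uh] w(1)])
  have "U h *\<^sub>v w' = (U h * mat_adjoint (U h)) *\<^sub>v w"
    unfolding w'_def by (rule assoc_mult_mat_vec[OF Uh mat_adjoint_carrier[OF Uh] w(1), symmetric])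
  then have Uw': "U h *\<^sub>v w' = w" using unitary_mat_right[OF U(1)[OF h]] w(1) by simp
  have "w' \<noteq> 0\<^sub>v r"
  proof
    assume "w' = 0\<^sub>v r"
    moreover have "U h *\<^sub>v 0\<^sub>v r = 0\<^sub>v r" using Uh by (intro eq_vecI) auto
    ultimately show False using Uw' w(2) by simp
  qed
  then obtain W t where W: "unitary_mat r W" "t \<noteq> 0" "col W 0 = t \<cdot>\<^sub>v w'"
    using unitary_mat_with_column[OF w' _ r] by blast
  note Wc = unitary_mat_carrier[OF W(1)]
  show ?thesis
  proof (rule that[of "\<lambda>j. U j * W" t])
    show "unitary_mat r (U j * W)" if "j \<in> C" for j
      using U(1)[OF that] W(1) by (rule unitary_mat_mult)
    show "col (U h * W) 0 = t \<cdot>\<^sub>v w"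
      unfolding col_mult2[OF Uh Wc r] W(3) mult_mat_vec[OF Uh w'] Uw' ..
    show "scalar_mat r (mat_adjoint (U i * W) * Gram i j * (U j * W))" if ij: "i \<in> C" "j \<in> C" for i j
    proof -
      note c = unitary_mat_carrier[OF U(1)[OF ij(1)]] unitary_mat_carrier[OF U(1)[OF ij(2)]]
        C.carrier[OF ij] mat_adjoint_carrier[OF Wc] mat_adjoint_carrier[OF unitary_mat_carrier[OF U(1)[OF ij(1)]]]
      obtain s where s: "mat_adjoint (U i) * Gram i j * U j = s \<cdot>\<^sub>m 1\<^sub>m r"
        using U(2)[OF ij] by (auto simp: scalar_mat_def)
      have "mat_adjoint (U i * W) * Gram i j * (U j * W)
          = mat_adjoint W * mat_adjoint (U i) * Gram i j * (U j * W)"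
        by (simp only: mat_adjoint_mult[OF c(1) Wc])
      also have "mat_adjoint W * mat_adjoint (U i) * Gram i j = mat_adjoint W * (mat_adjoint (U i) * Gram i j)"
        by (rule assoc_mult_mat[OF c(4,5,3)])
      also have "\<dots> * (U j * W) = mat_adjoint W * ((mat_adjoint (U i) * Gram i j * U j) * W)"
        by (rule mult_mat_middle[OF c(4) mult_carrier_mat[OF c(5,3)] c(2) Wc])
      also have "\<dots> = s \<cdot>\<^sub>m (mat_adjoint W * W)"
        unfolding s using Wc by (simp add: mult_smult_assoc_mat[of _ r r _ r] mult_smult_distrib[of _ r r _ r])
      also have "\<dots> = s \<cdot>\<^sub>m 1\<^sub>m r"
        unfolding unitary_mat_left[OF W(1)] ..
      finally show ?thesis unfolding scalar_mat_def by blast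
    qed
  qed (fact W(2))
qed

text \<open>
  In aligned frames \<open>Y j\<close> the \<open>m\<close>-th basis vector of one column space is orthogonal to the \<open>l\<close>-th of any
  other when \<open>m \<noteq> l\<close>. The first basis vectors \<open>u j\<close> of all blocks span a separation subspace \<open>S\<close>. A
  vector of \<open>S\<close> in the column space of block \<open>j\<close> is orthogonal to all its basis vectors but \<open>u j\<close>, so
  the intersection is the line through \<open>u j\<close>.
\<close>

lemma separation_subspace_exists:
  assumes C: "finite C" "C \<subseteq> I" and h: "h \<in> C" and r: "r > 0"
    and simple: "\<And>js. js \<noteq> [] \<Longrightarrow> distinct js \<Longrightarrow> set js \<subseteq> C \<Longrightarrow>
      scalar_mat r (path_product r Gram (js @ [hd js]))"
    and w: "w \<in> carrier_vec r" "w \<noteq> 0\<^sub>v r"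
  shows "\<exists>S. row_separation_subspace d (subset_subproblem D C) S \<and> (D h)\<^sup>T *\<^sub>v w \<in> S \<and>
    (\<forall>j \<in> C. subspace_dim d (S \<inter> column_space ((D j)\<^sup>T)) = 1)"
proof -
  obtain Y t where Y: "\<And>j. j \<in> C \<Longrightarrow> unitary_mat r (Y j)"
    and scal: "\<And>i j. i \<in> C \<Longrightarrow> j \<in> C \<Longrightarrow> scalar_mat r (mat_adjoint (Y i) * Gram i j * Y j)"
    and t: "t \<noteq> 0" "col (Y h) 0 = t \<cdot>\<^sub>v w"
    using aligned_unitary_frames[OF C(2) h r simple w] by blast
  define K where "K j = (Y j)\<^sup>T * D j" for j
  have Yc: "Y j \<in> carrier_mat r r" if "j \<in> C" for j using unitary_mat_carrier[OF Y[OF that]] .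
  have Dc: "D j \<in> carrier_mat r d" if "j \<in> C" for j using that C(2) block_carrier by auto
  have K: "K j \<in> carrier_mat r d" if "j \<in> C" for j
    unfolding K_def using Yc[OF that] Dc[OF that] by auto
  have KT: "(K j)\<^sup>T = (D j)\<^sup>T * Y j" if "j \<in> C" for j
    unfolding K_def using Yc[OF that] Dc[OF that] by (subst transpose_mult[of _ r r _ d]) auto
  have Kconj: "mat_conj (K j) = mat_adjoint (Y j) * mat_conj (D j)" if "j \<in> C" for j
    unfolding K_def using Yc[OF that] Dc[OF that]
    by (subst mat_conj_mult[of _ r r _ d]) (auto simp: mat_adjoint_conv(1))
  have KK: "mat_conj (K i) * (K j)\<^sup>T = mat_adjoint (Y i) * Gram i j * Y j" if ij: "i \<in> C" "j \<in> C" for i j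
  proof -
    have I: "i \<in> I" "j \<in> I" using ij C(2) by auto
    note c = mat_adjoint_carrier[OF Yc[OF ij(1)]] conj_carrier[OF I(1)] transpose_carrier[OF I(2)] Yc[OF ij(2)]
    have "mat_conj (K i) * (K j)\<^sup>T = mat_adjoint (Y i) * (Gram i j * Y j)"
      unfolding KT[OF ij(2)] Kconj[OF ij(1)] by (rule mult_mat_middle[OF c])
    also have "\<dots> = mat_adjoint (Y i) * Gram i j * Y j"
      by (rule assoc_mult_mat[OF c(1) carrier[OF I] c(4), symmetric])
    finally show ?thesis .
  qed
  have KK_offdiag: "(mat_conj (K i) * (K j)\<^sup>T) $$ (m, l) = 0"
    if ij: "i \<in> C" "j \<in> C" and ml: "m < r" "l < r" "m \<noteq> l" for i j m l
  proof -
    obtain s where "mat_conj (K i) * (K j)\<^sup>T = s \<cdot>\<^sub>m 1\<^sub>m r"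
      using scal[OF ij] unfolding KK[OF ij] scalar_mat_def by blast
    then show ?thesis using ml by (simp del: index_mult_mat(1))
  qed
  define Cs where "Cs = sorted_list_of_set C"
  have set_Cs: "set Cs = C" using C(1) by (simp add: Cs_def)
  define Ds where "Ds = subset_subproblem D C"
  have Ds_eq: "Ds = map D Cs" by (simp add: Ds_def subset_subproblem_def Cs_def)
  define c where "c = length Cs"
  have lenD: "length Ds = c" by (simp add: Ds_eq c_def)
  have nthC: "Cs ! i \<in> C" if "i < c" for i using that set_Cs by (auto simp: c_def)
  have Ds: "\<forall>A \<in> set Ds. A \<in> carrier_mat r d" using Dc by (auto simp: Ds_eq set_Cs)
  define X where "X i = (Y (Cs ! i))\<^sup>T" for i
  have XD: "X i * Ds ! i = K (Cs ! i)" if "i < c" for i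
    using that by (simp add: X_def K_def Ds_eq c_def)
  have "\<exists>E Hs L Bs. row_separation_solution d Ds E Hs L Bs \<and> 0 < length Bs \<and>
    mat_conj L * (block_row Bs 0)\<^sup>T = (mat (length Ds) d (\<lambda>(i, j). (X i * Ds ! i) $$ (0, j)))\<^sup>T"
  proof (rule aligned_bases_separation_solution[OF Ds r])
    show "unitary_mat r (X i)" if "i < length Ds" for i
      unfolding X_def using Y nthC that lenD by (intro unitary_mat_transpose) auto
    fix i j m l assume ij: "i < length Ds" "j < length Ds" and ml: "m < r" "l < r" "m \<noteq> l"
    have c: "Cs ! i \<in> C" "Cs ! j \<in> C" using nthC ij lenD by auto
    have "(K (Cs ! i) * mat_adjoint (K (Cs ! j))) $$ (m, l) = (mat_conj (K (Cs ! j)) * (K (Cs ! i))\<^sup>T) $$ (l, m)"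
      using ml K[OF c(1)] K[OF c(2)] by (simp add: scalar_prod_def mult.commute)
    also have "\<dots> = 0" using KK_offdiag[OF c(2,1) ml(2,1)] ml(3) by simp
    finally show "(X i * Ds ! i * mat_adjoint (X j * Ds ! j)) $$ (m, l) = 0"
      using XD ij lenD by simp
  qed
  then obtain E Hs L Bs where sol: "row_separation_solution d Ds E Hs L Bs" "0 < length Bs"
    and block: "mat_conj L * (block_row Bs 0)\<^sup>T = (mat c d (\<lambda>(i, j). (X i * Ds ! i) $$ (0, j)))\<^sup>T"
    unfolding lenD by blast
  define B where "B = (mat c d (\<lambda>(i, j). K (Cs ! i) $$ (0, j)))\<^sup>T"
  have B: "B \<in> carrier_mat d c" by (simp add: B_def)
  have B_eq: "mat_conj L * (block_row Bs 0)\<^sup>T = B"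
    unfolding block B_def by (intro eq_matI) (auto simp: XD)
  define S where "S = column_space B"
  have S: "S = {B *\<^sub>v y | y. y \<in> carrier_vec c}"
    using B by (simp add: S_def column_space_eq_range)
  define u where "u j = (K j)\<^sup>T *\<^sub>v unit_vec r 0" for j
  have u_c: "u j \<in> carrier_vec d" if "j \<in> C" for j using K[OF that] by (simp add: u_def)
  have u_S: "u j \<in> S" if j: "j \<in> C" for j
  proof -
    obtain i where i: "i < c" "j = Cs ! i" using j set_Cs by (metis c_def in_set_conv_nth)
    have "u j = B *\<^sub>v unit_vec c i"
      using i K[OF j] B r
      by (intro eq_vecI) (auto simp: u_def scalar_prod_right_unit, auto simp: B_def)
    then show ?thesis unfolding S by (auto intro!: exI[of _ "unit_vec c i"])
  qed
  have u_block: "u j = (D j)\<^sup>T *\<^sub>v col (Y j) 0" if j: "j \<in> C" for j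
  proof -
    have "u j = (D j)\<^sup>T *\<^sub>v (Y j *\<^sub>v unit_vec r 0)"
      unfolding u_def KT[OF j] using Yc[OF j] Dc[OF j] by (intro assoc_mult_mat_vec[of _ d r _ r]) auto
    moreover have "Y j *\<^sub>v unit_vec r 0 = col (Y j) 0"
      using Yc[OF j] r by (intro eq_vecI) (auto simp: scalar_prod_right_unit)
    ultimately show ?thesis by simp
  qed
  have colY: "col (Y j) 0 \<in> carrier_vec r" if "j \<in> C" for j using Yc[OF that] by auto
  have u_0: "u j \<noteq> 0\<^sub>v d" if j: "j \<in> C" for j
  proof
    assume "u j = 0\<^sub>v d"
    have jI: "j \<in> I" using j C(2) by auto
    have "mat_conj (D j) *\<^sub>v 0\<^sub>v d = 0\<^sub>v r" using conj_carrier[OF jI] by (intro eq_vecI) auto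
    then have z: "\<sigma> j \<cdot>\<^sub>v col (Y j) 0 = 0\<^sub>v r"
      using conj_block_mult_vec[OF jI colY[OF j]] u_block[OF j] \<open>u j = 0\<^sub>v d\<close> by simp
    have "col (Y j) 0 = 0\<^sub>v r"
      using smult_vec_eq_0D[OF colY[OF j] _ z] sigma_nonzero[OF jI] by blast
    then have "Y j $$ (i, 0) = 0" if "i < r" for i
      using arg_cong[of _ _ "\<lambda>v. v $ i"] that Yc[OF j] r by (metis index_col index_zero_vec(1) carrier_matD)
    then have "(mat_adjoint (Y j) * Y j) $$ (0, 0) = 0"
      using Yc[OF j] r by (simp add: scalar_prod_def)
    then show False using r by (simp add: unitary_mat_left[OF Y[OF j]])
  qed
  have v_S: "(D h)\<^sup>T *\<^sub>v w \<in> S"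
  proof -
    obtain y where y: "y \<in> carrier_vec c" "u h = B *\<^sub>v y" using u_S[OF h] S by auto
    have "u h = t \<cdot>\<^sub>v ((D h)\<^sup>T *\<^sub>v w)"
      unfolding u_block[OF h] t(2) using Dc[OF h] w(1) by (intro mult_mat_vec) auto
    then have "(D h)\<^sup>T *\<^sub>v w = (1 / t) \<cdot>\<^sub>v u h" using t(1) by (simp add: smult_smult_assoc)
    also have "\<dots> = B *\<^sub>v ((1 / t) \<cdot>\<^sub>v y)" unfolding y(2) using mult_mat_vec[OF B y(1)] by simp
    finally show ?thesis unfolding S using y(1) by (intro CollectI exI[of _ "(1 / t) \<cdot>\<^sub>v y"]) simp
  qed
  have inter: "S \<inter> column_space ((D j)\<^sup>T) = {a \<cdot>\<^sub>v u j | a. True}" if j: "j \<in> C" for j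
  proof (intro equalityI subsetI)
    have jI: "j \<in> I" using j C(2) by auto
    {
      fix x assume "x \<in> S \<inter> column_space ((D j)\<^sup>T)"
      then obtain y z where y: "y \<in> carrier_vec c" "x = B *\<^sub>v y" and z: "z \<in> carrier_vec r" "x = (D j)\<^sup>T *\<^sub>v z"
        using S block_column_space[OF jI] by auto
      define z' where "z' = mat_adjoint (Y j) *\<^sub>v z"
      have z': "z' \<in> carrier_vec r" unfolding z'_def
        by (rule mult_mat_vec_carrier[OF mat_adjoint_carrier[OF Yc[OF j]] z(1)])
      have "Y j *\<^sub>v z' = (Y j * mat_adjoint (Y j)) *\<^sub>v z"
        unfolding z'_def by (rule assoc_mult_mat_vec[OF Yc[OF j] mat_adjoint_carrier[OF Yc[OF j]] z(1), symmetric])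
      then have Yz': "Y j *\<^sub>v z' = z" using z(1) unitary_mat_right[OF Y[OF j]] by simp
      have x_K: "x = (K j)\<^sup>T *\<^sub>v z'"
        unfolding KT[OF j] z(2) Yz'[symmetric] using Yc[OF j] Dc[OF j] z'
        by (intro assoc_mult_mat_vec[symmetric, of _ d r _ r]) auto
      have xc: "x \<in> carrier_vec d" using y B by auto
      have "mat_conj (K j) *\<^sub>v x = mat_adjoint (Y j) *\<^sub>v (mat_conj (D j) *\<^sub>v x)"
        unfolding Kconj[OF j]
        by (rule assoc_mult_mat_vec[OF mat_adjoint_carrier[OF Yc[OF j]] conj_carrier[OF jI] xc])
      also have "mat_conj (D j) *\<^sub>v x = \<sigma> j \<cdot>\<^sub>v z"
        unfolding z(2) by (rule conj_block_mult_vec[OF jI z(1)])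
      also have "mat_adjoint (Y j) *\<^sub>v (\<sigma> j \<cdot>\<^sub>v z) = \<sigma> j \<cdot>\<^sub>v z'"
        unfolding z'_def by (rule mult_mat_vec[OF mat_adjoint_carrier[OF Yc[OF j]] z(1)])
      finally have Kx: "mat_conj (K j) *\<^sub>v x = \<sigma> j \<cdot>\<^sub>v z'" .
      have Kjc: "mat_conj (K j) \<in> carrier_mat r d" using K[OF j] by simp
      have "z' $ m = 0" if m: "m < r" "m \<noteq> 0" for m
      proof -
        have "mat_conj (K j) *\<^sub>v x = (mat_conj (K j) * B) *\<^sub>v y"
          unfolding y(2) by (rule assoc_mult_mat_vec[OF Kjc B y(1), symmetric])
        then have "\<sigma> j * z' $ m = ((mat_conj (K j) * B) *\<^sub>v y) $ m"
          using Kx z' m(1) by (metis carrier_vecD index_smult_vec(1))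
        also have "\<dots> = (\<Sum>i\<in>{0..<c}. (mat_conj (K j) * B) $$ (m, i) * y $ i)"
          by (rule index_mult_mat_vec_eq_sum[OF mult_carrier_mat[OF Kjc B] y(1) m(1)])
        also have "\<dots> = 0"
        proof (intro sum.neutral ballI)
          fix i assume "i \<in> {0..<c}"
          then have i: "i < c" by simp
          have "(mat_conj (K j) * B) $$ (m, i) = (mat_conj (K j) * (K (Cs ! i))\<^sup>T) $$ (m, 0)"
            using m(1) i r K[OF j] K[OF nthC[OF i]] by (simp add: B_def scalar_prod_def)
          also have "\<dots> = 0" by (rule KK_offdiag[OF j nthC[OF i] m(1) r m(2)])
          finally show "(mat_conj (K j) * B) $$ (m, i) * y $ i = 0" by simp
        qed
        finally show ?thesis using sigma_nonzero[OF jI] by simp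
      qed
      then have "z' = (z' $ 0) \<cdot>\<^sub>v unit_vec r 0"
        using z' r by (intro eq_vecI) auto
      then have "x = (K j)\<^sup>T *\<^sub>v ((z' $ 0) \<cdot>\<^sub>v unit_vec r 0)" using x_K by simp
      also have "\<dots> = (z' $ 0) \<cdot>\<^sub>v u j"
        unfolding u_def using K[OF j] by (intro mult_mat_vec[of _ d r]) auto
      finally show "x \<in> {a \<cdot>\<^sub>v u j | a. True}" by blast
    }
    fix x assume "x \<in> {a \<cdot>\<^sub>v u j | a. True}"
    then obtain a where a: "x = a \<cdot>\<^sub>v u j" by blast
    obtain y where y: "y \<in> carrier_vec c" "u j = B *\<^sub>v y" using u_S[OF j] S by auto
    have "x = B *\<^sub>v (a \<cdot>\<^sub>v y)" unfolding a y(2) using mult_mat_vec[OF B y(1)] by simp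
    then have "x \<in> S" unfolding S using y(1) by (intro CollectI exI[of _ "a \<cdot>\<^sub>v y"]) simp
    moreover have "x = (D j)\<^sup>T *\<^sub>v (a \<cdot>\<^sub>v col (Y j) 0)"
      unfolding a u_block[OF j] using mult_mat_vec[OF transpose_carrier[OF jI] colY[OF j]] by simp
    then have "x \<in> column_space ((D j)\<^sup>T)"
      unfolding block_column_space[OF jI] using colY[OF j]
      by (intro CollectI exI[of _ "a \<cdot>\<^sub>v col (Y j) 0"]) simp
    ultimately show "x \<in> S \<inter> column_space ((D j)\<^sup>T)" by simp
  qed
  have "S \<noteq> {0\<^sub>v d}" using u_S[OF h] u_0[OF h] by auto
  then have "row_separation_subspace d (subset_subproblem D C) S"
    unfolding row_separation_subspace_def S_def B_eq[symmetric] Ds_def[symmetric] using sol by blast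
  moreover have "\<forall>j \<in> C. subspace_dim d (S \<inter> column_space ((D j)\<^sup>T)) = 1"
  proof
    fix j assume j: "j \<in> C"
    show "subspace_dim d (S \<inter> column_space ((D j)\<^sup>T)) = 1"
      unfolding inter[OF j] by (rule subspace_dim_line[OF u_c[OF j] u_0[OF j]])
  qed
  ultimately show ?thesis using v_S by blast
qed

end

section \<open>Division problems\<close>

lemma division_problem_mono: "division_problem d k D n \<Longrightarrow> m \<le> n \<Longrightarrow> division_problem d k D m"
  by (induction n) (auto simp: le_Suc_eq)

lemma division_problem_rows:
  assumes "division_problem d k D n" "j \<in> {1..k + 1}"
  shows "dim_col (D j) = d" "mat_rank (D j) = dim_row (D j)"
proof -
  have "row_separation_problem d (map D [1..<k + 2])"
    using division_problem_mono[OF assms(1), of 0] by simp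
  moreover have "D j \<in> set (map D [1..<k + 2])" using assms(2) by (simp del: upt_Suc) 
  ultimately show "dim_col (D j) = d" "mat_rank (D j) = dim_row (D j)"
    unfolding row_separation_problem_def by blast+
qed

lemma division_problem_levels:
  assumes "division_problem d k D n"
  shows "n \<ge> 1 \<Longrightarrow> one_division k D" "n \<ge> 2 \<Longrightarrow> two_division k D" "n \<ge> 3 \<Longrightarrow> three_division k D"
    "4 \<le> m \<Longrightarrow> m \<le> n \<Longrightarrow> collection_division d k D m"
proof -
  show "one_division k D" if "n \<ge> 1" using division_problem_mono[OF assms, of "Suc 0"] that by simp
  show "two_division k D" if "n \<ge> 2"
    using division_problem_mono[OF assms, of "Suc (Suc 0)"] that by simp
  show "three_division k D" if "n \<ge> 3"
    using division_problem_mono[OF assms, of "Suc (Suc (Suc 0))"] that by simp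
  assume m: "4 \<le> m" "m \<le> n"
  then obtain l where "m = Suc l" "l \<ge> 3" by (cases m) auto
  then show "collection_division d k D m" using division_problem_mono[OF assms m(2)] by simp
qed

text \<open>
  The Gram matrix is Hermitian, so its only eigenvalue makes it scalar; the scalar is nonzero as
  otherwise \<open>A\<close> itself would vanish.
\<close>

lemma gram_scalar:
  fixes A :: "'a::real_or_complex mat"
  assumes ev: "card (eigenvalues (mat_conj A * A\<^sup>T)) = 1" and rank: "mat_rank A \<noteq> 0"
  shows "\<exists>\<sigma>. \<sigma> \<noteq> 0 \<and> mat_conj A * A\<^sup>T = \<sigma> \<cdot>\<^sub>m 1\<^sub>m (dim_row A)"
proof -
  define r where "r = dim_row A"
  define M where "M = mat_conj A * A\<^sup>T"
  obtain d where A: "A \<in> carrier_mat r d" by (metis r_def carrier_matI)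
  have M_adj: "M = mat_adjoint (A\<^sup>T) * A\<^sup>T" by (simp add: M_def mat_adjoint_transpose)
  have c: "A\<^sup>T \<in> carrier_mat d r" "mat_adjoint (A\<^sup>T) \<in> carrier_mat r d" using A by auto
  have M: "M \<in> carrier_mat r r" unfolding M_adj using c(2,1) by (rule mult_carrier_mat)
  have "mat_adjoint M = M" unfolding M_adj mat_adjoint_mult[OF c(2,1)] by simp
  moreover obtain \<mu> where "eigenvalues M = {\<mu>}" using ev by (auto simp: M_def card_1_singleton_iff)
  ultimately obtain \<sigma> where \<sigma>: "M = \<sigma> \<cdot>\<^sub>m 1\<^sub>m r"
    using normal_one_eigenvalue_scalar_mat[OF M, of \<mu>] by (auto simp: scalar_mat_def)
  have "\<sigma> \<noteq> 0"
  proof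
    assume "\<sigma> = 0"
    then have "M = 0\<^sub>m r r" unfolding \<sigma> by (intro eq_matI) auto
    then have "A\<^sup>T = 0\<^sub>m d r" using mat_adjoint_mult_self_eq_0D[OF c(1)] by (simp add: M_adj)
    then have "A = 0\<^sub>m r d" by (metis transpose_transpose zero_transpose_mat)
    then have "mat_rank A = 0" using vec_space.rank_0I[of r d] by (simp add: mat_rank_def)
    then show False using rank by simp
  qed
  then show ?thesis using \<sigma> by (auto simp: M_def r_def)
qed

text \<open>
  A nonzero multiple of a unitary matrix is square, so the number of rows is constant along the
  edges of the connected incidence graph.
\<close>

lemma two_division_same_rows:
  assumes "two_division k D" "i \<in> {1..k + 1}" "j \<in> {1..k + 1}"
  shows "dim_row (D i) = dim_row (D j)"
proof -
  have step: "dim_row (D i) = dim_row (D j)" if "(i, j) \<in> incidence k D" for i j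
  proof -
    have "one_singular_value (mat_conj (D i) * (D j)\<^sup>T)"
      "mat_conj (D i) * (D j)\<^sup>T \<noteq> 0\<^sub>m (dim_row (D i)) (dim_row (D j))"
      using assms(1) that by (auto simp: two_division_def incidence_def)
    then obtain a U where U: "unitary_mat (dim_row (D i)) U" "mat_conj (D i) * (D j)\<^sup>T = a \<cdot>\<^sub>m U"
      by (auto simp: one_singular_value_def)
    then have "dim_col (mat_conj (D i) * (D j)\<^sup>T) = dim_row (D i)"
      using unitary_mat_carrier[OF U(1)] by (auto simp del: index_mult_mat)
    then show ?thesis by simp
  qed
  have "(i, j) \<in> (incidence k D)\<^sup>*" using assms by (auto simp: two_division_def)
  then show ?thesis by (induction rule: rtrancl_induct) (auto simp: step)
qed

lemma division_problem_isoclinic: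
  fixes D :: "nat \<Rightarrow> 'a::real_or_complex mat"
  assumes prob: "division_problem d k D n" and n: "n \<ge> 2"
  obtains r \<sigma> where "r > 0" "isoclinic_blocks d r {1..k + 1} D \<sigma>"
proof -
  define r where "r = dim_row (D 1)"
  note levels = division_problem_levels[OF prob]
  have one: "one_division k D" and two: "two_division k D" using levels n by auto
  have rows: "dim_row (D j) = r" if "j \<in> {1..k + 1}" for j
    unfolding r_def using two_division_same_rows[OF two that, of 1] by simp
  have "\<forall>j. \<exists>\<sigma>. j \<in> {1..k + 1} \<longrightarrow> \<sigma> \<noteq> 0 \<and> mat_conj (D j) * (D j)\<^sup>T = \<sigma> \<cdot>\<^sub>m 1\<^sub>m r"
  proof (intro allI)
    fix j
    show "\<exists>\<sigma>. j \<in> {1..k + 1} \<longrightarrow> \<sigma> \<noteq> 0 \<and> mat_conj (D j) * (D j)\<^sup>T = \<sigma> \<cdot>\<^sub>m 1\<^sub>m r"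
    proof (cases "j \<in> {1..k + 1}")
      case True
      then have "card (eigenvalues (mat_conj (D j) * (D j)\<^sup>T)) = 1" "mat_rank (D j) \<ge> 2"
        using one by (auto simp: one_division_def)
      then show ?thesis using gram_scalar[of "D j"] rows[OF True] by auto
    next
      case False
      then show ?thesis by blast
    qed
  qed
  then obtain \<sigma> where \<sigma>: "\<And>j. j \<in> {1..k + 1} \<Longrightarrow> \<sigma> j \<noteq> 0 \<and> mat_conj (D j) * (D j)\<^sup>T = \<sigma> j \<cdot>\<^sub>m 1\<^sub>m r"
    by metis
  have "isoclinic_blocks d r {1..k + 1} D \<sigma>"
  proof
    fix j assume j: "j \<in> {1..k + 1}"
    show "D j \<in> carrier_mat r d" using rows[OF j] division_problem_rows(1)[OF prob j] by auto
    show "mat_conj (D j) * (D j)\<^sup>T = \<sigma> j \<cdot>\<^sub>m 1\<^sub>m r" "\<sigma> j \<noteq> 0" using \<sigma>[OF j] by simp_all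
  next
    fix i j assume "i \<in> {1..k + 1}" "j \<in> {1..k + 1}"
    then show "one_singular_value (mat_conj (D i) * (D j)\<^sup>T)" using two by (simp add: two_division_def)
  qed
  moreover have "r > 0"
  proof -
    have "mat_rank (D 1) \<ge> 2" using one by (simp add: one_division_def)
    then show ?thesis using division_problem_rows(2)[OF prob, of 1] by (simp add: r_def)
  qed
  ultimately show ?thesis using that by blast
qed

context isoclinic_blocks
begin

text \<open>
  Going along an edge and back multiplies a matrix by its adjoint, which is scalar for a multiple of
  a unitary matrix.
\<close>

lemma two_cycle_scalar:
  assumes "i \<in> I" "j \<in> I"
  shows "scalar_mat r (path_product r Gram [i, j, i])"
proof -
  note G = carrier[OF assms]
  have pp: "path_product r Gram [i, j, i] = Gram i j * mat_adjoint (Gram i j)"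
    using right_mult_one_mat[OF mat_adjoint_carrier[OF G]]
    by (simp only: path_product.simps adjoint[OF assms])
  show ?thesis
  proof (cases "Gram i j = 0\<^sub>m r r")
    case True
    have "path_product r Gram [i, j, i] = 0 \<cdot>\<^sub>m 1\<^sub>m r"
      unfolding pp True by (intro eq_matI) auto
    then show ?thesis unfolding scalar_mat_def by blast
  next
    case False
    then obtain a U where U: "unitary_mat r U" "Gram i j = a \<cdot>\<^sub>m U" using edge[OF assms] by blast
    have "path_product r Gram [i, j, i] = (a * conjugate a) \<cdot>\<^sub>m (U * mat_adjoint U)"
      unfolding pp U(2) mat_adjoint_smult using unitary_mat_carrier[OF U(1)]
      by (intro eq_matI) (auto simp: mult_ac)
    then show ?thesis unfolding unitary_mat_right[OF U(1)] scalar_mat_def by blast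
  qed
qed

lemma one_cycle_scalar:
  assumes "j \<in> I"
  shows "scalar_mat r (path_product r Gram [j, j])"
proof -
  have "path_product r Gram [j, j] = \<sigma> j \<cdot>\<^sub>m 1\<^sub>m r"
    using right_mult_one_mat[OF carrier[OF assms assms]] by (simp only: path_product.simps block_norm[OF assms])
  then show ?thesis unfolding scalar_mat_def by blast
qed

end

lemma collection_division_scalar:
  assumes "isoclinic_blocks d r {1..k + 1} D \<sigma>" and "collection_division d k D c"
    and js: "ordered_collection k c js" "js \<noteq> []"
  shows "scalar_mat r (path_product r (\<lambda>i j. mat_conj (D i) * (D j)\<^sup>T) (js @ [hd js]))"
proof -
  interpret isoclinic_blocks d r "{1..k + 1}" D \<sigma> by fact
  show ?thesis
  proof (rule scalar_if_separation_subspaces)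
    show "set js \<subseteq> {1..k + 1}" using js by (simp add: ordered_collection_def)
    show "\<exists>S. row_separation_subspace d (subset_subproblem D (set js)) S \<and> v \<in> S \<and>
        subspace_dim d (S \<inter> column_space ((D (hd js))\<^sup>T)) = 1"
      if "v \<in> column_space ((D (hd js))\<^sup>T)" for v
      using assms(2) js that hd_in_set[OF js(2)] unfolding collection_division_def by blast
  qed (fact js(2))
qed

text \<open>
  The condition of every level is used for the cycles of that length: \<open>1\<close>- and \<open>2\<close>-division for the
  trivial cycles, \<open>3\<close>-division for triangles, and \<open>m\<close>-division for cycles of length \<open>m\<close>.
\<close>

lemma division_problem_cycles_scalar:
  assumes blocks: "isoclinic_blocks d r {1..k + 1} D \<sigma>"
    and prob: "division_problem d k D n" and n: "n \<ge> 3"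
    and js: "js \<noteq> []" "distinct js" "set js \<subseteq> {1..k + 1}" "length js \<le> n"
  shows "scalar_mat r (path_product r (\<lambda>i j. mat_conj (D i) * (D j)\<^sup>T) (js @ [hd js]))"
proof -
  interpret isoclinic_blocks d r "{1..k + 1}" D \<sigma> by fact
  consider j where "js = [j]" | i j where "js = [i, j]" | i j l where "js = [i, j, l]" | "length js \<ge> 4"
    using js(1) by (cases js; cases "tl js"; cases "tl (tl js)"; cases "tl (tl (tl js))") auto
  then show ?thesis
  proof cases
    case 1
    then show ?thesis using one_cycle_scalar js(3) by simp
  next
    case 2
    then show ?thesis using two_cycle_scalar js(3) by simp
  next
    case 3
    have "card (eigenvalues (Cov D js) - {0}) \<le> 1"
      using division_problem_levels(3)[OF prob n] js(3) unfolding three_division_def 3 by simp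
    then show ?thesis using at_most_one_nonzero_eigenvalue_iff[OF js(1,3)] by simp
  next
    case 4
    have "collection_division d k D (length js)"
      using division_problem_levels(4)[OF prob 4 js(4)] .
    then show ?thesis
      using js by (intro collection_division_scalar[OF blocks]) (simp_all add: ordered_collection_def)
  qed
qed

lemma row_separation_subspace_zero:
  assumes "row_separation_subspace d Ds S"
  shows "0\<^sub>v d \<in> S"
proof -
  obtain E Hs L Bs t where sol: "row_separation_solution d Ds E Hs L Bs"
    and S: "S = column_space (mat_conj L * (block_row Bs t)\<^sup>T)"
    using assms unfolding row_separation_subspace_def by blast
  define M where "M = mat_conj L * (block_row Bs t)\<^sup>T"
  have M: "S = column_space M" "dim_row M = d"
    using S sol by (auto simp: M_def row_separation_solution_def unitary_mat_def)
  have "M *\<^sub>v 0\<^sub>v (dim_col M) = 0\<^sub>v d" using M(2) by (intro eq_vecI) auto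
  then show ?thesis unfolding M(1) column_space_eq_range by (metis (mono_tags) mem_Collect_eq zero_carrier_vec)
qed

text \<open>
  A simple cycle inside a collection of \<open>c\<close> blocks has length at most \<open>c\<close>, so scalar holonomy up to this
  length suffices to align all its frames.
\<close>

lemma collection_division_if_cycles_scalar:
  assumes "isoclinic_blocks d r {1..k + 1} D \<sigma>" and r: "r > 0"
    and cycles: "\<And>js. js \<noteq> [] \<Longrightarrow> distinct js \<Longrightarrow> set js \<subseteq> {1..k + 1} \<Longrightarrow> length js \<le> c \<Longrightarrow>
      scalar_mat r (path_product r (\<lambda>i j. mat_conj (D i) * (D j)\<^sup>T) (js @ [hd js]))"
    and c: "c > 0"
  shows "collection_division d k D c"
  unfolding collection_division_def
proof (intro allI impI ballI)
  interpret isoclinic_blocks d r "{1..k + 1}" D \<sigma> by fact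
  fix js v assume js: "ordered_collection k c js" and v: "v \<in> column_space ((D (hd js))\<^sup>T)"
  define h where "h = hd js"
  have js': "length js = c" "distinct js" "set js \<subseteq> {1..k + 1}" using js by (auto simp: ordered_collection_def)
  then have h: "h \<in> set js" using c by (auto simp: h_def)
  then have hI: "h \<in> {1..k + 1}" using js'(3) by blast
  have simple: "scalar_mat r (path_product r Gram (ks @ [hd ks]))"
    if "ks \<noteq> []" "distinct ks" "set ks \<subseteq> set js" for ks
  proof (rule cycles)
    show "length ks \<le> c"
      using card_mono[OF _ that(3)] that(2) js'(1,2) by (simp add: distinct_card)
  qed (use that js'(3) in auto)
  note ex = separation_subspace_exists[OF finite_set js'(3) h r simple]
  obtain w where w: "w \<in> carrier_vec r" "v = (D h)\<^sup>T *\<^sub>v w"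
    using v block_column_space[OF hI] by (auto simp: h_def)
  show "\<exists>S. row_separation_subspace d (subset_subproblem D (set js)) S \<and> v \<in> S \<and>
      (\<forall>j \<in> set js. subspace_dim d (S \<inter> column_space ((D j)\<^sup>T)) = 1)"
  proof (cases "w = 0\<^sub>v r")
    case False
    then show ?thesis using ex[OF _ _ _ w(1)] w(2) by blast
  next
    case True
    \<comment> \<open>The zero vector lies in every separation subspace, for instance in one through another vector.\<close>
    have "v = 0\<^sub>v d" unfolding w(2) True using transpose_carrier[OF hI] by (intro eq_vecI) auto
    moreover have "unit_vec r 0 \<noteq> (0\<^sub>v r :: 'a vec)" using r by (simp add: unit_vec_nonzero)
    ultimately show ?thesis
      using ex[of "unit_vec r 0"] row_separation_subspace_zero by (metis unit_vec_carrier)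
  qed
qed

theorem corollary4p30:
  fixes D :: "nat \<Rightarrow> 'a::real_or_complex mat" and d k c :: nat
  assumes "c \<ge> 4"
    and "division_problem d k D (c - 1)"
  shows "(division_problem d k D c \<longleftrightarrow>
            (\<forall>js. ordered_collection k c js \<longrightarrow> card (eigenvalues (Cov D js) - {0}) \<le> 1)) \<and>
         (\<not> division_problem d k D c \<longleftrightarrow>
            (\<exists>js. ordered_collection k c js \<and> card (eigenvalues (Cov D js) - {0}) \<ge> 2))"
proof -
  obtain r \<sigma> where r: "r > 0" and blocks: "isoclinic_blocks d r {1..k + 1} D \<sigma>"
  proof -
    have "c - 1 \<ge> 2" using assms(1) by simp
    then show ?thesis using division_problem_isoclinic[OF assms(2)] that by blast
  qed
  interpret isoclinic_blocks d r "{1..k + 1}" D \<sigma> by (fact blocks)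
  have nonempty: "js \<noteq> []" "set js \<subseteq> {1..k + 1}" if "ordered_collection k c js" for js
    using that assms(1) by (auto simp: ordered_collection_def)
  have iff: "card (eigenvalues (Cov D js) - {0}) \<le> 1 \<longleftrightarrow> scalar_mat r (path_product r Gram (js @ [hd js]))"
    if "ordered_collection k c js" for js
    by (rule at_most_one_nonzero_eigenvalue_iff[OF nonempty[OF that]])
  have "division_problem d k D c \<longleftrightarrow> collection_division d k D c"
  proof -
    obtain l where l: "c = Suc l" "l \<ge> 3" using assms(1) by (cases c) auto
    then show ?thesis using assms(2) by simp
  qed
  also have "\<dots> \<longleftrightarrow> (\<forall>js. ordered_collection k c js \<longrightarrow> card (eigenvalues (Cov D js) - {0}) \<le> 1)"
  proof
    assume "collection_division d k D c"
    then show "\<forall>js. ordered_collection k c js \<longrightarrow> card (eigenvalues (Cov D js) - {0}) \<le> 1"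
      using iff collection_division_scalar[OF blocks] nonempty by blast
  next
    assume ev: "\<forall>js. ordered_collection k c js \<longrightarrow> card (eigenvalues (Cov D js) - {0}) \<le> 1"
    show "collection_division d k D c"
    proof (rule collection_division_if_cycles_scalar[OF blocks r])
      fix js :: "nat list" assume js: "js \<noteq> []" "distinct js" "set js \<subseteq> {1..k + 1}" "length js \<le> c"
      show "scalar_mat r (path_product r Gram (js @ [hd js]))"
      proof (cases "length js = c")
        case True
        then have "ordered_collection k c js" using js by (simp add: ordered_collection_def)
        then show ?thesis using ev iff by blast
      next
        case False
        then show ?thesis
          using js assms(1) by (intro division_problem_cycles_scalar[OF blocks assms(2)]) auto
      qed
    qed (use assms(1) in simp)
  qed
  finally have main: "division_problem d k D c \<longleftrightarrow>
      (\<forall>js. ordered_collection k c js \<longrightarrow> card (eigenvalues (Cov D js) - {0}) \<le> 1)" .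
  moreover have "\<not> card A \<le> 1 \<longleftrightarrow> card A \<ge> 2" for A :: "complex set" by auto
  ultimately show ?thesis by blast
qed

end
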